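(* There exists $\epsilon_0>0$ such that, for all sufficiently large $n$ and every $4$-uniform hypergraph $\mathcal{H}$ on $2n$ vertices with $b(\mathcal{H})<\epsilon_0 n^4$, the following holds: if $\delta_3(\mathcal{H})\geq n-1$, then $\mathcal{H}$ has a Hamiltonian cycle.
   Context: A cycle in a $4$-graph is a cyclic sequence of distinct vertices $v_1,\dots,v_l$ such that $\{v_i,v_{i+1},v_{i+2},v_{i+3}\}$ is an edge for every $i=1,\dots,l$, indices taken modulo $l$; it is Hamiltonian if it contains all vertices. $\delta_3(\mathcal{H})$ is the minimum, over all $3$-sets $T$ of vertices, of the number of vertices $x$ with $T\cup\{x\}\in E(\mathcal{H})$. For a partition $V(\mathcal{H})=A\cup B$, $\mathcal{H}(A,A,B,B)=\{e\in E(\mathcal{H}):|e\cap A|=2\}$, and $b(\mathcal{H})=\min|\mathcal{H}(A,A,B,B)|$ over all partitions with $|A|=|B|=n$. *)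

theory Defs
  imports Complex_Main
begin

definition four_graph :: "'a set \<Rightarrow> 'a set set \<Rightarrow> bool" where
  "four_graph V E \<longleftrightarrow> finite V \<and> (\<forall>e\<in>E. e \<subseteq> V \<and> card e = 4)"

(* All indices are read modulo the length of the list. *)
definition cycle_in :: "'a set \<Rightarrow> 'a set set \<Rightarrow> 'a list \<Rightarrow> bool" where
  "cycle_in V E vs \<longleftrightarrow> vs \<noteq> [] \<and> distinct vs \<and> set vs \<subseteq> V \<and>
     (\<forall>i<length vs. {vs ! i, vs ! ((i + 1) mod length vs),
        vs ! ((i + 2) mod length vs), vs ! ((i + 3) mod length vs)} \<in> E)"

definition has_hamiltonian_cycle :: "'a set \<Rightarrow> 'a set set \<Rightarrow> bool" where
  "has_hamiltonian_cycle V E \<longleftrightarrow> (\<exists>vs. cycle_in V E vs \<and> set vs = V)"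

(* Min is only meaningful when card V \<ge> 3. In a 4-graph, T \<union> {x} \<in> E with
   card T = 3 forces x \<notin> T. *)
definition min_codegree3 :: "'a set \<Rightarrow> 'a set set \<Rightarrow> nat" where
  "min_codegree3 V E =
     Min ((\<lambda>T. card {x \<in> V. T \<union> {x} \<in> E}) ` {T. T \<subseteq> V \<and> card T = 3})"

definition edges_AABB :: "'a set set \<Rightarrow> 'a set \<Rightarrow> 'a set set" where
  "edges_AABB E A = {e \<in> E. card (e \<inter> A) = 2}"

(* Min is only meaningful when V is finite with card V = 2 * n, so that a
   balanced partition exists. *)
definition balanced_min :: "nat \<Rightarrow> 'a set \<Rightarrow> 'a set set \<Rightarrow> nat" where
  "balanced_min n V E =
     Min {card (edges_AABB E A) | A B.
       A \<union> B = V \<and> A \<inter> B = {} \<and> card A = n \<and> card B = n}"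

end

theory Submission
  imports Defs
begin

text \<open>A balanced partition with few $AABB$ edges forces almost all 4-sets meeting $A$ in an odd number of vertices to
be edges. Reassign the vertices whose links disagree with their side, and put the vertices with two dense links
into an exceptional set $Z$. Inside $A$ one can run along paths with pattern $ABA\,A\,ABA\,A\dots$, inside $B$ along
$BAB\,B\,BAB\,B\dots$; such long paths absorb any prescribed vertex sets because every vertex fits into most slots
(greedy choice of the triples by a potential function, then a matching of vertices to slots). A Hamiltonian cycle is
closed up from one path of each kind and two short pieces crossing from $A$ to $B$ and back, which also swallow $Z$.
With weight 1 on $A$ and 5 on $B$, one period of either pattern has weight 0 modulo 8, so the only remaining
obstruction is the residue modulo 8 of the total weight; crossings (through a vertex of $Z$, a pair without the typical
extensions, or an $AABB$ edge) and detours of different weights adjust it. That the required $AABB$ edges exist is where the exact bound $n - 1$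
on the codegree enters.\<close>

section \<open>Matchings, dense subfamilies and tight paths\<close>

text \<open>Consecutive windows of a tight path share three vertices. If both meet \<open>A\<close>
  in an odd number of vertices, the entering vertex has the class of the leaving one. A path in
  \<open>A \<union> B\<close> using only AAAB and ABBB edges thus repeats its first four classes
  forever and never leaves its pattern. This is the obstacle: each of the two switches needs an AABB
  edge or a vertex of \<open>Z\<close>. The weights 1 and 5 are chosen so that both periods, AAAB of
  weight 8 and ABBB of weight 16, vanish modulo 8. One typical choice fails for at most 10^-7 n
  vertices, so each averaging step costs a factor 10^7. Two scales run in parallel. At a single
  vertex the density 10^-37 of AABB edges leaves 10^-29 for bad triples and 10^-22 for bad pairs,
  enough to extend a path from anywhere. Globally the density 10^-108 leaves 10^-99 and 10^-92. This
  second scale is needed for the vertices of \<open>Z\<close>, whose links are only known to have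
  density 10^-38: atypical triples must be negligible even inside such a link. The size error
  10^-110 lies below both scales.\<close>

lemma matching_of_few_conflicts:
  fixes ok :: "'b \<Rightarrow> 'c \<Rightarrow> bool"
  assumes fin: "finite R" "finite S" and eq: "card R = card S"
    and left: "\<And>x. x \<in> R \<Longrightarrow> card {s \<in> S. \<not> ok x s} \<le> d1"
    and right: "\<And>s. s \<in> S \<Longrightarrow> card {x \<in> R. \<not> ok x s} \<le> d2"
    and less: "d1 + d2 < card R"
  shows "\<exists>f. bij_betw f R S \<and> (\<forall>x\<in>R. ok x (f x))"
proof -
  let ?m = "\<lambda>f. card {x \<in> R. \<not> ok x (f x)}"
  obtain f0 where "bij_betw f0 R S"
    using finite_same_card_bij[OF fin eq] by blast
  \<comment> \<open>a bijection with the fewest conflicts has none: any conflict could be repaired by a transposition\<close>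
  then obtain f where f: "bij_betw f R S" and least: "\<And>g. bij_betw g R S \<Longrightarrow> ?m f \<le> ?m g"
    using ex_has_least_nat[of "\<lambda>f. bij_betw f R S" f0 ?m] by blast
  have "\<forall>x\<in>R. ok x (f x)"
  proof (rule ccontr)
    assume "\<not> ?thesis"
    then obtain x0 where x0: "x0 \<in> R" "\<not> ok x0 (f x0)" by blast
    let ?P = "{x \<in> R. \<not> ok x0 (f x)}" and ?Q = "{x \<in> R. \<not> ok x (f x0)}"
    have "card ?P \<le> card {s \<in> S. \<not> ok x0 s}"
    proof (rule card_inj_on_le[of f])
      show "inj_on f ?P" using f by (auto simp: bij_betw_def inj_on_def)
      show "f ` ?P \<subseteq> {s \<in> S. \<not> ok x0 s}" using f by (auto simp: bij_betw_def)
    qed (use fin in auto)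
    moreover have "card ?Q \<le> d2"
      using right f x0(1) by (auto simp: bij_betw_def)
    ultimately have "card (?P \<union> ?Q) < card R"
      using left[OF x0(1)] less card_Un_le[of ?P ?Q] by linarith
    hence "\<not> R \<subseteq> ?P \<union> ?Q"
      using fin(1) card_mono[of "?P \<union> ?Q" R] by auto
    then obtain x1 where x1: "x1 \<in> R" "ok x0 (f x1)" "ok x1 (f x0)" by blast
    define g where "g = f(x0 := f x1, x1 := f x0)"
    have "bij_betw g R S"
    proof -
      have "inj_on g R" using f x0(1) x1(1)
        unfolding g_def bij_betw_def inj_on_def by auto
      moreover have "g ` R \<subseteq> S" using f x0(1) x1(1)
        unfolding g_def bij_betw_def by auto
      ultimately show ?thesis
        using fin eq by (metis bij_betw_def card_image card_subset_eq)
    qed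
    moreover have "{x \<in> R. \<not> ok x (g x)} \<subset> {x \<in> R. \<not> ok x (f x)}"
      using x0 x1 unfolding g_def by auto
    hence "?m g < ?m f" using fin by (intro psubset_card_mono) auto
    ultimately show False using least by (meson not_le)
  qed
  thus ?thesis using f by blast
qed

text \<open>Delete, as long as possible, all members that contain some pair of degree at most
  \<open>d\<close>. Such a pair disappears with its members and is struck from \<open>Q\<close>, so
  each pair costs at most \<open>d\<close> members.\<close>

lemma dense_core:
  fixes G :: "'b set set"
  assumes "finite G" "finite Q" and "\<And>T P. T \<in> G \<Longrightarrow> P \<subseteq> T \<Longrightarrow> card P = 2 \<Longrightarrow> P \<in> Q"
  shows "\<exists>G'\<subseteq>G. card G \<le> card G' + d * card Q \<and>
    (\<forall>T\<in>G'. \<forall>P\<subseteq>T. card P = 2 \<longrightarrow> d < card {T' \<in> G'. P \<subseteq> T'})"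
  using assms
proof (induction "card G" arbitrary: G Q rule: less_induct)
  case less
  show ?case
  proof (cases "\<forall>T\<in>G. \<forall>P\<subseteq>T. card P = 2 \<longrightarrow> d < card {T' \<in> G. P \<subseteq> T'}")
    case True
    thus ?thesis by (intro exI[of _ G]) auto
  next
    case False
    then obtain T P where TP: "T \<in> G" "P \<subseteq> T" "card P = 2" "card {T' \<in> G. P \<subseteq> T'} \<le> d"
      by (auto simp: not_less)
    define H where "H = {T' \<in> G. P \<subseteq> T'}"
    have PQ: "P \<in> Q" using less.prems(3) TP by blast
    have lt: "card (G - H) < card G"
      using TP less.prems(1) by (intro psubset_card_mono) (auto simp: H_def)
    have Q': "P' \<in> Q - {P}" if "T' \<in> G - H" "P' \<subseteq> T'" "card P' = 2" for T' P'
      using that less.prems(3) by (auto simp: H_def)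
    have "\<exists>G'\<subseteq>G - H. card (G - H) \<le> card G' + d * card (Q - {P}) \<and>
        (\<forall>T\<in>G'. \<forall>P\<subseteq>T. card P = 2 \<longrightarrow> d < card {T' \<in> G'. P \<subseteq> T'})"
      by (rule less.hyps[OF lt]) (use less.prems(1,2) Q' in auto)
    then obtain G' where G': "G' \<subseteq> G - H" "card (G - H) \<le> card G' + d * card (Q - {P})"
      "\<forall>T\<in>G'. \<forall>P\<subseteq>T. card P = 2 \<longrightarrow> d < card {T' \<in> G'. P \<subseteq> T'}"
      by (elim exE conjE) (rule that)
    have "H \<subseteq> G" by (auto simp: H_def)
    hence "card G = card (G - H) + card H"
      using less.prems(1) card_Un_disjoint[of "G - H" H] finite_subset[of H G]
      by (simp add: Un_absorb2 Int_commute)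
    moreover have "card Q = Suc (card (Q - {P}))"
      using PQ less.prems(2) by (metis card.remove)
    ultimately have "card G \<le> card G' + d * card Q"
      using G'(2) TP(4) by (simp add: H_def)
    thus ?thesis using G'(1,3) by (intro exI[of _ G']) auto
  qed
qed

section \<open>Tight paths: gluing, reversing, closing up\<close>

definition tight_path :: "'a set set \<Rightarrow> 'a list \<Rightarrow> bool" where
  "tight_path E xs \<longleftrightarrow> (\<forall>i. i + 3 < length xs \<longrightarrow>
     {xs ! i, xs ! (i + 1), xs ! (i + 2), xs ! (i + 3)} \<in> E)"

lemma tight_path_Cons [simp]:
  "tight_path E (a # b # c # d # xs) \<longleftrightarrow> {a, b, c, d} \<in> E \<and> tight_path E (b # c # d # xs)"
  (is "?l \<longleftrightarrow> ?r")
proof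
  assume l: ?l
  have "{(b # c # d # xs) ! i, (b # c # d # xs) ! (i + 1), (b # c # d # xs) ! (i + 2),
      (b # c # d # xs) ! (i + 3)} \<in> E" if "i + 3 < length (b # c # d # xs)" for i
    using l that unfolding tight_path_def by (auto dest: spec[of _ "Suc i"])
  moreover have "{a, b, c, d} \<in> E"
    using l unfolding tight_path_def by (auto dest: spec[of _ 0] simp: numeral_3_eq_3)
  ultimately show ?r unfolding tight_path_def by blast
next
  assume r: ?r
  show ?l unfolding tight_path_def
  proof (intro allI impI)
    fix i assume "i + 3 < length (a # b # c # d # xs)"
    thus "{(a # b # c # d # xs) ! i, (a # b # c # d # xs) ! (i + 1),
      (a # b # c # d # xs) ! (i + 2), (a # b # c # d # xs) ! (i + 3)} \<in> E"
      using r unfolding tight_path_def by (cases i) (auto simp: numeral_3_eq_3 numeral_2_eq_2)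
  qed
qed

lemma tight_path_short [simp]:
  "tight_path E []" "tight_path E [a]" "tight_path E [a, b]" "tight_path E [a, b, c]"
  by (auto simp: tight_path_def)

text \<open>An overlap of three vertices suffices because every window of four then lies wholly in
  \<open>xs @ ys\<close> or wholly in \<open>ys @ zs\<close>.\<close>

lemma tight_path_append:
  assumes "tight_path E (xs @ ys)" "tight_path E (ys @ zs)" "length ys \<ge> 3"
  shows "tight_path E (xs @ ys @ zs)"
  unfolding tight_path_def
proof (intro allI impI)
  fix i assume i: "i + 3 < length (xs @ ys @ zs)"
  let ?l = "xs @ ys @ zs"
  show "{?l ! i, ?l ! (i + 1), ?l ! (i + 2), ?l ! (i + 3)} \<in> E"
  proof (cases "i < length xs")
    case True
    hence lt: "i + 3 < length (xs @ ys)" using assms(3) by simp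
    have "?l ! j = (xs @ ys) ! j" if "j \<le> i + 3" for j
      using lt that by (metis append_assoc le_less_trans nth_append)
    thus ?thesis using assms(1) lt unfolding tight_path_def by simp
  next
    case False
    then obtain j where j: "i = length xs + j" by (metis le_Suc_ex not_less)
    have "?l ! (length xs + k) = (ys @ zs) ! k" for k by (simp add: nth_append)
    moreover have "j + 3 < length (ys @ zs)" using i j by simp
    ultimately show ?thesis using assms(2) unfolding tight_path_def j
      by (metis (no_types, lifting) add.assoc)
  qed
qed

lemma tight_path_glue:
  assumes "tight_path E (xs @ [a, b, c])" "tight_path E ([a, b, c] @ zs)"
  shows "tight_path E (xs @ [a, b, c] @ zs)"
  using tight_path_append[OF assms] by simp

lemma tight_path_rev:
  assumes "tight_path E xs" shows "tight_path E (rev xs)"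
  unfolding tight_path_def
proof (intro allI impI)
  fix i assume i: "i + 3 < length (rev xs)"
  define j where "j = length xs - 4 - i"
  have j: "j + 3 < length xs" "length xs - Suc i = j + 3" "length xs - Suc (i + 1) = j + 2"
    "length xs - Suc (i + 2) = j + 1" "length xs - Suc (i + 3) = j"
    using i by (auto simp: j_def)
  have "{xs ! j, xs ! (j + 1), xs ! (j + 2), xs ! (j + 3)} \<in> E"
    using assms j(1) unfolding tight_path_def by blast
  moreover have "rev xs ! i = xs ! (j + 3)" "rev xs ! (i + 1) = xs ! (j + 2)"
    "rev xs ! (i + 2) = xs ! (j + 1)" "rev xs ! (i + 3) = xs ! j"
    using i j by (simp_all add: rev_nth)
  ultimately show "{rev xs ! i, rev xs ! (i + 1), rev xs ! (i + 2), rev xs ! (i + 3)} \<in> E"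
    by (simp add: insert_commute)
qed

text \<open>Repeating the first three vertices at the end turns the windows that wrap around into
  ordinary ones.\<close>

lemma cycle_of_tight_path:
  assumes "tight_path E (xs @ take 3 xs)" "distinct xs" "length xs \<ge> 3" "set xs \<subseteq> V"
  shows "cycle_in V E xs"
proof -
  have nth: "(xs @ take 3 xs) ! k = xs ! (k mod length xs)" if "k < length xs + 3" for k
  proof (cases "k < length xs")
    case False
    hence "k mod length xs = (k - length xs) mod length xs" by (simp add: le_mod_geq)
    also have "\<dots> = k - length xs" using False that assms(3) by simp
    finally have "k mod length xs = k - length xs" .
    thus ?thesis using False that by (simp add: nth_append)
  qed (simp add: nth_append)
  have "{xs ! i, xs ! ((i + 1) mod length xs), xs ! ((i + 2) mod length xs),
      xs ! ((i + 3) mod length xs)} \<in> E" if i: "i < length xs" for i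
  proof -
    let ?l = "xs @ take 3 xs"
    have "{?l ! i, ?l ! (i + 1), ?l ! (i + 2), ?l ! (i + 3)} \<in> E"
      using assms(1,3) i unfolding tight_path_def by (auto simp: min_def)
    moreover have "?l ! i = xs ! i" using i by (simp add: nth_append)
    moreover have "?l ! (i + 1) = xs ! ((i + 1) mod length xs)"
      "?l ! (i + 2) = xs ! ((i + 2) mod length xs)"
      "?l ! (i + 3) = xs ! ((i + 3) mod length xs)"
      by (rule nth, use i in simp)+
    ultimately show ?thesis by simp
  qed
  thus ?thesis using assms unfolding cycle_in_def by auto
qed

section \<open>Double counting over fibres\<close>

lemma card_Sigma_mono:
  fixes e :: real
  assumes "finite X" "\<And>x. x \<in> X \<Longrightarrow> finite (S x)" "\<And>x. x \<in> X \<Longrightarrow> finite (T x)"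
    and "\<And>x. x \<in> X \<Longrightarrow> real (card (S x)) \<le> real (card (T x)) + e"
  shows "real (card (Sigma X S)) \<le> real (card (Sigma X T)) + e * real (card X)"
proof -
  have "real (card (Sigma X S)) = (\<Sum>x\<in>X. real (card (S x)))"
    using assms(1,2) by simp
  also have "\<dots> \<le> (\<Sum>x\<in>X. real (card (T x)) + e)" by (intro sum_mono assms(4))
  also have "\<dots> = real (card (Sigma X T)) + e * real (card X)"
    using assms(1,3) by (simp add: sum.distrib)
  finally show ?thesis .
qed

lemma card_Sigma_le:
  fixes k :: real
  assumes "finite X" "\<And>x. x \<in> X \<Longrightarrow> finite (S x)"
    and "\<And>x. x \<in> X \<Longrightarrow> real (card (S x)) \<le> k"
  shows "real (card (Sigma X S)) \<le> k * real (card X)"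
  using card_Sigma_mono[of X S "\<lambda>_. {}" k] assms by simp

lemma card_Sigma_ge:
  fixes k :: real
  assumes "finite X" "\<And>x. x \<in> X \<Longrightarrow> finite (S x)"
    and "\<And>x. x \<in> X \<Longrightarrow> k \<le> real (card (S x))"
  shows "k * real (card X) \<le> real (card (Sigma X S))"
  using card_Sigma_mono[of X "\<lambda>_. {}" S "-k"] assms by simp

text \<open>Used as Markov's inequality: a bound on the deviating tuples \<open>T\<close>, divided
  by the number of extensions that makes an element bad, bounds the number of bad elements.\<close>

lemma card_le_of_fibres:
  fixes k :: real
  assumes "finite T" "S \<subseteq> X" "finite X" "k > 0"
    and "\<And>x. x \<in> S \<Longrightarrow> k \<le> real (card {y. (x, y) \<in> T})"
  shows "k * real (card S) \<le> real (card T)"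
proof -
  have fin: "finite {y. (x, y) \<in> T}" for x
  proof (rule finite_subset)
    show "{y. (x, y) \<in> T} \<subseteq> snd ` T" by force
  qed (use assms(1) in simp)
  have "k * real (card S) \<le> real (card (Sigma S (\<lambda>x. {y. (x, y) \<in> T})))"
    using assms fin finite_subset by (intro card_Sigma_ge) auto
  also have "\<dots> \<le> real (card T)"
    using assms(1) by (intro of_nat_mono card_mono) auto
  finally show ?thesis .
qed

section \<open>The near-extremal partition\<close>

text \<open>The locale is symmetric in $A$ and $B$; statements about $B$ are read off from those about $A$ by interpreting
it with the two sides exchanged.\<close>

locale near_extremal =
  fixes V :: "'a set" and E :: "'a set set" and n :: nat and A B Z :: "'a set"
  assumes finV: "finite V" and cardV: "card V = 2 * n"
    and edge: "e \<in> E \<Longrightarrow> e \<subseteq> V \<and> card e = 4"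
    and codeg: "T \<subseteq> V \<Longrightarrow> card T = 3 \<Longrightarrow> n \<le> card {u \<in> V. insert u T \<in> E} + 1"
    and V_eq: "V = A \<union> B \<union> Z" and disj: "A \<inter> B = {}" "A \<inter> Z = {}" "B \<inter> Z = {}"
    and cardA_ge: "(1 - 1 / 10 ^ 110) * real n \<le> real (card A)"
    and cardB_ge: "(1 - 1 / 10 ^ 110) * real n \<le> real (card B)"
    and cardZ_le: "real (card Z) \<le> 1 / 10 ^ 110 * real n"
    and A_sparse: "v \<in> A \<Longrightarrow>
      real (card {(a, b, b'). a \<in> A \<and> b \<in> B \<and> b' \<in> B \<and> {v, a, b, b'} \<in> E}) \<le> 1 / 10 ^ 37 * real n ^ 3"
    and B_sparse: "v \<in> B \<Longrightarrow>
      real (card {(b, a, a'). b \<in> B \<and> a \<in> A \<and> a' \<in> A \<and> {v, b, a, a'} \<in> E}) \<le> 1 / 10 ^ 37 * real n ^ 3"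
    and Z_dense: "v \<in> Z \<Longrightarrow>
      1 / 10 ^ 38 * real n ^ 3 \<le> real (card {(b, a, a'). b \<in> B \<and> a \<in> A \<and> a' \<in> A \<and> {v, b, a, a'} \<in> E})"
      "v \<in> Z \<Longrightarrow>
      1 / 10 ^ 38 * real n ^ 3 \<le> real (card {(a, b, b'). a \<in> A \<and> b \<in> B \<and> b' \<in> B \<and> {v, a, b, b'} \<in> E})"
    and total_sparse: "real (card {(a, a', b, b'). a \<in> A \<and> a' \<in> A \<and> b \<in> B \<and> b' \<in> B \<and> {a, a', b, b'} \<in> E})
      \<le> 1 / 10 ^ 108 * real n ^ 4"
    and n_large: "10 ^ 200 \<le> n"
begin

lemma fin [simp]: "finite A" "finite B" "finite Z" "finite V"
  using finV V_eq by auto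

lemma not_mem: "x \<in> A \<Longrightarrow> x \<notin> B" "x \<in> B \<Longrightarrow> x \<notin> A" "x \<in> Z \<Longrightarrow> x \<notin> A" "x \<in> Z \<Longrightarrow> x \<notin> B"
  using disj by auto

lemma in_V: "x \<in> A \<Longrightarrow> x \<in> V" "x \<in> B \<Longrightarrow> x \<in> V" "x \<in> Z \<Longrightarrow> x \<in> V"
  using V_eq by auto

lemma swapped: "near_extremal V E n B A Z"
proof
  show "real (card {(b, b', a, a'). b \<in> B \<and> b' \<in> B \<and> a \<in> A \<and> a' \<in> A \<and> {b, b', a, a'} \<in> E})
      \<le> 1 / 10 ^ 108 * real n ^ 4" (is "real (card ?S) \<le> _")
  proof -
    let ?T = "{(a, a', b, b'). a \<in> A \<and> a' \<in> A \<and> b \<in> B \<and> b' \<in> B \<and> {a, a', b, b'} \<in> E}"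
    have "finite ?T" by (rule finite_subset[of _ "A \<times> A \<times> B \<times> B"]) auto
    moreover have "?S \<subseteq> (\<lambda>(a, a', b, b'). (b, b', a, a')) ` ?T"
    proof
      fix s assume "s \<in> ?S"
      then obtain b b' a a' where s: "s = (b, b', a, a')" and m: "b \<in> B" "b' \<in> B" "a \<in> A" "a' \<in> A"
        "{b, b', a, a'} \<in> E" by auto
      have "{b, b', a, a'} = {a, a', b, b'}" by auto
      hence "(a, a', b, b') \<in> ?T" using m by simp
      thus "s \<in> (\<lambda>(a, a', b, b'). (b, b', a, a')) ` ?T" unfolding s by (rule rev_image_eqI) simp
    qed
    ultimately have "card ?S \<le> card ?T" by (rule surj_card_le)
    thus ?thesis using total_sparse by linarith
  qed
next
  show "B \<inter> A = {}" "V = B \<union> A \<union> Z" using disj V_eq by auto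
qed (fact finV cardV edge codeg disj cardA_ge cardB_ge cardZ_le A_sparse B_sparse Z_dense n_large)+

lemma n_real: "(10::real) ^ 200 \<le> real n"
  using n_large by (metis of_nat_le_iff of_nat_numeral of_nat_power)

lemma n_pos [simp]: "0 < real n" "0 < n"
proof -
  show "0 < real n" by (rule less_le_trans[OF _ n_real]) simp
  thus "0 < n" by simp
qed

lemma one_le: "1 \<le> 1 / 10 ^ 200 * real n"
proof -
  have *: "1 \<le> 1 / c * x" if "0 < c" "c \<le> x" for c x :: real using that by (simp add: field_simps)
  show ?thesis by (rule *[OF _ n_real]) simp
qed

lemma card_sum: "card A + card B + card Z = 2 * n"
  using cardV V_eq disj card_Un_disjoint[of "A \<union> B" Z] card_Un_disjoint[of A B]
  by (simp add: Int_Un_distrib2)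

lemma cardA_le: "real (card A) \<le> (1 + 1 / 10 ^ 110) * real n"
  using card_sum cardB_ge by (simp add: algebra_simps)

lemma cardB_le: "real (card B) \<le> (1 + 1 / 10 ^ 110) * real n"
  using card_sum cardA_ge by (simp add: algebra_simps)

lemma card_bounds:
  "real (card A) \<le> 1001 / 1000 * real n" "real (card B) \<le> 1001 / 1000 * real n"
  "999 / 1000 * real n \<le> real (card A)" "999 / 1000 * real n \<le> real (card B)"
  using order_trans[OF cardA_le mult_right_mono, of "1001 / 1000"]
    order_trans[OF cardB_le mult_right_mono, of "1001 / 1000"]
    order_trans[OF mult_right_mono cardA_ge, of "999 / 1000"]
    order_trans[OF mult_right_mono cardB_ge, of "999 / 1000"] by simp_all

lemma codeg_split:
  assumes "x \<in> V" "y \<in> V" "z \<in> V" "x \<noteq> y" "y \<noteq> z" "x \<noteq> z"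
  shows "n \<le> card {u \<in> A. {x, y, z, u} \<in> E} + card {u \<in> B. {x, y, z, u} \<in> E}
    + card {u \<in> Z. {x, y, z, u} \<in> E} + 1"
proof -
  have "{u \<in> V. insert u {x, y, z} \<in> E} =
     {u \<in> A. {x, y, z, u} \<in> E} \<union> {u \<in> B. {x, y, z, u} \<in> E} \<union> {u \<in> Z. {x, y, z, u} \<in> E}"
    using V_eq by (auto simp: insert_commute)
  moreover have "card \<dots> \<le> card {u \<in> A. {x, y, z, u} \<in> E} + card {u \<in> B. {x, y, z, u} \<in> E}
    + card {u \<in> Z. {x, y, z, u} \<in> E}"
    using card_Un_le le_trans add_le_mono1 by meson
  ultimately show ?thesis using codeg[of "{x, y, z}"] assms by simp
qed

text \<open>The 4-sets on which the hypergraph deviates from the extremal one (edges are exactly the 4-sets meeting $A$ in an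
odd number of vertices); 4-sets inside $A$ or inside $B$ are left unconstrained. The predicates \<open>g3\<close>, \<open>g2\<close> and \<open>h3\<close>
below single out triples and pairs with few deviating extensions.\<close>

definition W :: "'a set \<Rightarrow> bool" where
  "W S \<longleftrightarrow> S \<subseteq> A \<union> B \<and> card S = 4 \<and>
     (card (S \<inter> A) = card (S \<inter> B) \<and> S \<in> E \<or> odd (card (S \<inter> A)) \<and> S \<notin> E)"

abbreviation cA :: "'a \<Rightarrow> nat" where "cA v \<equiv> (if v \<in> A then 1 else 0)"

lemma card4: "card {x, y, z, u} = 4 \<longleftrightarrow> distinct [x, y, z, u]"
  using distinct_card[of "[x, y, z, u]"] card_length[of "[x, y, z, u]"]
  by (auto simp: card_insert_if)

lemma card_Int_A:
  assumes "distinct [x, y, z, u]"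
  shows "card ({x, y, z, u} \<inter> A) = cA x + cA y + cA z + cA u"
  using assms by (auto simp: Int_insert_left)

lemma card_Int_AB:
  assumes "S \<subseteq> A \<union> B" "card S = 4"
  shows "card (S \<inter> A) + card (S \<inter> B) = 4"
proof -
  have "finite S" using assms(2) by (intro card_ge_0_finite) simp
  moreover have "S = (S \<inter> A) \<union> (S \<inter> B)" using assms(1) by auto
  moreover have "(S \<inter> A) \<inter> (S \<inter> B) = {}" using disj by auto
  ultimately show ?thesis using assms(2) card_Un_disjoint[of "S \<inter> A" "S \<inter> B"] by simp
qed

lemma W4:
  "W {x, y, z, u} \<longleftrightarrow> {x, y, z, u} \<subseteq> A \<union> B \<and> distinct [x, y, z, u] \<and>
     (cA x + cA y + cA z + cA u = 2 \<and> {x, y, z, u} \<in> E \<or>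
      odd (cA x + cA y + cA z + cA u) \<and> {x, y, z, u} \<notin> E)"
proof (cases "{x, y, z, u} \<subseteq> A \<union> B \<and> distinct [x, y, z, u]")
  case True
  define S k where "S = {x, y, z, u}" and "k = cA x + cA y + cA z + cA u"
  have k: "card (S \<inter> A) = k" and S: "S \<subseteq> A \<union> B" "card S = 4"
    using True card_Int_A[of x y z u] card4[of x y z u] unfolding S_def k_def by blast+
  have "card (S \<inter> A) = card (S \<inter> B) \<longleftrightarrow> k = 2" using card_Int_AB[OF S] k by linarith
  moreover have "distinct [x, y, z, u]" using True by blast
  ultimately show ?thesis using S k unfolding W_def S_def[symmetric] k_def[symmetric] by simp
next
  case False
  hence "\<not> ({x, y, z, u} \<subseteq> A \<union> B \<and> card {x, y, z, u} = 4)" unfolding card4 .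
  thus ?thesis using False unfolding W_def by argo
qed

section \<open>Conditions that hold for almost all vertices\<close>

definition few :: "real \<Rightarrow> ('a \<Rightarrow> bool) \<Rightarrow> bool" where
  "few e P \<longleftrightarrow> real (card {x \<in> A \<union> B. \<not> P x}) \<le> e * real n"

definition g3 :: "'a \<Rightarrow> 'a \<Rightarrow> 'a \<Rightarrow> bool" where
  "g3 x y z \<longleftrightarrow> few (1 / 10 ^ 7) (\<lambda>u. \<not> W {x, y, z, u})"

definition g2 :: "'a \<Rightarrow> 'a \<Rightarrow> bool" where
  "g2 x y \<longleftrightarrow> few (1 / 10 ^ 7) (g3 x y)"

definition h3 :: "'a \<Rightarrow> 'a \<Rightarrow> 'a \<Rightarrow> bool" where
  "h3 x y z \<longleftrightarrow> {x, y, z} \<subseteq> A \<union> B \<and> x \<noteq> y \<and> y \<noteq> z \<and> x \<noteq> z \<and>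
     g3 x y z \<and> g2 x y \<and> g2 y z \<and> g2 x z"

lemma g3_commute: "g3 x y z = g3 y x z" "g3 x y z = g3 x z y" "g3 x y z = g3 z y x"
  unfolding g3_def by (simp_all add: insert_commute)

lemma g2_commute: "g2 x y = g2 y x"
proof -
  have "g3 x y = g3 y x" using g3_commute(1) by (intro ext)
  thus ?thesis unfolding g2_def by simp
qed

lemma h3_commute: "h3 x y z = h3 y x z" "h3 x y z = h3 x z y" "h3 x y z = h3 z y x"
  using g3_commute[of x y z] g2_commute[of x y] g2_commute[of y z] g2_commute[of x z]
  by (simp_all add: h3_def conj_ac eq_commute)

lemma swap_W: "near_extremal.W E B A = W"
proof
  fix S
  interpret sw: near_extremal V E n B A Z by (rule swapped)
  have "odd (card (S \<inter> B)) \<longleftrightarrow> odd (card (S \<inter> A))" if "S \<subseteq> A \<union> B" "card S = 4"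
    using card_Int_AB[OF that] by presburger
  thus "near_extremal.W E B A S = W S" unfolding W_def sw.W_def by (auto simp: Un_commute)
qed

lemma swap_few: "near_extremal.few n B A = few"
proof (intro ext)
  fix e P
  interpret sw: near_extremal V E n B A Z by (rule swapped)
  show "near_extremal.few n B A e P = few e P" unfolding few_def sw.few_def by (simp add: Un_commute)
qed

lemma swap_g3: "near_extremal.g3 E n B A = g3"
proof (intro ext)
  fix x y z
  interpret sw: near_extremal V E n B A Z by (rule swapped)
  show "near_extremal.g3 E n B A x y z = g3 x y z" unfolding g3_def sw.g3_def by (simp add: swap_W swap_few)
qed

lemma swap_g2: "near_extremal.g2 E n B A = g2"
proof (intro ext)
  fix x y
  interpret sw: near_extremal V E n B A Z by (rule swapped)
  show "near_extremal.g2 E n B A x y = g2 x y" unfolding g2_def sw.g2_def by (simp add: swap_g3 swap_few)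
qed

lemma swap_h3: "near_extremal.h3 E n B A = h3"
proof (intro ext)
  fix x y z
  interpret sw: near_extremal V E n B A Z by (rule swapped)
  show "near_extremal.h3 E n B A x y z = h3 x y z"
    unfolding h3_def sw.h3_def by (simp add: swap_g3 swap_g2 Un_commute)
qed

lemmas swap = swap_W swap_few swap_g3 swap_g2 swap_h3

lemma few_mono: "few e P \<Longrightarrow> e \<le> e' \<Longrightarrow> few e' P"
  unfolding few_def by (meson mult_right_mono of_nat_0_le_iff order_trans)

lemma few_notin:
  assumes "finite F" "real (card F) \<le> e * real n"
  shows "few e (\<lambda>x. x \<notin> F)"
proof -
  have "card {x \<in> A \<union> B. \<not> x \<notin> F} \<le> card F" using assms(1) by (intro card_mono) auto
  thus ?thesis using assms(2) unfolding few_def by linarith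
qed

lemma few_neq: "few (1 / 10 ^ 7) (\<lambda>x. x \<noteq> y)"
  using few_notin[of "{y}" "1 / 10 ^ 7"] n_real by simp

lemma few_g3: "g2 x y \<Longrightarrow> few (1 / 10 ^ 7) (g3 x y)"
  unfolding g2_def .

lemma few_W: "g3 x y z \<Longrightarrow> few (1 / 10 ^ 7) (\<lambda>u. \<not> W {x, y, z, u})"
  unfolding g3_def .

lemma few_all:
  assumes "\<forall>P\<in>set Ps. few e P"
  shows "few (real (length Ps) * e) (\<lambda>x. \<forall>P\<in>set Ps. P x)"
  using assms
proof (induction Ps)
  case Nil
  thus ?case by (simp add: few_def)
next
  case (Cons P Ps)
  have "{x \<in> A \<union> B. \<not> (\<forall>P\<in>set (P # Ps). P x)} =
    {x \<in> A \<union> B. \<not> P x} \<union> {x \<in> A \<union> B. \<not> (\<forall>P\<in>set Ps. P x)}" by auto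
  hence "card {x \<in> A \<union> B. \<not> (\<forall>P\<in>set (P # Ps). P x)} \<le>
    card {x \<in> A \<union> B. \<not> P x} + card {x \<in> A \<union> B. \<not> (\<forall>P\<in>set Ps. P x)}"
    by (simp only: card_Un_le)
  thus ?case using Cons unfolding few_def by (simp add: algebra_simps)
qed

text \<open>A hundred conditions, each failing for at most 10^-7 n vertices, exclude at most 10^-5 n
  of them, fewer than \<open>C\<close> contains.\<close>

lemma pick:
  assumes "\<forall>P\<in>set Ps. few (1 / 10 ^ 7) P" "length Ps \<le> 100"
    and "C \<subseteq> A \<union> B" "1 / 1000 * real n \<le> real (card C)"
  shows "\<exists>u\<in>C. \<forall>P\<in>set Ps. P u"
proof (rule ccontr)
  assume "\<not> ?thesis"
  hence "C \<subseteq> {x \<in> A \<union> B. \<not> (\<forall>P\<in>set Ps. P x)}" using assms(3) by blast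
  moreover have "finite {x \<in> A \<union> B. \<not> (\<forall>P\<in>set Ps. P x)}"
    by (rule finite_subset[of _ "A \<union> B"]) auto
  ultimately have "card C \<le> card {x \<in> A \<union> B. \<not> (\<forall>P\<in>set Ps. P x)}" by (intro card_mono)
  also have "real \<dots> \<le> real (length Ps) * (1 / 10 ^ 7) * real n"
    using few_all[OF assms(1)] unfolding few_def .
  also have "\<dots> \<le> 100 * (1 / 10 ^ 7) * real n" using assms(2) by (intro mult_right_mono) auto
  also have "\<dots> < 1 / 1000 * real n" using n_pos by simp
  finally show False using assms(4) by linarith
qed

lemma odd_edge:
  assumes "\<not> W {x, y, z, u}" "{x, y, z, u} \<subseteq> A \<union> B" "distinct [x, y, z, u]"
    and "odd (cA x + cA y + cA z + cA u)"
  shows "{x, y, z, u} \<in> E"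
  using assms W4 by blast

text \<open>The triple has codegree at least n - 1, while \<open>A\<close> has barely more than n
  vertices and \<open>Z\<close> hardly any. So every missing AAAB extension must be made up for by
  an AABB one. This is how sparsity of AABB edges controls the missing odd sets.\<close>

lemma missing_A:
  assumes "x \<in> A" "y \<in> A" "z \<in> B" "x \<noteq> y"
  shows "real (card {q \<in> A. W {x, y, z, q}}) \<le> real (card {b \<in> B. {x, y, z, b} \<in> E}) + 3 / 10 ^ 110 * real n"
proof -
  have "{q \<in> A. W {x, y, z, q}} \<inter> {q \<in> A. {x, y, z, q} \<in> E} = {}"
    using assms not_mem by (auto simp: W4)
  hence "card {q \<in> A. W {x, y, z, q}} + card {q \<in> A. {x, y, z, q} \<in> E} =
     card ({q \<in> A. W {x, y, z, q}} \<union> {q \<in> A. {x, y, z, q} \<in> E})"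
    by (simp add: card_Un_disjoint)
  also have "\<dots> \<le> card A" by (intro card_mono) auto
  finally have "card {q \<in> A. W {x, y, z, q}} + card {q \<in> A. {x, y, z, q} \<in> E} \<le> card A" .
  moreover have "n \<le> card {u \<in> A. {x, y, z, u} \<in> E} + card {u \<in> B. {x, y, z, u} \<in> E}
    + card {u \<in> Z. {x, y, z, u} \<in> E} + 1" using assms in_V not_mem by (intro codeg_split) blast+
  moreover have "card {u \<in> Z. {x, y, z, u} \<in> E} \<le> card Z" by (intro card_mono) auto
  ultimately have "real (card {q \<in> A. W {x, y, z, q}}) + real n \<le> real (card A) +
      real (card {b \<in> B. {x, y, z, b} \<in> E}) + real (card Z) + 1" by linarith
  thus ?thesis using cardA_le cardZ_le one_le by (simp add: algebra_simps)
qed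

lemma missing_B:
  assumes "x \<in> B" "y \<in> B" "z \<in> A" "x \<noteq> y"
  shows "real (card {q \<in> B. W {x, y, z, q}}) \<le> real (card {a \<in> A. {x, y, z, a} \<in> E}) + 3 / 10 ^ 110 * real n"
proof -
  interpret sw: near_extremal V E n B A Z by (rule swapped)
  show ?thesis using sw.missing_A[OF assms] by (simp add: swap)
qed

end

text \<open>Evaluating only the powers of ten, and not the fractions they occur in, keeps linear arithmetic fast.\<close>

lemmas pow_simps = power_numeral Num.pow.simps Num.sqr.simps mult_num_simps add_num_simps

lemma card_preimage_le:
  assumes "finite T" "inj f"
  shows "card {x. f x \<in> T} \<le> card T"
  using card_vimage_inj_on_le[of f UNIV T] assms by (simp add: vimage_def)

context near_extremal begin

section \<open>Counting deviating 4-sets, globally and at a fixed vertex\<close>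

lemma W_distinct: "W {x, y, z, u} \<Longrightarrow> distinct [x, y, z, u]"
  unfolding W4 by blast

text \<open>A deviating set through \<open>v\<close> is an AABB edge, counted by \<open>T\<close>,
  or a missing AAAB or ABBB set, charged to \<open>T\<close> by \<open>missing_A\<close> and
  \<open>missing_B\<close>. Three, three and one arrangements of the classes of p, q, u give the
  factor 7.\<close>

lemma W_triples_A:
  assumes v: "v \<in> A"
  defines "T \<equiv> {(a, b, b'). a \<in> A \<and> b \<in> B \<and> b' \<in> B \<and> {v, a, b, b'} \<in> E}"
  shows "real (card {(p, q, u). p \<in> A \<union> B \<and> q \<in> A \<union> B \<and> u \<in> A \<union> B \<and> W {v, p, q, u}})
    \<le> 7 * real (card T) + 100 / 10 ^ 110 * real n ^ 3"
proof -
  define T2 where "T2 = Sigma (A \<times> B) (\<lambda>(p, z). {q \<in> A. W {v, p, z, q}})"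
  define T3 where "T3 = Sigma (B \<times> B) (\<lambda>(p, z). {q \<in> B. W {p, z, v, q}})"
  let ?S = "{(p, q, u). p \<in> A \<union> B \<and> q \<in> A \<union> B \<and> u \<in> A \<union> B \<and> W {v, p, q, u}}"
  have finT: "finite T" unfolding T_def by (rule finite_subset[of _ "A \<times> B \<times> B"]) auto
  have fin2: "finite T2" "finite T3" unfolding T2_def T3_def by auto
  have sq: "real (card (X \<times> Y)) \<le> 2 * real n ^ 2" if "X = A \<or> X = B" "Y = A \<or> Y = B" for X Y
  proof -
    have "real (card X) \<le> 1.1 * real n" "real (card Y) \<le> 1.1 * real n"
      using that card_bounds(1,2) n_pos(1) by auto
    hence "real (card X) * real (card Y) \<le> 1.1 * real n * (1.1 * real n)" by (intro mult_mono) auto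
    also have "\<dots> \<le> 2 * (real n * real n)" using zero_le_square[of "real n"] by linarith
    finally show ?thesis by (simp add: card_cartesian_product power2_eq_square)
  qed
  have T2: "real (card T2) \<le> real (card T) + 10 / 10 ^ 110 * real n ^ 3"
  proof -
    let ?U = "Sigma (A \<times> B) (\<lambda>(p, z). {b \<in> B. {v, p, z, b} \<in> E})"
    have "real (card T2) \<le> real (card ?U) + 3 / 10 ^ 110 * real n * real (card (A \<times> B))"
      unfolding T2_def
    proof (rule card_Sigma_mono, goal_cases)
      case (4 x)
      obtain p z where x: "x = (p, z)" "p \<in> A" "z \<in> B" using 4 by auto
      show ?case
      \<comment> \<open>\<open>missing_A\<close> needs two different vertices of \<open>A\<close>;
        the degenerate case contributes nothing, since \<open>W\<close> requires four distinct
        vertices.\<close>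
      proof (cases "p = v")
        case True
        hence "{q \<in> A. W {v, p, z, q}} = {}" using W_distinct by fastforce
        thus ?thesis unfolding x(1) prod.case by (simp only: card.empty) simp
      next
        case False
        show ?thesis using missing_A[OF v x(2,3) False[symmetric]] x(1) by simp
      qed
    qed auto
    moreover have "3 / 10 ^ 110 * real n * real (card (A \<times> B)) \<le> 3 / 10 ^ 110 * real n * (2 * real n ^ 2)"
      by (intro mult_left_mono sq) auto
    moreover have "card ?U \<le> card T"
    proof -
      have "?U = {x. (\<lambda>((p, z), b). (p, z, b)) x \<in> T}" by (auto simp: T_def)
      moreover have "inj (\<lambda>((p, z), b). (p, z, b))" by (auto simp: inj_on_def)
      ultimately show ?thesis using card_preimage_le[OF finT] by simp
    qed
    moreover have "3 / 10 ^ 110 * real n * (2 * real n ^ 2) = 6 / 10 ^ 110 * real n ^ 3"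
      by (simp add: power2_eq_square power3_eq_cube)
    moreover have "0 \<le> real n ^ 3" by simp
    ultimately show ?thesis by (simp only: pow_simps; linarith)
  qed
  have T3: "real (card T3) \<le> real (card T) + 10 / 10 ^ 110 * real n ^ 3"
  proof -
    let ?U = "Sigma (B \<times> B) (\<lambda>(p, z). {a \<in> A. {p, z, v, a} \<in> E})"
    have "real (card T3) \<le> real (card ?U) + 3 / 10 ^ 110 * real n * real (card (B \<times> B))"
      unfolding T3_def
    proof (rule card_Sigma_mono, goal_cases)
      case (4 x)
      obtain p z where x: "x = (p, z)" "p \<in> B" "z \<in> B" using 4 by auto
      show ?case
      proof (cases "p = z")
        case True
        hence "{q \<in> B. W {p, z, v, q}} = {}" using W_distinct by fastforce
        thus ?thesis unfolding x(1) prod.case by (simp only: card.empty) simp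
      next
        case False
        show ?thesis using missing_B[OF x(2,3) v False] x(1) by simp
      qed
    qed auto
    moreover have "3 / 10 ^ 110 * real n * real (card (B \<times> B)) \<le> 3 / 10 ^ 110 * real n * (2 * real n ^ 2)"
      by (intro mult_left_mono sq) auto
    moreover have "card ?U \<le> card T"
    proof -
      have "{p, z, v, a} = {v, a, p, z}" for p z a by auto
      hence "?U = {x. (\<lambda>((p, z), a). (a, p, z)) x \<in> T}" by (auto simp: T_def)
      moreover have "inj (\<lambda>((p, z), a). (a, p, z))" by (auto simp: inj_on_def)
      ultimately show ?thesis using card_preimage_le[OF finT] by simp
    qed
    moreover have "3 / 10 ^ 110 * real n * (2 * real n ^ 2) = 6 / 10 ^ 110 * real n ^ 3"
      by (simp add: power2_eq_square power3_eq_cube)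
    moreover have "0 \<le> real n ^ 3" by simp
    ultimately show ?thesis by (simp only: pow_simps; linarith)
  qed
  \<comment> \<open>\<open>?P1\<close> to \<open>?P3\<close>: the place of the second vertex of
    \<open>A\<close> in an AABB edge; \<open>?Q1\<close> to \<open>?Q3\<close>: the place of the
    vertex of \<open>B\<close> in a missing AAAB set; \<open>?R\<close>: a missing ABBB set.\<close>
  let ?P1 = "{x. (\<lambda>(p, q, u). (p, q, u)) x \<in> T}"
  let ?P2 = "{x. (\<lambda>(p, q, u). (q, p, u)) x \<in> T}"
  let ?P3 = "{x. (\<lambda>(p, q, u). (u, p, q)) x \<in> T}"
  let ?Q1 = "{x. (\<lambda>(p, q, u). ((p, u), q)) x \<in> T2}"
  let ?Q2 = "{x. (\<lambda>(p, q, u). ((p, q), u)) x \<in> T2}"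
  let ?Q3 = "{x. (\<lambda>(p, q, u). ((q, p), u)) x \<in> T2}"
  let ?R = "{x. (\<lambda>(p, q, u). ((p, q), u)) x \<in> T3}"
  have "?S \<subseteq> ?P1 \<union> (?P2 \<union> (?P3 \<union> (?Q1 \<union> (?Q2 \<union> (?Q3 \<union> ?R)))))"
  proof
    fix x assume "x \<in> ?S"
    then obtain p q u where x: "x = (p, q, u)" and m: "p \<in> A \<union> B" "q \<in> A \<union> B" "u \<in> A \<union> B"
      and w: "W {v, p, q, u}" by auto
    have eqs: "{v, q, p, u} = {v, p, q, u}" "{v, u, p, q} = {v, p, q, u}" "{v, p, u, q} = {v, p, q, u}"
      "{p, q, v, u} = {v, p, q, u}" by auto
    have par: "cA v + cA p + cA q + cA u = 2 \<and> {v, p, q, u} \<in> E \<or> odd (cA v + cA p + cA q + cA u)"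
      using w unfolding W4 by blast
    have iff: "(a, b, c) \<in> T \<longleftrightarrow> a \<in> A \<and> b \<in> B \<and> c \<in> B \<and> {v, a, b, c} \<in> E"
      "((a, b), c) \<in> T2 \<longleftrightarrow> a \<in> A \<and> b \<in> B \<and> c \<in> A \<and> W {v, a, b, c}"
      "((a, b), c) \<in> T3 \<longleftrightarrow> a \<in> B \<and> b \<in> B \<and> c \<in> B \<and> W {a, b, v, c}" for a b c
      by (auto simp: T_def T2_def T3_def)
    have "(p, q, u) \<in> T \<or> (q, p, u) \<in> T \<or> (u, p, q) \<in> T \<or> ((p, u), q) \<in> T2 \<or>
        ((p, q), u) \<in> T2 \<or> ((q, p), u) \<in> T2 \<or> ((p, q), u) \<in> T3"
      unfolding iff eqs using m w par v not_mem(2)[of p] not_mem(2)[of q] not_mem(2)[of u]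
      by (elim UnE) (simp_all only: simp_thms if_True if_False, simp_all)
    thus "x \<in> ?P1 \<union> (?P2 \<union> (?P3 \<union> (?Q1 \<union> (?Q2 \<union> (?Q3 \<union> ?R)))))"
      unfolding x by (simp only: Un_iff mem_Collect_eq prod.case)
  qed
  moreover have "finite (?P1 \<union> (?P2 \<union> (?P3 \<union> (?Q1 \<union> (?Q2 \<union> (?Q3 \<union> ?R))))))"
    by (intro finite_UnI finite_vimageI[unfolded vimage_def] finT fin2) (auto simp: inj_on_def)
  ultimately have "card ?S \<le> card (?P1 \<union> (?P2 \<union> (?P3 \<union> (?Q1 \<union> (?Q2 \<union> (?Q3 \<union> ?R))))))"
    by (intro card_mono)
  also have "\<dots> \<le> card ?P1 + (card ?P2 + (card ?P3 + (card ?Q1 + (card ?Q2 + (card ?Q3 + card ?R)))))"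
    by (intro order_trans[OF card_Un_le] add_left_mono order_refl)
  also have "\<dots> \<le> card T + (card T + (card T + (card T2 + (card T2 + (card T2 + card T3)))))"
    by (intro add_mono card_preimage_le finT fin2) (auto simp: inj_on_def)
  finally have "real (card ?S) \<le> 3 * real (card T) + 3 * real (card T2) + real (card T3)" by linarith
  thus ?thesis using T2 T3 zero_le_power[of "real n" 3, OF of_nat_0_le_iff] by (simp only: pow_simps; linarith)
qed

lemma W_triples:
  assumes v: "v \<in> A \<union> B"
  shows "real (card {(p, q, u). p \<in> A \<union> B \<and> q \<in> A \<union> B \<and> u \<in> A \<union> B \<and> W {v, p, q, u}})
    \<le> 1 / 10 ^ 36 * real n ^ 3"
proof (cases "v \<in> A")
  case True
  show ?thesis using W_triples_A[OF True] A_sparse[OF True] by simp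
next
  case False
  hence vB: "v \<in> B" using v by simp
  interpret sw: near_extremal V E n B A Z by (rule swapped)
  show ?thesis using sw.W_triples_A[OF vB] B_sparse[OF vB] by (simp add: swap Un_commute)
qed

lemma W_quadruples_A:
  "real (card (Sigma A (\<lambda>v. {(p, q, u). p \<in> A \<union> B \<and> q \<in> A \<union> B \<and> u \<in> A \<union> B \<and> W {v, p, q, u}})))
    \<le> 1 / (2 * 10 ^ 106) * real n ^ 4" (is "real (card (Sigma A ?S)) \<le> _")
proof -
  define T where "T v = {(a, b, b'). a \<in> A \<and> b \<in> B \<and> b' \<in> B \<and> {v, a, b, b'} \<in> E}" for v
  have finT: "finite (T v)" for v unfolding T_def by (rule finite_subset[of _ "A \<times> B \<times> B"]) auto
  have finS: "finite (?S v)" for v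
    by (rule finite_subset[of _ "(A \<union> B) \<times> (A \<union> B) \<times> (A \<union> B)"]) auto
  have "real (card (Sigma A ?S)) = (\<Sum>v\<in>A. real (card (?S v)))"
    using finS by simp
  also have "\<dots> \<le> (\<Sum>v\<in>A. 7 * real (card (T v)) + 100 / 10 ^ 110 * real n ^ 3)"
    unfolding T_def by (intro sum_mono W_triples_A)
  also have "\<dots> = 7 * real (card (Sigma A T)) + 100 / 10 ^ 110 * real n ^ 3 * real (card A)"
    using finT by (simp add: sum.distrib sum_distrib_left)
  also have "Sigma A T = {(a, a', b, b'). a \<in> A \<and> a' \<in> A \<and> b \<in> B \<and> b' \<in> B \<and> {a, a', b, b'} \<in> E}"
    by (auto simp: T_def)
  finally have "real (card (Sigma A ?S)) \<le> 7 * (1 / 10 ^ 108 * real n ^ 4) + 100 / 10 ^ 110 * real n ^ 3 * real (card A)"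
    using total_sparse by linarith
  moreover have "real (card A) \<le> 2 * real n"
    using card_bounds(1) n_pos(1) by linarith
  hence "100 / 10 ^ 110 * real n ^ 3 * real (card A) \<le> 100 / 10 ^ 110 * real n ^ 3 * (2 * real n)"
    by (intro mult_left_mono) simp_all
  moreover have "100 / 10 ^ 110 * real n ^ 3 * (2 * real n) = 200 / 10 ^ 110 * real n ^ 4"
    by (simp add: power3_eq_cube power4_eq_xxxx)
  ultimately show ?thesis using zero_le_power[of "real n" 4, OF of_nat_0_le_iff] by (simp only: pow_simps; linarith)
qed

lemma W_quadruples:
  "real (card {(v, p, q, u). v \<in> A \<union> B \<and> p \<in> A \<union> B \<and> q \<in> A \<union> B \<and> u \<in> A \<union> B \<and> W {v, p, q, u}})
    \<le> 1 / 10 ^ 106 * real n ^ 4"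
proof -
  interpret sw: near_extremal V E n B A Z by (rule swapped)
  let ?S = "\<lambda>v. {(p, q, u). p \<in> A \<union> B \<and> q \<in> A \<union> B \<and> u \<in> A \<union> B \<and> W {v, p, q, u}}"
  have "{(v, p, q, u). v \<in> A \<union> B \<and> p \<in> A \<union> B \<and> q \<in> A \<union> B \<and> u \<in> A \<union> B \<and> W {v, p, q, u}}
    = Sigma A ?S \<union> Sigma B ?S" by auto
  hence "card {(v, p, q, u). v \<in> A \<union> B \<and> p \<in> A \<union> B \<and> q \<in> A \<union> B \<and> u \<in> A \<union> B \<and> W {v, p, q, u}}
    \<le> card (Sigma A ?S) + card (Sigma B ?S)"
    by (simp only: card_Un_le)
  moreover have "real (card (Sigma B ?S)) \<le> 1 / (2 * 10 ^ 106) * real n ^ 4"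
    using sw.W_quadruples_A unfolding swap Un_commute[of B A] .
  ultimately show ?thesis using W_quadruples_A by linarith
qed

text \<open>A bad triple has at least 10^-7 n deviating fourth vertices, so averaging costs a factor
  10^7. Starting from the global count, it ends far below 10^-38, the density of the links of
  exceptional vertices.\<close>

lemma not_g3_triples:
  "real (card {(x, y, z). x \<in> A \<union> B \<and> y \<in> A \<union> B \<and> z \<in> A \<union> B \<and> \<not> g3 x y z}) \<le> 1 / 10 ^ 99 * real n ^ 3"
proof -
  let ?T = "{(v, p, q, u). v \<in> A \<union> B \<and> p \<in> A \<union> B \<and> q \<in> A \<union> B \<and> u \<in> A \<union> B \<and> W {v, p, q, u}}"
  let ?T' = "{x. (\<lambda>((v, p, q), u). (v, p, q, u)) x \<in> ?T}"
  let ?S = "{(x, y, z). x \<in> A \<union> B \<and> y \<in> A \<union> B \<and> z \<in> A \<union> B \<and> \<not> g3 x y z}"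
  have finT: "finite ?T" by (rule finite_subset[of _ "(A \<union> B) \<times> (A \<union> B) \<times> (A \<union> B) \<times> (A \<union> B)"]) auto
  have inj: "inj (\<lambda>((v, p, q), u). (v, p, q, u))" by (auto simp: inj_on_def)
  have "1 / 10 ^ 7 * real n * real (card ?S) \<le> real (card ?T')"
  proof (rule card_le_of_fibres)
    show "finite ?T'" using finite_vimageI[OF finT inj] by (simp add: vimage_def)
    show "?S \<subseteq> (A \<union> B) \<times> (A \<union> B) \<times> (A \<union> B)" by blast
    fix x assume "x \<in> ?S"
    then obtain a b c where "x = (a, b, c)" "a \<in> A \<union> B" "b \<in> A \<union> B" "c \<in> A \<union> B" "\<not> g3 a b c" by auto
    moreover from this have "{y. (x, y) \<in> ?T'} = {u \<in> A \<union> B. \<not> \<not> W {a, b, c, u}}" by auto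
    ultimately show "1 / 10 ^ 7 * real n \<le> real (card {y. (x, y) \<in> ?T'})"
      unfolding g3_def few_def by simp
  qed auto
  also have "\<dots> \<le> real (card ?T)" using card_preimage_le[OF finT inj] by simp
  also have "\<dots> \<le> 1 / 10 ^ 106 * real n ^ 4" by (rule W_quadruples)
  finally have "real n * (1 / 10 ^ 7 * real (card ?S)) \<le> real n * (1 / 10 ^ 106 * real n ^ 3)"
    by (simp add: power3_eq_cube power4_eq_xxxx mult_ac)
  hence "1 / 10 ^ 7 * real (card ?S) \<le> 1 / 10 ^ 106 * real n ^ 3" using n_pos(1) by (rule mult_left_le_imp_le)
  thus ?thesis by simp
qed

lemma not_g2_pairs:
  "real (card {(x, y). x \<in> A \<union> B \<and> y \<in> A \<union> B \<and> \<not> g2 x y}) \<le> 1 / 10 ^ 92 * real n ^ 2"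
proof -
  let ?T = "{(x, y, z). x \<in> A \<union> B \<and> y \<in> A \<union> B \<and> z \<in> A \<union> B \<and> \<not> g3 x y z}"
  let ?T' = "{x. (\<lambda>((v, p), u). (v, p, u)) x \<in> ?T}"
  let ?S = "{(x, y). x \<in> A \<union> B \<and> y \<in> A \<union> B \<and> \<not> g2 x y}"
  have finT: "finite ?T" by (rule finite_subset[of _ "(A \<union> B) \<times> (A \<union> B) \<times> (A \<union> B)"]) auto
  have inj: "inj (\<lambda>((v, p), u). (v, p, u))" by (auto simp: inj_on_def)
  have "1 / 10 ^ 7 * real n * real (card ?S) \<le> real (card ?T')"
  proof (rule card_le_of_fibres)
    show "finite ?T'" using finite_vimageI[OF finT inj] by (simp add: vimage_def)
    show "?S \<subseteq> (A \<union> B) \<times> (A \<union> B)" by auto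
    fix x assume "x \<in> ?S"
    then obtain a b where "x = (a, b)" "a \<in> A \<union> B" "b \<in> A \<union> B" "\<not> g2 a b" by auto
    moreover from this have "{y. (x, y) \<in> ?T'} = {u \<in> A \<union> B. \<not> g3 a b u}" by auto
    ultimately show "1 / 10 ^ 7 * real n \<le> real (card {y. (x, y) \<in> ?T'})"
      unfolding g2_def few_def by simp
  qed auto
  also have "\<dots> \<le> real (card ?T)" using card_preimage_le[OF finT inj] by simp
  also have "\<dots> \<le> 1 / 10 ^ 99 * real n ^ 3" by (rule not_g3_triples)
  finally have "real n * (1 / 10 ^ 7 * real (card ?S)) \<le> real n * (1 / 10 ^ 99 * real n ^ 2)"
    by (simp add: power3_eq_cube power2_eq_square mult_ac)
  hence "1 / 10 ^ 7 * real (card ?S) \<le> 1 / 10 ^ 99 * real n ^ 2" using n_pos(1) by (rule mult_left_le_imp_le)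
  thus ?thesis by simp
qed

text \<open>The same averaging started from the bound at one vertex. The result is weaker than the
  global one but holds for every \<open>v\<close> in \<open>A \<union> B\<close>, so each of these
  vertices has typical pairs with almost all others.\<close>

lemma not_g3_pairs:
  assumes v: "v \<in> A \<union> B"
  shows "real (card {(p, q). p \<in> A \<union> B \<and> q \<in> A \<union> B \<and> \<not> g3 v p q}) \<le> 1 / 10 ^ 29 * real n ^ 2"
proof -
  let ?T = "{(p, q, u). p \<in> A \<union> B \<and> q \<in> A \<union> B \<and> u \<in> A \<union> B \<and> W {v, p, q, u}}"
  let ?T' = "{x. (\<lambda>((v, p), u). (v, p, u)) x \<in> ?T}"
  let ?S = "{(p, q). p \<in> A \<union> B \<and> q \<in> A \<union> B \<and> \<not> g3 v p q}"
  have finT: "finite ?T" by (rule finite_subset[of _ "(A \<union> B) \<times> (A \<union> B) \<times> (A \<union> B)"]) auto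
  have inj: "inj (\<lambda>((v, p), u). (v, p, u))" by (auto simp: inj_on_def)
  have "1 / 10 ^ 7 * real n * real (card ?S) \<le> real (card ?T')"
  proof (rule card_le_of_fibres)
    show "finite ?T'" using finite_vimageI[OF finT inj] by (simp add: vimage_def)
    show "?S \<subseteq> (A \<union> B) \<times> (A \<union> B)" by auto
    fix x assume "x \<in> ?S"
    then obtain a b where "x = (a, b)" "a \<in> A \<union> B" "b \<in> A \<union> B" "\<not> g3 v a b" by auto
    moreover from this have "{y. (x, y) \<in> ?T'} = {u \<in> A \<union> B. \<not> \<not> W {v, a, b, u}}" by auto
    ultimately show "1 / 10 ^ 7 * real n \<le> real (card {y. (x, y) \<in> ?T'})"
      unfolding g3_def few_def by simp
  qed auto
  also have "\<dots> \<le> real (card ?T)" using card_preimage_le[OF finT inj] by simp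
  also have "\<dots> \<le> 1 / 10 ^ 36 * real n ^ 3" by (rule W_triples[OF v])
  finally have "real n * (1 / 10 ^ 7 * real (card ?S)) \<le> real n * (1 / 10 ^ 36 * real n ^ 2)"
    by (simp add: power3_eq_cube power2_eq_square mult_ac)
  hence "1 / 10 ^ 7 * real (card ?S) \<le> 1 / 10 ^ 36 * real n ^ 2" using n_pos(1) by (rule mult_left_le_imp_le)
  thus ?thesis by simp
qed

lemma few_g2_strong:
  assumes v: "v \<in> A \<union> B"
  shows "few (1 / 10 ^ 22) (g2 v)"
proof -
  let ?T = "{(p, q). p \<in> A \<union> B \<and> q \<in> A \<union> B \<and> \<not> g3 v p q}"
  let ?S = "{p \<in> A \<union> B. \<not> g2 v p}"
  have "1 / 10 ^ 7 * real n * real (card ?S) \<le> real (card ?T)"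
  proof (rule card_le_of_fibres)
    show "finite ?T" by (rule finite_subset[of _ "(A \<union> B) \<times> (A \<union> B)"]) auto
    show "?S \<subseteq> A \<union> B" by blast
    fix x assume "x \<in> ?S"
    moreover from this have "{y. (x, y) \<in> ?T} = {u \<in> A \<union> B. \<not> g3 v x u}" by auto
    ultimately show "1 / 10 ^ 7 * real n \<le> real (card {y. (x, y) \<in> ?T})"
      unfolding g2_def few_def by simp
  qed auto
  also have "\<dots> \<le> 1 / 10 ^ 29 * real n ^ 2" by (rule not_g3_pairs[OF v])
  finally have "real n * (1 / 10 ^ 7 * real (card ?S)) \<le> real n * (1 / 10 ^ 29 * real n)"
    by (simp add: power2_eq_square mult_ac)
  hence "1 / 10 ^ 7 * real (card ?S) \<le> 1 / 10 ^ 29 * real n" using n_pos(1) by (rule mult_left_le_imp_le)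
  thus ?thesis unfolding few_def by simp
qed

lemma few_g2: "v \<in> A \<union> B \<Longrightarrow> few (1 / 10 ^ 7) (g2 v)"
  by (rule few_mono[OF few_g2_strong]) auto

end

section \<open>Long paths in one mode\<close>

text \<open>Averaging over \<open>d\<close>: after exchanging the sums, each \<open>x\<close>
  contributes its weight for at most a fraction \<open>c\<close> of the choices, so some choice is
  no worse than the average.\<close>

lemma weighted_choice:
  fixes w :: "'b \<Rightarrow> real" and c K :: real
  assumes "finite D" "D \<noteq> {}" "finite U" and w: "\<And>x. x \<in> U \<Longrightarrow> 0 \<le> w x"
    and bad: "\<And>x. x \<in> U \<Longrightarrow> real (card {d \<in> D. bad x d}) \<le> K"
    and K: "K \<le> c * real (card D)"
  shows "\<exists>d\<in>D. (\<Sum>x\<in>U. if bad x d then w x else 0) \<le> c * sum w U"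
proof (rule ccontr)
  assume "\<not> ?thesis"
  hence "c * sum w U < (\<Sum>x\<in>U. if bad x d then w x else 0)" if "d \<in> D" for d
    using that by force
  hence "(\<Sum>d\<in>D. c * sum w U) < (\<Sum>d\<in>D. \<Sum>x\<in>U. if bad x d then w x else 0)"
    using assms(1,2) by (intro sum_strict_mono)
  also have "\<dots> = (\<Sum>x\<in>U. \<Sum>d\<in>D. if bad x d then w x else 0)" by (rule sum.swap)
  also have "\<dots> = (\<Sum>x\<in>U. w x * real (card {d \<in> D. bad x d}))"
    using assms(1) by (intro sum.cong refl) (simp add: sum.If_cases Int_def mult.commute)
  also have "\<dots> \<le> (\<Sum>x\<in>U. w x * (c * real (card D)))"
    using bad K w by (intro sum_mono mult_left_mono) (auto intro: order_trans)
  also have "\<dots> = (\<Sum>d\<in>D. c * sum w U)"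
    by (simp add: sum_distrib_left sum_distrib_right mult_ac)
  finally show False by simp
qed

text \<open>The $m + 1$ slots of a path, filled by a list of vertices, alternate with $m$ blocks of three vertices.\<close>

fun weave :: "'b list \<Rightarrow> ('b \<times> 'b \<times> 'b) list \<Rightarrow> 'b list" where
  "weave (x # xs) ((p, q, r) # bs) = x # p # q # r # weave xs bs"
| "weave xs _ = xs"

fun verts :: "('b \<times> 'b \<times> 'b) list \<Rightarrow> 'b list" where
  "verts [] = []"
| "verts ((p, q, r) # bs) = p # q # r # verts bs"

lemma set_weave: "length xs = Suc (length bs) \<Longrightarrow> set (weave xs bs) = set xs \<union> set (verts bs)"
  by (induction xs bs rule: weave.induct) auto

lemma distinct_weave:
  "length xs = Suc (length bs) \<Longrightarrow> distinct xs \<Longrightarrow> distinct (verts bs) \<Longrightarrow> set xs \<inter> set (verts bs) = {} \<Longrightarrow>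
    distinct (weave xs bs)"
  by (induction xs bs rule: weave.induct) (auto simp: set_weave)

context near_extremal begin

lemma card_AB: "real (card (A \<union> B)) \<le> 2002 / 1000 * real n"
  using card_Un_le[of A B] card_bounds(1,2) by linarith

lemma few_neq': "few (1 / 10 ^ 7) (\<lambda>x. y \<noteq> x)"
  using few_neq[of y] by (simp add: eq_commute)

text \<open>A failure at any of the three choices leaves at most \<open>e * n\<close> values for
  that vertex and 2.002 n for either of the others; 3 * 2.002^2 is below 13.\<close>

lemma few_triples:
  assumes e: "0 \<le> e" and P: "few e P" and Q: "\<And>p. p \<in> A \<union> B \<Longrightarrow> P p \<Longrightarrow> few e (Q p)"
    and R: "\<And>p q. p \<in> A \<union> B \<Longrightarrow> q \<in> A \<union> B \<Longrightarrow> P p \<Longrightarrow> Q p q \<Longrightarrow> few e (R p q)"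
  shows "real (card {(p, q, r). p \<in> A \<union> B \<and> q \<in> A \<union> B \<and> r \<in> A \<union> B \<and> \<not> (P p \<and> Q p q \<and> R p q r)})
    \<le> 13 * e * real n ^ 3"
proof -
  let ?U = "A \<union> B" and ?k = "e * real n"
  let ?S1 = "{p \<in> ?U. \<not> P p} \<times> ?U \<times> ?U"
  let ?S2 = "Sigma {p \<in> ?U. P p} (\<lambda>p. {q \<in> ?U. \<not> Q p q} \<times> ?U)"
  let ?S3 = "Sigma {p \<in> ?U. P p} (\<lambda>p. Sigma {q \<in> ?U. Q p q} (\<lambda>q. {r \<in> ?U. \<not> R p q r}))"
  let ?S = "{(p, q, r). p \<in> ?U \<and> q \<in> ?U \<and> r \<in> ?U \<and> \<not> (P p \<and> Q p q \<and> R p q r)}"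
  define u where "u = real (card ?U)"
  have fU: "finite ?U" by simp
  have k: "0 \<le> ?k" using e by simp
  have u: "0 \<le> u" "u \<le> 2002 / 1000 * real n" using card_AB by (auto simp: u_def)
  have sub: "real (card {x \<in> ?U. T x}) \<le> u" for T
    unfolding u_def by (intro of_nat_mono card_mono) auto
  have 1: "real (card ?S1) \<le> ?k * (u * u)"
    using P mult_right_mono[of "real (card {p \<in> ?U. \<not> P p})" ?k "u * u"] u
    by (simp add: card_cartesian_product few_def u_def)
  have 2: "real (card ?S2) \<le> (?k * u) * u"
  proof -
    have "real (card ?S2) \<le> (?k * u) * real (card {p \<in> ?U. P p})"
    proof (rule card_Sigma_le)
      fix p assume "p \<in> {p \<in> ?U. P p}"
      hence "real (card {q \<in> ?U. \<not> Q p q}) \<le> ?k" using Q by (auto simp: few_def)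
      thus "real (card ({q \<in> ?U. \<not> Q p q} \<times> ?U)) \<le> ?k * u"
        using mult_right_mono[OF _ u(1)] by (simp add: card_cartesian_product u_def)
    qed auto
    also have "\<dots> \<le> (?k * u) * u" using k u by (intro mult_left_mono sub) auto
    finally show ?thesis .
  qed
  have 3: "real (card ?S3) \<le> (?k * u) * u"
  proof -
    have "real (card ?S3) \<le> (?k * u) * real (card {p \<in> ?U. P p})"
    proof (rule card_Sigma_le)
      fix p assume p: "p \<in> {p \<in> ?U. P p}"
      have "real (card (Sigma {q \<in> ?U. Q p q} (\<lambda>q. {r \<in> ?U. \<not> R p q r}))) \<le> ?k * real (card {q \<in> ?U. Q p q})"
        using R p by (intro card_Sigma_le) (auto simp: few_def)
      also have "\<dots> \<le> ?k * u" using k by (intro mult_left_mono sub)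
      finally show "real (card (Sigma {q \<in> ?U. Q p q} (\<lambda>q. {r \<in> ?U. \<not> R p q r}))) \<le> ?k * u" .
    qed auto
    also have "\<dots> \<le> (?k * u) * u" using k u by (intro mult_left_mono sub) auto
    finally show ?thesis .
  qed
  have "?S \<subseteq> ?S1 \<union> (?S2 \<union> ?S3)" by auto
  hence "card ?S \<le> card (?S1 \<union> (?S2 \<union> ?S3))" by (intro card_mono) auto
  also have "\<dots> \<le> card ?S1 + (card ?S2 + card ?S3)"
    by (intro order_trans[OF card_Un_le] add_left_mono order_refl)
  finally have "real (card ?S) \<le> real (card ?S1) + (real (card ?S2) + real (card ?S3))" by linarith
  moreover have "(?k * u) * u = ?k * (u * u)" by (simp only: mult_ac)
  ultimately have "real (card ?S) \<le> 3 * (?k * (u * u))" using 1 2 3 by linarith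
  also have "u * u \<le> 2002 / 1000 * real n * (2002 / 1000 * real n)" using u by (intro mult_mono) auto
  hence "3 * (?k * (u * u)) \<le> 3 * (?k * (2002 / 1000 * real n * (2002 / 1000 * real n)))"
    using k by (intro mult_left_mono) auto
  also have "\<dots> = 12.024012 * (e * real n ^ 3)" by (simp add: power3_eq_cube)
  also have "\<dots> \<le> 13 * (e * real n ^ 3)" using e by (intro mult_right_mono) auto
  finally show ?thesis by simp
qed

text \<open>Removing the slot vertex from the four windows through a slot leaves l1 l2 l3, l2 l3 p,
  l3 p q and p q r. The first is already typical by the preceding link, or by assumption at the
  start.\<close>

definition link :: "'a \<times> 'a \<times> 'a \<Rightarrow> 'a \<times> 'a \<times> 'a \<Rightarrow> bool" where
  "link = (\<lambda>(l1, l2, l3) (p, q, r). h3 l2 l3 p \<and> h3 l3 p q \<and> h3 p q r)"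

definition slot_ok :: "'a \<Rightarrow> 'a \<times> 'a \<times> 'a \<Rightarrow> 'a \<times> 'a \<times> 'a \<Rightarrow> bool" where
  "slot_ok x = (\<lambda>(l1, l2, l3) (p, q, r). \<not> W {l1, l2, l3, x} \<and> \<not> W {l2, l3, x, p} \<and>
     \<not> W {l3, x, p, q} \<and> \<not> W {x, p, q, r})"

text \<open>If \<open>x\<close> is compatible with the block on its left, then most choices of the next block make the slot between them
suitable for \<open>x\<close> and keep \<open>x\<close> compatible. Choosing the blocks greedily against the potential
$\sum_x 2^{c_x}$, where $c_x$ counts the bad steps for \<open>x\<close>, therefore leaves every vertex with few bad slots.\<close>

definition ok_left :: "'a \<Rightarrow> 'a \<times> 'a \<times> 'a \<Rightarrow> bool" where
  "ok_left x = (\<lambda>(l1, l2, l3). \<not> W {l1, l2, l3, x} \<and> g3 l2 l3 x \<and> g2 l3 x)"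

definition step_bad :: "'a \<Rightarrow> 'a \<times> 'a \<times> 'a \<Rightarrow> 'a \<times> 'a \<times> 'a \<Rightarrow> bool" where
  "step_bad x l b \<longleftrightarrow> ok_left x l \<and> \<not> slot_ok x l b \<or> \<not> ok_left x b"

fun bad_steps :: "'a \<Rightarrow> 'a \<times> 'a \<times> 'a \<Rightarrow> ('a \<times> 'a \<times> 'a) list \<Rightarrow> nat" where
  "bad_steps x l [] = 0"
| "bad_steps x l (b # bs) = (if step_bad x l b then 1 else 0) + bad_steps x b bs"

fun bad_slots :: "'a \<Rightarrow> 'a \<times> 'a \<times> 'a \<Rightarrow> ('a \<times> 'a \<times> 'a) list \<Rightarrow> 'a \<times> 'a \<times> 'a \<Rightarrow> nat" where
  "bad_slots x l [] e = (if slot_ok x l e then 0 else 1)"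
| "bad_slots x l (b # bs) e = (if slot_ok x l b then 0 else 1) + bad_slots x b bs e"

text \<open>A slot fails because its own step is bad or because \<open>x\<close> was incompatible
  with the block on its left, which made the preceding step bad. So a bad step spoils at most two
  slots; the start and the final slot before \<open>e\<close> account for one each.\<close>

lemma bad_slots_le:
  "bad_slots x l bs e \<le> 2 * bad_steps x l bs + (if ok_left x l then 0 else 1) + 1"
proof (induction bs arbitrary: l)
  case (Cons b bs)
  show ?case using Cons[of b] by (auto simp: step_bad_def split: if_splits)
qed auto

lemma bad_slots_card:
  "bad_slots x l bs e = card {i \<in> {..length bs}. \<not> slot_ok x ((l # bs) ! i) ((bs @ [e]) ! i)}"
proof (induction bs arbitrary: l)
  case Nil
  have "{i \<in> {..0::nat}. \<not> slot_ok x ([l] ! i) ([e] ! i)} = (if slot_ok x l e then {} else {0})"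
    by (auto intro: gr0I)
  thus ?case by simp
next
  case (Cons b bs)
  let ?S = "{i \<in> {..length bs}. \<not> slot_ok x ((b # bs) ! i) ((bs @ [e]) ! i)}"
  have "{i \<in> {..length (b # bs)}. \<not> slot_ok x ((l # b # bs) ! i) (((b # bs) @ [e]) ! i)} =
    (if slot_ok x l b then {} else {0}) \<union> Suc ` ?S"
  proof (intro set_eqI, goal_cases)
    case (1 i)
    show ?case by (cases i) auto
  qed
  moreover have "card (Suc ` ?S) = card ?S" by (intro card_image) auto
  ultimately show ?case using Cons[of b] by (auto simp: card_insert_if)
qed

lemma few_step_bad:
  assumes x: "x \<in> A \<union> B"
  shows "real (card {(p, q, r). p \<in> A \<union> B \<and> q \<in> A \<union> B \<and> r \<in> A \<union> B \<and> step_bad x l (p, q, r)})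
    \<le> 1 / 10 ^ 5 * real n ^ 3"
proof -
  obtain l1 l2 l3 where l: "l = (l1, l2, l3)" by (cases l)
  \<comment> \<open>The premise \<open>ok_left x l\<close> voids the conditions on the old block
    when \<open>x\<close> is incompatible with it. The other conditions already give
    \<open>ok_left\<close> for the new block, so \<open>x\<close> recovers after a single good
    choice.\<close>
  define P where "P = (\<lambda>p. \<forall>T\<in>set [\<lambda>p. ok_left x l \<longrightarrow> \<not> W {l2, l3, x, p}, \<lambda>p. ok_left x l \<longrightarrow> g3 l3 x p, g2 x]. T p)"
  define Q where "Q p = (\<lambda>q. \<forall>T\<in>set [\<lambda>q. ok_left x l \<longrightarrow> \<not> W {l3, x, p, q}, g3 x p, g2 x]. T q)" for p
  define R where "R p q = (\<lambda>r. \<forall>T\<in>set [\<lambda>r. \<not> W {x, p, q, r}, g3 x q, g2 x]. T r)" for p q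
  have imp: "few e T \<or> \<not> c \<Longrightarrow> 0 \<le> e \<Longrightarrow> few e (\<lambda>y. c \<longrightarrow> T y)" for e c T
    by (cases c) (auto simp: few_def)
  have "few (3 / 10 ^ 7) P"
    unfolding P_def using few_g2[OF x] few_W[of l2 l3 x] few_g3[of l3 x]
    by (intro few_mono[OF few_all[of _ "1 / 10 ^ 7"]])
       (auto simp: ok_left_def l intro!: imp)
  moreover have "few (3 / 10 ^ 7) (Q p)" if "P p" for p
    using that unfolding Q_def P_def using few_g2[OF x] few_W[of l3 x p] few_g3[of x p]
    by (intro few_mono[OF few_all[of _ "1 / 10 ^ 7"]]) (auto intro!: imp)
  moreover have "few (3 / 10 ^ 7) (R p q)" if "Q p q" for p q
    using that unfolding R_def Q_def using few_g2[OF x] few_W[of x p q] few_g3[of x q]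
    by (intro few_mono[OF few_all[of _ "1 / 10 ^ 7"]]) auto
  ultimately have "real (card {(p, q, r). p \<in> A \<union> B \<and> q \<in> A \<union> B \<and> r \<in> A \<union> B \<and> \<not> (P p \<and> Q p q \<and> R p q r)})
    \<le> 13 * (3 / 10 ^ 7) * real n ^ 3" (is "real (card ?S) \<le> _")
    by (intro few_triples) auto
  moreover have "{(p, q, r). p \<in> A \<union> B \<and> q \<in> A \<union> B \<and> r \<in> A \<union> B \<and> step_bad x l (p, q, r)} \<subseteq> ?S"
  proof -
    have "\<not> step_bad x l (p, q, r)" if "P p \<and> Q p q \<and> R p q r" for p q r
    proof -
      have "W {p, q, r, x} = W {x, p, q, r}" "g3 q r x = g3 x q r" "g2 r x = g2 x r"
        using g3_commute[of q r x] g3_commute[of q x r] g2_commute[of r x] by (simp_all add: insert_commute)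
      moreover have "ok_left x l \<Longrightarrow> \<not> W {l2, l3, x, p} \<and> \<not> W {l3, x, p, q}" "\<not> W {x, p, q, r}"
        "g3 x q r" "g2 x r" using that by (simp_all add: P_def Q_def R_def)
      moreover have "ok_left x l \<Longrightarrow> \<not> W {l1, l2, l3, x}" by (simp add: ok_left_def l)
      ultimately have "ok_left x l \<Longrightarrow> slot_ok x l (p, q, r)" "ok_left x (p, q, r)"
        by (simp_all add: slot_ok_def ok_left_def l)
      thus ?thesis unfolding step_bad_def by blast
    qed
    thus ?thesis by auto
  qed
  moreover have "finite ?S" by (rule finite_subset[of _ "(A \<union> B) \<times> (A \<union> B) \<times> (A \<union> B)"]) auto
  ultimately have "real (card {(p, q, r). p \<in> A \<union> B \<and> q \<in> A \<union> B \<and> r \<in> A \<union> B \<and> step_bad x l (p, q, r)})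
    \<le> 13 * (3 / 10 ^ 7) * real n ^ 3" using card_mono of_nat_mono order_trans by meson
  thus ?thesis using zero_le_power[of "real n" 3, OF of_nat_0_le_iff] by simp
qed

text \<open>A link to the fixed end \<open>e\<close> is demanded of every block: it costs little and
  leaves the chain free to stop after any of them. Choosing p, q, r in turn, each choice keeps
  typical the pairs on which the later triples depend.\<close>

lemma few_unlinked:
  assumes l: "h3 l1 l2 l3" and e: "h3 e1 e2 e3"
  shows "real (card {(p, q, r). p \<in> A \<union> B \<and> q \<in> A \<union> B \<and> r \<in> A \<union> B \<and>
    \<not> (link (l1, l2, l3) (p, q, r) \<and> link (p, q, r) (e1, e2, e3))}) \<le> 1 / 10 ^ 4 * real n ^ 3"
proof -
  have V: "l2 \<in> A \<union> B" "l3 \<in> A \<union> B" "e1 \<in> A \<union> B" "e2 \<in> A \<union> B" "l2 \<noteq> l3" "e1 \<noteq> e2"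
    and g: "g2 l2 l3" "g2 e1 e2" using l e by (auto simp: h3_def)
  define P where "P = (\<lambda>p. \<forall>T\<in>set [g3 l2 l3, g2 l2, g2 l3, \<lambda>p. l2 \<noteq> p, \<lambda>p. l3 \<noteq> p]. T p)"
  define Q where "Q p = (\<lambda>q. \<forall>T\<in>set [g3 l3 p, g2 l3, g2 p, g2 e1, \<lambda>q. l3 \<noteq> q, \<lambda>q. p \<noteq> q, \<lambda>q. q \<noteq> e1]. T q)" for p
  define R where "R p q = (\<lambda>r. \<forall>T\<in>set [g3 p q, g2 p, g2 q, g3 e1 q, g2 e1, g3 e1 e2, g2 e2,
     \<lambda>r. p \<noteq> r, \<lambda>r. q \<noteq> r, \<lambda>r. r \<noteq> e1, \<lambda>r. r \<noteq> e2]. T r)" for p q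
  have "few (11 / 10 ^ 7) P"
    unfolding P_def using few_g2[OF V(1)] few_g2[OF V(2)] few_g3[OF g(1)] few_neq few_neq'
    by (intro few_mono[OF few_all[of _ "1 / 10 ^ 7"]]) auto
  moreover have "few (11 / 10 ^ 7) (Q p)" if "p \<in> A \<union> B" "P p" for p
    using that unfolding Q_def P_def using few_g2[OF V(2)] few_g2[OF that(1)] few_g2[OF V(3)] few_g3[of l3 p] few_neq few_neq'
    by (intro few_mono[OF few_all[of _ "1 / 10 ^ 7"]]) auto
  moreover have "few (11 / 10 ^ 7) (R p q)" if "p \<in> A \<union> B" "q \<in> A \<union> B" "Q p q" for p q
    using that unfolding R_def Q_def using few_g2[OF V(3)] few_g2[OF V(4)] few_g2[OF that(1)] few_g2[OF that(2)]
      few_g3[of p q] few_g3[of e1 q] few_g3[OF g(2)] few_neq few_neq'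
    by (intro few_mono[OF few_all[of _ "1 / 10 ^ 7"]]) auto
  ultimately have "real (card {(p, q, r). p \<in> A \<union> B \<and> q \<in> A \<union> B \<and> r \<in> A \<union> B \<and> \<not> (P p \<and> Q p q \<and> R p q r)})
    \<le> 13 * (11 / 10 ^ 7) * real n ^ 3" (is "real (card ?S) \<le> _")
    by (intro few_triples) auto
  moreover have "{(p, q, r). p \<in> A \<union> B \<and> q \<in> A \<union> B \<and> r \<in> A \<union> B \<and>
    \<not> (link (l1, l2, l3) (p, q, r) \<and> link (p, q, r) (e1, e2, e3))} \<subseteq> ?S"
  proof -
    have "link (l1, l2, l3) (p, q, r) \<and> link (p, q, r) (e1, e2, e3)"
      if "P p \<and> Q p q \<and> R p q r" "p \<in> A \<union> B" "q \<in> A \<union> B" "r \<in> A \<union> B" for p q r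
    proof -
      have "g3 q r e1 = g3 e1 q r" "g3 r e1 e2 = g3 e1 e2 r" "g2 r e1 = g2 e1 r" "g2 q e1 = g2 e1 q" "g2 r e2 = g2 e2 r"
        using g3_commute(1)[of q e1 r] g3_commute(2)[of q r e1] g3_commute(1)[of r e1 e2] g3_commute(2)[of e1 r e2]
          g2_commute[of r e1] g2_commute[of q e1] g2_commute[of r e2] by simp_all
      moreover have "P p" "Q p q" "R p q r" using that by auto
      ultimately have c: "g3 l2 l3 p" "g2 l2 p" "g2 l3 p" "l2 \<noteq> p" "l3 \<noteq> p"
        "g3 l3 p q" "g2 l3 q" "g2 p q" "g2 q e1" "l3 \<noteq> q" "p \<noteq> q" "q \<noteq> e1"
        "g3 p q r" "g2 p r" "g2 q r" "g3 q r e1" "g2 r e1" "g3 r e1 e2" "g2 r e2"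
        "p \<noteq> r" "q \<noteq> r" "r \<noteq> e1" "r \<noteq> e2"
        unfolding P_def Q_def R_def by simp_all
      have "h3 l2 l3 p" "h3 l3 p q" "h3 p q r" "h3 q r e1" "h3 r e1 e2"
        unfolding h3_def using that(2-4) V g c by simp_all
      thus ?thesis unfolding link_def using e by simp
    qed
    thus ?thesis by auto
  qed
  moreover have "finite ?S" by (rule finite_subset[of _ "(A \<union> B) \<times> (A \<union> B) \<times> (A \<union> B)"]) auto
  ultimately have "real (card {(p, q, r). p \<in> A \<union> B \<and> q \<in> A \<union> B \<and> r \<in> A \<union> B \<and>
    \<not> (link (l1, l2, l3) (p, q, r) \<and> link (p, q, r) (e1, e2, e3))})
    \<le> 13 * (11 / 10 ^ 7) * real n ^ 3" using card_mono of_nat_mono order_trans by meson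
  thus ?thesis using zero_le_power[of "real n" 3, OF of_nat_0_le_iff] by simp
qed

text \<open>The pools offer at least n^3 / 1000 blocks, of which at most n^3 / 10^4 fail to link,
  while each \<open>x\<close> objects to at most n^3 / 10^5. Each \<open>x\<close> thus rejects less
  than one in 20 of the admissible blocks, and \<open>weighted_choice\<close> applies.\<close>

lemma choose_block:
  fixes w :: "'a \<Rightarrow> real"
  assumes l: "h3 l1 l2 l3" and e: "h3 e1 e2 e3"
    and pools: "PA \<subseteq> A" "PB \<subseteq> B" "1 / 10 * real n \<le> real (card PA)" "1 / 10 * real n \<le> real (card PB)"
    and w: "\<And>x. x \<in> A \<union> B \<Longrightarrow> 0 \<le> w x"
  shows "\<exists>p q r. p \<in> PA \<and> q \<in> PB \<and> r \<in> PA \<and> link (l1, l2, l3) (p, q, r) \<and> link (p, q, r) (e1, e2, e3) \<and>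
    (\<Sum>x\<in>A \<union> B. if step_bad x (l1, l2, l3) (p, q, r) then w x else 0) \<le> 1 / 20 * sum w (A \<union> B)"
proof -
  let ?l = "(l1, l2, l3)" and ?e = "(e1, e2, e3)"
  let ?ok = "\<lambda>b. link ?l b \<and> link b ?e"
  let ?X = "PA \<times> PB \<times> PA"
  let ?N = "{(p, q, r). p \<in> A \<union> B \<and> q \<in> A \<union> B \<and> r \<in> A \<union> B \<and> \<not> ?ok (p, q, r)}"
  define D where "D = ?X - ?N"
  have fin_pools: "finite PA" "finite PB" using pools finite_subset fin by blast+
  hence finD: "finite D" by (simp add: D_def)
  have finN: "finite ?N" by (rule finite_subset[of _ "(A \<union> B) \<times> (A \<union> B) \<times> (A \<union> B)"]) auto
  have "1 / 10 * real n * (1 / 10 * real n * (1 / 10 * real n)) \<le>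
     real (card PA) * (real (card PB) * real (card PA))"
    using pools by (intro mult_mono) auto
  hence "1 / 1000 * real n ^ 3 \<le> real (card ?X)"
    by (simp add: card_cartesian_product power3_eq_cube)
  moreover have "real (card ?X) \<le> real (card ?N) + real (card D)"
  proof -
    have "?X \<subseteq> ?N \<union> D" unfolding D_def by blast
    hence "card ?X \<le> card (?N \<union> D)" using finN finD by (intro card_mono) blast+
    thus ?thesis using card_Un_le[of ?N D] by linarith
  qed
  ultimately have cardD: "9 / 10000 * real n ^ 3 \<le> real (card D)"
    using few_unlinked[OF l e] by simp
  have n3: "0 < real n ^ 3" using n_pos(1) by simp
  have "D \<noteq> {}"
  proof
    assume "D = {}"
    thus False using cardD n3 by simp
  qed
  moreover have "real (card {d \<in> D. step_bad x ?l d}) \<le> 1 / 10 ^ 5 * real n ^ 3" if x: "x \<in> A \<union> B" for x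
  proof -
    let ?M = "{(p, q, r). p \<in> A \<union> B \<and> q \<in> A \<union> B \<and> r \<in> A \<union> B \<and> step_bad x ?l (p, q, r)}"
    have "{d \<in> D. step_bad x ?l d} \<subseteq> ?M" using pools unfolding D_def by auto
    moreover have "finite ?M" by (rule finite_subset[of _ "(A \<union> B) \<times> (A \<union> B) \<times> (A \<union> B)"]) auto
    ultimately show ?thesis using few_step_bad[OF x, of ?l] card_mono of_nat_mono order_trans by meson
  qed
  moreover have "1 / 10 ^ 5 * real n ^ 3 \<le> 1 / 20 * real (card D)" using cardD n3 by simp
  ultimately have "\<exists>d\<in>D. (\<Sum>x\<in>A \<union> B. if step_bad x ?l d then w x else 0) \<le> 1 / 20 * sum w (A \<union> B)"
    by (intro weighted_choice[OF finD, where K = "1 / 10 ^ 5 * real n ^ 3"] w) auto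
  then obtain d where d: "d \<in> D"
    "(\<Sum>x\<in>A \<union> B. if step_bad x ?l d then w x else 0) \<le> 1 / 20 * sum w (A \<union> B)" by blast
  obtain p q r where d_eq: "d = (p, q, r)" by (cases d)
  have m: "(p, q, r) \<in> ?X" "(p, q, r) \<notin> ?N" using d(1) unfolding D_def d_eq Diff_iff by blast+
  hence "p \<in> PA" "q \<in> PB" "r \<in> PA" by simp_all
  moreover from this have "?ok (p, q, r)" using m(2) pools(1,2) by blast
  ultimately show ?thesis using d(2) unfolding d_eq by blast
qed

fun chain :: "'a \<times> 'a \<times> 'a \<Rightarrow> ('a \<times> 'a \<times> 'a) list \<Rightarrow> 'a \<times> 'a \<times> 'a \<Rightarrow> bool" where
  "chain l [] e = link l e"
| "chain l (b # bs) e \<longleftrightarrow> link l b \<and> chain b bs e"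

text \<open>A bad step doubles the weight of its vertex, and \<open>choose_block\<close> keeps the
  weight to be doubled below 1/20 of the total, so the potential grows by a factor of at most 21/20
  per block. A block takes two vertices from \<open>A\<close> and one from \<open>B\<close>; the
  size bounds keep n / 10 in each pool to the end.\<close>

lemma choose_chain:
  fixes w :: "'a \<Rightarrow> real"
  assumes e: "h3 e1 e2 e3"
  shows "h3 l1 l2 l3 \<Longrightarrow> finite F \<Longrightarrow> 2 * real m + 1 / 10 * real n \<le> real (card (A - F)) \<Longrightarrow>
    real m + 1 / 10 * real n \<le> real (card (B - F)) \<Longrightarrow> (\<And>x. x \<in> A \<union> B \<Longrightarrow> 0 \<le> w x) \<Longrightarrow>
    (m = 0 \<Longrightarrow> link (l1, l2, l3) (e1, e2, e3)) \<Longrightarrow>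
    \<exists>bs. length bs = m \<and> chain (l1, l2, l3) bs (e1, e2, e3) \<and> distinct (verts bs) \<and>
      set (verts bs) \<inter> F = {} \<and> set bs \<subseteq> A \<times> B \<times> A \<and>
      (\<Sum>x\<in>A \<union> B. w x * 2 ^ bad_steps x (l1, l2, l3) bs) \<le> (21 / 20) ^ m * sum w (A \<union> B)"
proof (induction m arbitrary: l1 l2 l3 F w)
  case 0
  thus ?case by (intro exI[of _ "[]"]) simp
next
  case (Suc m)
  let ?l = "(l1, l2, l3)" and ?e = "(e1, e2, e3)"
  have pools: "A - F \<subseteq> A" "B - F \<subseteq> B" "1 / 10 * real n \<le> real (card (A - F))"
    "1 / 10 * real n \<le> real (card (B - F))" using Suc.prems(3,4) by auto
  obtain p q r where b: "p \<in> A - F" "q \<in> B - F" "r \<in> A - F" "link ?l (p, q, r)" "link (p, q, r) ?e"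
    and sum: "(\<Sum>x\<in>A \<union> B. if step_bad x ?l (p, q, r) then w x else 0) \<le> 1 / 20 * sum w (A \<union> B)"
    using choose_block[OF Suc.prems(1) e pools, of w] Suc.prems(5) by blast
  have h: "h3 p q r" using b(4) by (simp add: link_def)
  hence neq: "p \<noteq> r" by (simp add: h3_def)
  define F' where "F' = insert p (insert q (insert r F))"
  define w' where "w' x = w x * 2 ^ (if step_bad x ?l (p, q, r) then 1 else 0)" for x
  have "A - F' = A - F - {p, r}" using b(2) not_mem by (auto simp: F'_def)
  hence "card (A - F') = card (A - F) - 2" using b(1,3) neq by (simp add: card_Diff_subset)
  hence cA': "2 * real m + 1 / 10 * real n \<le> real (card (A - F'))" using Suc.prems(3) by auto
  have "B - F' = B - F - {q}" using b(1,3) not_mem by (auto simp: F'_def)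
  hence "card (B - F') = card (B - F) - 1" using b(2) by simp
  hence cB': "real m + 1 / 10 * real n \<le> real (card (B - F'))" using Suc.prems(4) by auto
  obtain bs where bs: "length bs = m" "chain (p, q, r) bs ?e" "distinct (verts bs)" "set (verts bs) \<inter> F' = {}"
    "set bs \<subseteq> A \<times> B \<times> A"
    "(\<Sum>x\<in>A \<union> B. w' x * 2 ^ bad_steps x (p, q, r) bs) \<le> (21 / 20) ^ m * sum w' (A \<union> B)"
    using Suc.IH[of p q r F' w', OF h _ cA' cB'] Suc.prems(2,5) b(5) by (auto simp: F'_def w'_def)
  have "sum w' (A \<union> B) = sum w (A \<union> B) + (\<Sum>x\<in>A \<union> B. if step_bad x ?l (p, q, r) then w x else 0)"
    unfolding sum.distrib[symmetric] w'_def by (intro sum.cong) auto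
  hence "sum w' (A \<union> B) \<le> 21 / 20 * sum w (A \<union> B)" using sum by simp
  hence "(21 / 20) ^ m * sum w' (A \<union> B) \<le> (21 / 20) ^ m * (21 / 20 * sum w (A \<union> B))"
    by (intro mult_left_mono) auto
  also have "\<dots> = (21 / 20) ^ Suc m * sum w (A \<union> B)" by simp
  finally have "(\<Sum>x\<in>A \<union> B. w' x * 2 ^ bad_steps x (p, q, r) bs) \<le> (21 / 20) ^ Suc m * sum w (A \<union> B)"
    using bs(6) by (rule order_trans[rotated])
  moreover have "(\<Sum>x\<in>A \<union> B. w' x * 2 ^ bad_steps x (p, q, r) bs) =
      (\<Sum>x\<in>A \<union> B. w x * 2 ^ bad_steps x ?l ((p, q, r) # bs))"
    unfolding w'_def by (intro sum.cong) auto
  ultimately have "(\<Sum>x\<in>A \<union> B. w x * 2 ^ bad_steps x ?l ((p, q, r) # bs)) \<le> (21 / 20) ^ Suc m * sum w (A \<union> B)"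
    by simp
  moreover have "distinct (verts ((p, q, r) # bs))" "set (verts ((p, q, r) # bs)) \<inter> F = {}"
    using b(1-3) bs(3,4) h by (auto simp: F'_def h3_def)
  ultimately show ?case using bs(1,2,5) b by (intro exI[of _ "(p, q, r) # bs"]) auto
qed

text \<open>(21/20)^7 * 7/5 is below 2, and (7/5)^m beats (2.002 n)^7: Bernoulli's inequality for
  the exponent m div 8, raised to the eighth power, gives order n^8.\<close>

lemma exp_beats_power:
  fixes m :: nat
  assumes m: "1 / 10 * real n \<le> real m"
  shows "((21 / 20) ^ m * (2002 / 1000 * real n)) ^ 7 < (2::real) ^ m"
proof -
  define k where "k = m div 8"
  have k: "8 * k \<le> m" "m < 8 * k + 8" unfolding k_def by auto
  have large: "10 ^ 30 \<le> real n" using n_real by (rule order_trans[rotated]) simp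
  have kn: "1 / 100 * real n \<le> real k" using m k(2) large by simp
  have "1 + real k * (2 / 5) \<le> (1 + 2 / 5) ^ k" by (rule Bernoulli_inequality) simp
  hence "1 / 250 * real n \<le> (7 / 5) ^ k" using kn by simp
  hence "(1 / 250 * real n) ^ 8 \<le> ((7 / 5) ^ k) ^ 8" by (intro power_mono) auto
  also have "\<dots> = (7 / 5) ^ (8 * k)" by (simp add: power_mult mult.commute)
  also have "\<dots> \<le> (7 / 5) ^ m" using k(1) by (intro power_increasing) auto
  finally have 1: "(1 / 250 * real n) ^ 8 \<le> (7 / 5) ^ m" .
  have "(2002 / 1000 * real n) ^ 7 = (2002 / 1000) ^ 7 * real n ^ 7" by (rule power_mult_distrib)
  also have "\<dots> < (1 / 250) ^ 8 * real n * real n ^ 7"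
  proof (rule mult_strict_right_mono)
    have "(2002 / 1000) ^ 7 * 250 ^ 8 < (10::real) ^ 30" by (simp add: power_divide)
    hence "(2002 / 1000) ^ 7 * 250 ^ 8 < real n" using large by linarith
    thus "(2002 / 1000) ^ 7 < (1 / 250) ^ 8 * real n" by (simp add: power_divide field_simps)
  qed simp
  also have "\<dots> = (1 / 250 * real n) ^ 8" by (simp add: power_mult_distrib eval_nat_numeral)
  finally have 2: "(2002 / 1000 * real n) ^ 7 < (7 / 5) ^ m" using 1 by linarith
  have "((21 / 20) ^ m * (2002 / 1000 * real n)) ^ 7 = ((21 / 20) ^ 7) ^ m * (2002 / 1000 * real n) ^ 7"
    by (simp only: power_mult_distrib power_mult[symmetric] mult.commute)
  also have "\<dots> < ((21 / 20) ^ 7) ^ m * (7 / 5) ^ m" using 2 by (intro mult_strict_left_mono) auto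
  also have "\<dots> = ((21 / 20) ^ 7 * (7 / 5)) ^ m" by (simp only: power_mult_distrib)
  also have "\<dots> \<le> 2 ^ m" by (intro power_mono) (auto simp: power_divide)
  finally show ?thesis .
qed

section \<open>From a chain of blocks to an absorbing path\<close>

lemma chain_len: "chain l bs e \<Longrightarrow> i \<le> length bs \<Longrightarrow> link ((l # bs) ! i) ((bs @ [e]) ! i)"
  by (induction l bs e arbitrary: i rule: chain.induct) (auto simp: less_Suc_eq_0_disj nth_Cons split: nat.splits)

lemma few_slot_bad:
  assumes "h3 l1 l2 l3" "link (l1, l2, l3) b"
  shows "few (4 / 10 ^ 7) (\<lambda>x. slot_ok x (l1, l2, l3) b)"
proof -
  obtain p q r where b: "b = (p, q, r)" by (cases b)
  have g: "g3 l1 l2 l3" "g3 l2 l3 p" "g3 l3 p q" "g3 p q r" using assms by (auto simp: b link_def h3_def)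
  have "few (4 / 10 ^ 7) (\<lambda>x. \<forall>T\<in>set [\<lambda>x. \<not> W {l1, l2, l3, x}, \<lambda>x. \<not> W {l2, l3, p, x},
      \<lambda>x. \<not> W {l3, p, q, x}, \<lambda>x. \<not> W {p, q, r, x}]. T x)"
    using g few_W by (intro few_mono[OF few_all[of _ "1 / 10 ^ 7"]]) auto
  moreover have "{l2, l3, p, x} = {l2, l3, x, p}" "{l3, p, q, x} = {l3, x, p, q}" "{p, q, r, x} = {x, p, q, r}" for x
    by auto
  ultimately show ?thesis unfolding slot_ok_def b by simp
qed

text \<open>In the pattern ABA A ABA A ... every window has three vertices in \<open>A\<close>, one
  in \<open>B\<close>, and contains exactly one slot. So \<open>slot_ok\<close> for all slots covers
  all windows, and \<open>odd_edge\<close> makes them edges.\<close>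

lemma weave_tight:
  assumes "length xs = Suc (length bs)" "chain (l1, l2, l3) bs (e1, e2, e3)"
    and "\<And>i. i \<le> length bs \<Longrightarrow> slot_ok (xs ! i) (((l1, l2, l3) # bs) ! i) ((bs @ [(e1, e2, e3)]) ! i)"
    and "set xs \<subseteq> A" "set bs \<subseteq> A \<times> B \<times> A" "h3 l1 l2 l3" "h3 e1 e2 e3" "l1 \<in> A" "l2 \<in> B" "l3 \<in> A"
    and "e1 \<in> A" "e2 \<in> B" "e3 \<in> A" "distinct (weave xs bs)"
    and "set (weave xs bs) \<inter> {l1, l2, l3, e1, e2, e3} = {}" "{l1, l2, l3} \<inter> {e1, e2, e3} = {}"
  shows "tight_path E ([l1, l2, l3] @ weave xs bs @ [e1, e2, e3])"
  using assms
proof (induction bs arbitrary: xs l1 l2 l3)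
  case Nil
  then obtain x where xs: "xs = [x]" by (cases xs) auto
  have ok: "slot_ok x (l1, l2, l3) (e1, e2, e3)" using Nil.prems(3)[of 0] by (simp add: xs)
  have x: "x \<in> A" "x \<notin> {l1, l2, l3, e1, e2, e3}" using Nil.prems(4,15) by (auto simp: xs)
  have mem: "l1 \<in> A" "l2 \<in> B" "l3 \<in> A" "e1 \<in> A" "e2 \<in> B" "e3 \<in> A" "l2 \<notin> A" "e2 \<notin> A"
    using Nil.prems(8-13) not_mem(2)[OF Nil.prems(9)] not_mem(2)[OF Nil.prems(12)] by simp_all
  have neq: "distinct [l1, l2, l3, x, e1, e2, e3]" using Nil.prems(6,7,16) x(2) by (auto simp: h3_def)
  have "{l1, l2, l3, x} \<in> E" "{l2, l3, x, e1} \<in> E" "{l3, x, e1, e2} \<in> E" "{x, e1, e2, e3} \<in> E"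
    by (rule odd_edge; use ok x mem neq in \<open>simp add: slot_ok_def\<close>)+
  thus ?case by (simp add: xs)
next
  case (Cons b bs)
  obtain p q r where b: "b = (p, q, r)" by (cases b)
  obtain x ys where xs: "xs = x # ys" using Cons.prems(1) by (cases xs) auto
  have link: "link (l1, l2, l3) (p, q, r)" "chain (p, q, r) bs (e1, e2, e3)" using Cons.prems(2) by (auto simp: b)
  have h: "h3 p q r" using link by (simp add: link_def)
  have m: "p \<in> A" "q \<in> B" "r \<in> A" using Cons.prems(5) by (auto simp: b)
  have ok: "slot_ok x (l1, l2, l3) (p, q, r)" using Cons.prems(3)[of 0] by (simp add: xs b)
  have d: "distinct (x # p # q # r # weave ys bs)" using Cons.prems(14) by (simp add: xs b)
  have dis: "{x, p, q, r} \<inter> {l1, l2, l3} = {}" using Cons.prems(15) by (auto simp: xs b)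
  have tail: "tight_path E ([p, q, r] @ weave ys bs @ [e1, e2, e3])"
  proof (rule Cons.IH)
    show "slot_ok (ys ! i) (((p, q, r) # bs) ! i) ((bs @ [(e1, e2, e3)]) ! i)" if "i \<le> length bs" for i
      using Cons.prems(3)[of "Suc i"] that by (simp add: xs b)
    show "set (weave ys bs) \<inter> {p, q, r, e1, e2, e3} = {}" "{p, q, r} \<inter> {e1, e2, e3} = {}"
      using d Cons.prems(15) by (auto simp: xs b)
  qed (use Cons.prems link h m d in \<open>auto simp: xs b\<close>)
  have mem: "x \<in> A" "l1 \<in> A" "l2 \<in> B" "l3 \<in> A" "p \<in> A" "q \<in> B" "r \<in> A" "l2 \<notin> A" "q \<notin> A"
    using Cons.prems(4,8-10) m not_mem by (auto simp: xs)
  have neq: "distinct [l1, l2, l3, x, p, q, r]" using Cons.prems(6) d dis by (auto simp: h3_def)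
  have "{l1, l2, l3, x} \<in> E" "{l2, l3, x, p} \<in> E" "{l3, x, p, q} \<in> E" "{x, p, q, r} \<in> E"
    by (rule odd_edge; use ok mem neq in \<open>simp add: slot_ok_def\<close>)+
  thus ?case using tail by (simp add: xs b)
qed

lemma verts_card:
  "set bs \<subseteq> A \<times> B \<times> A \<Longrightarrow> distinct (verts bs) \<Longrightarrow>
    set (verts bs) \<subseteq> A \<union> B \<and> card (set (verts bs) \<inter> A) = 2 * length bs \<and> card (set (verts bs) \<inter> B) = length bs"
proof (induction bs)
  case (Cons b bs)
  obtain p q r where b: "b = (p, q, r)" by (cases b)
  have m: "p \<in> A" "q \<in> B" "r \<in> A" using Cons.prems(1) by (auto simp: b)
  have nm: "p \<notin> B" "q \<notin> A" "r \<notin> B" using m not_mem by blast+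
  have "p \<noteq> r" "p \<notin> set (verts bs)" "q \<notin> set (verts bs)" "r \<notin> set (verts bs)"
    using Cons.prems(2) by (auto simp: b)
  thus ?case using Cons m nm by (simp add: b Int_insert_left)
qed simp

text \<open>The order of the quantifiers is the point: the blocks \<open>D\<close> are fixed before
  the set \<open>R\<close> that fills the slots is known, so the path can absorb whatever is left
  over. Few conflicts in both directions make a perfect matching of vertices to slots
  possible.\<close>

lemma A_segment:
  assumes h: "h3 l1 l2 l3" "h3 e1 e2 e3"
    and mem: "l1 \<in> A" "l2 \<in> B" "l3 \<in> A" "e1 \<in> A" "e2 \<in> B" "e3 \<in> A"
    and F: "finite F" "{l1, l2, l3, e1, e2, e3} \<subseteq> F" "{l1, l2, l3} \<inter> {e1, e2, e3} = {}"
    and pools: "2 * real m + 1 / 10 * real n \<le> real (card (A - F))"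
      "real m + 1 / 10 * real n \<le> real (card (B - F))"
    and m: "1 / 10 * real n \<le> real m"
  shows "\<exists>D. D \<subseteq> (A \<union> B) - F \<and> card (D \<inter> A) = 2 * m \<and> card (D \<inter> B) = m \<and>
    (\<forall>R. R \<subseteq> A - F - D \<longrightarrow> card R = Suc m \<longrightarrow>
      (\<exists>ys. distinct ys \<and> set ys = R \<union> D \<and> tight_path E ([l1, l2, l3] @ ys @ [e1, e2, e3])))"
proof -
  have "10 ^ 5 \<le> real n" by (rule order_trans[OF _ n_real]) simp
  hence large: "1000 < real m" using m by simp
  let ?l = "(l1, l2, l3)" and ?e = "(e1, e2, e3)"
  have "\<exists>bs. length bs = m \<and> chain ?l bs ?e \<and> distinct (verts bs) \<and> set (verts bs) \<inter> F = {} \<and>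
    set bs \<subseteq> A \<times> B \<times> A \<and>
    (\<Sum>x\<in>A \<union> B. 1 * 2 ^ bad_steps x ?l bs) \<le> (21 / 20) ^ m * sum (\<lambda>_. 1::real) (A \<union> B)"
    using large by (intro choose_chain[OF h(2,1) F(1) pools]) auto
  then obtain bs where bs: "length bs = m" "chain ?l bs ?e" "distinct (verts bs)" "set (verts bs) \<inter> F = {}"
    "set bs \<subseteq> A \<times> B \<times> A" "(\<Sum>x\<in>A \<union> B. 1 * 2 ^ bad_steps x ?l bs) \<le> (21 / 20) ^ m * sum (\<lambda>_. 1::real) (A \<union> B)"
    by blast
  define D where "D = set (verts bs)"
  have D: "D \<subseteq> A \<union> B" "card (D \<inter> A) = 2 * m" "card (D \<inter> B) = m"
    using verts_card[OF bs(5,3)] by (auto simp: D_def bs(1))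
  \<comment> \<open>One vertex alone contributes 2 to the power of its bad steps to the potential; m
    / 7 bad steps would push this beyond the bound of \<open>choose_chain\<close>, by
    \<open>exp_beats_power\<close>.\<close>
  have steps: "7 * bad_steps x ?l bs < m" if x: "x \<in> A \<union> B" for x
  proof (rule ccontr)
    assume "\<not> ?thesis"
    hence "(2::real) ^ m \<le> 2 ^ (7 * bad_steps x ?l bs)" by (intro power_increasing) auto
    also have "\<dots> = (2 ^ bad_steps x ?l bs) ^ 7" by (simp add: power_mult[symmetric] mult.commute)
    also have "(2::real) ^ bad_steps x ?l bs \<le> (\<Sum>x\<in>A \<union> B. 1 * 2 ^ bad_steps x ?l bs)"
      using x member_le_sum[of x "A \<union> B" "\<lambda>x. (2::real) ^ bad_steps x ?l bs"] by simp
    hence "(2 ^ bad_steps x ?l bs) ^ 7 \<le> (((21 / 20) ^ m * (2002 / 1000 * real n)) ^ 7 :: real)"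
    proof (intro power_mono)
      have "(21 / 20) ^ m * sum (\<lambda>_. 1::real) (A \<union> B) \<le> (21 / 20) ^ m * (2002 / 1000 * real n)"
        using card_AB by (intro mult_left_mono) auto
      thus "(2::real) ^ bad_steps x ?l bs \<le> (21 / 20) ^ m * (2002 / 1000 * real n)"
        using bs(6) \<open>(2::real) ^ bad_steps x ?l bs \<le> (\<Sum>x\<in>A \<union> B. 1 * 2 ^ bad_steps x ?l bs)\<close> by linarith
    qed simp
    also have "\<dots> < 2 ^ m" by (rule exp_beats_power[OF m])
    finally show False by simp
  qed
  let ?L = "\<lambda>i. (?l # bs) ! i" and ?R = "\<lambda>i. (bs @ [?e]) ! i"
  let ?ok = "\<lambda>x i. slot_ok x (?L i) (?R i)"
  have "\<exists>ys. distinct ys \<and> set ys = R \<union> D \<and> tight_path E ([l1, l2, l3] @ ys @ [e1, e2, e3])"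
    if R: "R \<subseteq> A - F - D" "card R = Suc m" for R
  proof -
    have finR: "finite R" using R(1) finite_subset by fastforce
    have "\<exists>f. bij_betw f R {..m} \<and> (\<forall>x\<in>R. ?ok x (f x))"
    \<comment> \<open>Fewer than m / 7 bad steps spoil at most 2 m / 7 + 2 slots, which is below m /
      3 for large m; conversely a slot rejects only 4 / 10^7 n vertices.\<close>
    proof (rule matching_of_few_conflicts[where ?d1.0 = "m div 3" and ?d2.0 = "m div 3"])
      fix x assume "x \<in> R"
      hence x: "x \<in> A \<union> B" using R(1) by blast
      have "bad_slots x ?l bs ?e \<le> 2 * bad_steps x ?l bs + 2"
        using bad_slots_le[of x ?l bs ?e] by (auto split: if_splits)
      also have "\<dots> \<le> m div 3" using steps[OF x] large by linarith
      finally show "card {i \<in> {..m}. \<not> ?ok x i} \<le> m div 3"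
        using bad_slots_card[of x ?l bs ?e] by (simp only: bs(1))
    next
      fix i assume i: "i \<in> {..m}"
      obtain a b c where L: "?L i = (a, b, c)" by (cases "?L i")
      have "h3 a b c"
      proof (cases i)
        case 0
        thus ?thesis using L h(1) by simp
      next
        case (Suc j)
        have "link (?L j) (?R j)" using i bs(1,2) by (intro chain_len) (auto simp: Suc)
        moreover have "?R j = (a, b, c)" using L i bs(1) by (simp add: Suc nth_append)
        ultimately show ?thesis by (auto simp: link_def)
      qed
      moreover have "link (a, b, c) (?R i)" using chain_len[OF bs(2), of i] i bs(1) L by simp
      ultimately have "few (4 / 10 ^ 7) (\<lambda>x. ?ok x i)" using few_slot_bad L by simp
      moreover have "card {x \<in> R. \<not> ?ok x i} \<le> card {x \<in> A \<union> B. \<not> ?ok x i}"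
        using R(1) by (intro card_mono) auto
      ultimately have "real (card {x \<in> R. \<not> ?ok x i}) \<le> 4 / 10 ^ 7 * real n" unfolding few_def by linarith
      also have "\<dots> \<le> 1 / 4 * real m" using m by simp
      finally show "card {x \<in> R. \<not> ?ok x i} \<le> m div 3" using large by linarith
    qed (use finR R(2) in auto)
    then obtain f where f: "bij_betw f R {..m}" "\<forall>x\<in>R. ?ok x (f x)" by blast
    define xs where "xs = map (inv_into R f) [0..<Suc m]"
    have inv: "bij_betw (inv_into R f) {..m} R" using f(1) by (rule bij_betw_inv_into)
    have set_xs: "set xs = R" using inv unfolding xs_def bij_betw_def by (simp add: atLeast0LessThan lessThan_Suc_atMost del: upt_Suc)
    have dist: "distinct xs" using inv unfolding xs_def bij_betw_def
      by (simp add: distinct_map atLeast0LessThan lessThan_Suc_atMost del: upt_Suc)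
    have len: "length xs = Suc (length bs)" by (simp add: xs_def bs(1))
    have ok: "?ok (xs ! i) i" if "i \<le> length bs" for i
    proof -
      have i: "i \<in> {..m}" using that bs(1) by simp
      have "xs ! i = inv_into R f i" using that by (simp add: xs_def bs(1) nth_map del: upt_Suc)
      moreover have "inv_into R f i \<in> R" "f (inv_into R f i) = i"
        using f(1) i by (auto simp: bij_betw_def inv_into_into f_inv_into_f)
      ultimately show ?thesis using f(2) by metis
    qed
    have disj': "set xs \<inter> set (verts bs) = {}" using R(1) set_xs by (auto simp: D_def)
    have wd: "distinct (weave xs bs)" by (rule distinct_weave[OF len dist bs(3) disj'])
    have ws: "set (weave xs bs) = R \<union> D" using set_weave[OF len] by (simp add: set_xs D_def)
    have "tight_path E ([l1, l2, l3] @ weave xs bs @ [e1, e2, e3])"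
    proof (rule weave_tight[OF len bs(2) ok])
      show "set (weave xs bs) \<inter> {l1, l2, l3, e1, e2, e3} = {}"
        using ws R(1) F(2) bs(4) by (auto simp: D_def)
      show "set xs \<subseteq> A" using R(1) set_xs by blast
    qed (use bs(5) h mem wd F(3) in blast)+
    thus ?thesis using wd ws by blast
  qed
  moreover have "D \<subseteq> A \<union> B - F" using D(1) bs(4) by (auto simp: D_def)
  ultimately show ?thesis using D(2,3) by blast
qed

section \<open>Closing the cycle\<close>

definition piece :: "'a list \<Rightarrow> bool" where
  "piece P \<longleftrightarrow> tight_path E P \<and> distinct P \<and> set P \<subseteq> V"

definition starts :: "'a set \<Rightarrow> 'a set \<Rightarrow> 'a list \<Rightarrow> bool" where
  "starts X Y P \<longleftrightarrow> (\<exists>x y z Q. P = [x, y, z] @ Q \<and> x \<in> X \<and> y \<in> Y \<and> z \<in> X \<and> h3 x y z)"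

definition ends :: "'a set \<Rightarrow> 'a set \<Rightarrow> 'a list \<Rightarrow> bool" where
  "ends X Y P \<longleftrightarrow> (\<exists>x y z Q. P = Q @ [x, y, z] \<and> x \<in> X \<and> y \<in> Y \<and> z \<in> X \<and> h3 x y z)"

lemma ends_rev: "ends X Y (rev P) \<longleftrightarrow> starts X Y P"
proof
  assume "ends X Y (rev P)"
  then obtain x y z Q where "rev P = Q @ [x, y, z]" and m: "x \<in> X" "y \<in> Y" "z \<in> X" "h3 x y z"
    unfolding ends_def by blast
  hence "P = [z, y, x] @ rev Q" by (simp add: rev_swap)
  thus "starts X Y P" unfolding starts_def using m h3_commute(3) by blast
next
  assume "starts X Y P"
  then obtain x y z Q where "P = [x, y, z] @ Q" and m: "x \<in> X" "y \<in> Y" "z \<in> X" "h3 x y z"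
    unfolding starts_def by blast
  hence "rev P = rev Q @ [z, y, x]" by simp
  thus "ends X Y (rev P)" unfolding ends_def using m h3_commute(3) by blast
qed

lemma starts_rev: "starts X Y (rev P) \<longleftrightarrow> ends X Y P"
  using ends_rev[of X Y "rev P"] by simp

lemma piece_rev: "piece P \<Longrightarrow> piece (rev P)"
  unfolding piece_def using tight_path_rev by auto

lemma swap_starts: "near_extremal.starts E n B A = starts"
proof (intro ext)
  fix X Y P
  interpret sw: near_extremal V E n B A Z by (rule swapped)
  show "near_extremal.starts E n B A X Y P = starts X Y P"
    unfolding starts_def sw.starts_def by (simp add: swap)
qed

text \<open>The block numbers of the two long paths solve a linear system of determinant 8, and it
  implies \<alpha> + 5 \<beta> = 8 mA + 16 mB + 6. The residue 6 is exactly the condition for an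
  integral solution. The solution is positive because the pieces are short, so \<alpha> and \<beta>
  are both close to n.\<close>

lemma hamiltonian_of_pieces:
  assumes pieces: "piece S1" "piece S2" "set S1 \<inter> set S2 = {}"
    and S1: "starts A B S1" "ends B A S1" and S2: "starts B A S2" "ends A B S2"
    and Z: "Z \<subseteq> set S1 \<union> set S2"
    and few: "real (card (set S1 \<union> set S2)) \<le> 1 / 50 * real n"
    and cong: "(card (A - (set S1 \<union> set S2)) + 5 * card (B - (set S1 \<union> set S2))) mod 8 = 6"
  shows "has_hamiltonian_cycle V E"
proof -
  interpret sw: near_extremal V E n B A Z by (rule swapped)
  define U where "U = set S1 \<union> set S2"
  have finU: "finite U" by (simp add: U_def)
  have UV: "U \<subseteq> V" using pieces(1,2) by (auto simp: U_def piece_def)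
  define \<alpha> \<beta> where "\<alpha> = card (A - U)" and "\<beta> = card (B - U)"
  have "real (card A) \<le> real \<alpha> + real (card U)" "real (card B) \<le> real \<beta> + real (card U)"
    using card_Un_le[of "A - U" U] card_Un_le[of "B - U" U] card_mono[of "A - U \<union> U" A]
      card_mono[of "B - U \<union> U" B] finU unfolding \<alpha>_def \<beta>_def by auto
  hence lower: "97 / 100 * real n \<le> real \<alpha>" "97 / 100 * real n \<le> real \<beta>"
    using few card_bounds(3,4) by (auto simp: U_def)
  have upper: "real \<alpha> \<le> 101 / 100 * real n" "real \<beta> \<le> 101 / 100 * real n"
    using card_bounds(1,2) card_mono[of A "A - U"] card_mono[of B "B - U"] n_pos(1)
    unfolding \<alpha>_def \<beta>_def by auto
  have "10 ^ 5 \<le> real n" by (rule order_trans[OF _ n_real]) simp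
  note big = this
  have "real (\<beta> + 2) \<le> real (3 * \<alpha>)" "real (\<alpha> + 2) \<le> real (3 * \<beta>)"
    using lower upper big by simp_all
  hence ge: "\<beta> + 2 \<le> 3 * \<alpha>" "\<alpha> + 2 \<le> 3 * \<beta>" by (simp_all only: of_nat_le_iff)
  define q where "q = (\<alpha> + 5 * \<beta>) div 8"
  have q: "\<alpha> + 5 * \<beta> = 8 * q + 6"
    using cong div_mult_mod_eq[of "\<alpha> + 5 * \<beta>" 8] by (simp add: \<alpha>_def \<beta>_def U_def q_def)
  \<comment> \<open>\<open>mA\<close> and \<open>mB\<close> are the numbers of blocks of the two long paths, solving $\alpha = 3 m_A + m_B + 1$ and
    $\beta = 3 m_B + m_A + 1$\<close>
  define mA mB where "mA = 3 * q + 2 - 2 * \<beta>" and "mB = \<beta> - q - 1"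
  have m8: "3 * \<alpha> = \<beta> + 2 + 8 * mA" "3 * \<beta> = \<alpha> + 2 + 8 * mB"
    using ge q unfolding mA_def mB_def by linarith+
  hence m: "\<alpha> = 3 * mA + mB + 1" "\<beta> = 3 * mB + mA + 1" by linarith+
  have "real (3 * \<alpha>) = real (\<beta> + 2 + 8 * mA)" "real (3 * \<beta>) = real (\<alpha> + 2 + 8 * mB)"
    using m8 by (simp_all only:)
  hence m_ge: "1 / 10 * real n \<le> real mA" "1 / 10 * real n \<le> real mB"
    using lower upper big by simp_all
  obtain a1 a2 a3 Q1 where s1: "S1 = [a1, a2, a3] @ Q1" "a1 \<in> A" "a2 \<in> B" "a3 \<in> A" "h3 a1 a2 a3"
    using S1(1) unfolding starts_def by blast
  obtain b1 b2 b3 P1 where e1: "S1 = P1 @ [b1, b2, b3]" "b1 \<in> B" "b2 \<in> A" "b3 \<in> B" "h3 b1 b2 b3"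
    using S1(2) unfolding ends_def by blast
  obtain c1 c2 c3 Q2 where s2: "S2 = [c1, c2, c3] @ Q2" "c1 \<in> B" "c2 \<in> A" "c3 \<in> B" "h3 c1 c2 c3"
    using S2(1) unfolding starts_def by blast
  obtain d1 d2 d3 P2 where e2: "S2 = P2 @ [d1, d2, d3]" "d1 \<in> A" "d2 \<in> B" "d3 \<in> A" "h3 d1 d2 d3"
    using S2(2) unfolding ends_def by blast
  have mems: "{a1, a2, a3} \<subseteq> set S1" "{b1, b2, b3} \<subseteq> set S1" "{c1, c2, c3} \<subseteq> set S2" "{d1, d2, d3} \<subseteq> set S2"
    using arg_cong[OF s1(1), of set] arg_cong[OF s2(1), of set]
      arg_cong[OF e1(1), of set] arg_cong[OF e2(1), of set] by auto
  have dm: "X \<inter> Y = {}" "Y \<inter> X = {}" if "X \<subseteq> set S2" "Y \<subseteq> set S1" for X Y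
    using that pieces(3) by blast+
  have "\<exists>D. D \<subseteq> (A \<union> B) - U \<and> card (D \<inter> A) = 2 * mA \<and> card (D \<inter> B) = mA \<and>
    (\<forall>R. R \<subseteq> A - U - D \<longrightarrow> card R = Suc mA \<longrightarrow>
      (\<exists>ys. distinct ys \<and> set ys = R \<union> D \<and> tight_path E ([d1, d2, d3] @ ys @ [a1, a2, a3])))"
  proof (rule A_segment[OF e2(5) s1(5) e2(2-4) s1(2-4) finU])
    show "{d1, d2, d3, a1, a2, a3} \<subseteq> U" using mems by (auto simp: U_def)
    show "{d1, d2, d3} \<inter> {a1, a2, a3} = {}" using mems by (intro dm)
    show "2 * real mA + 1 / 10 * real n \<le> real (card (A - U))"
      "real mA + 1 / 10 * real n \<le> real (card (B - U))"
    proof -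
      have "real \<alpha> = 3 * real mA + real mB + 1" "real \<beta> = 3 * real mB + real mA + 1" by (simp_all add: m)
      thus "2 * real mA + 1 / 10 * real n \<le> real (card (A - U))"
        "real mA + 1 / 10 * real n \<le> real (card (B - U))"
        using m_ge unfolding \<alpha>_def \<beta>_def by linarith+
    qed
  qed (rule m_ge)
  then obtain DA where DA: "DA \<subseteq> (A \<union> B) - U" "card (DA \<inter> A) = 2 * mA" "card (DA \<inter> B) = mA"
    and fillA: "\<And>R. R \<subseteq> A - U - DA \<Longrightarrow> card R = Suc mA \<Longrightarrow>
      (\<exists>ys. distinct ys \<and> set ys = R \<union> DA \<and> tight_path E ([d1, d2, d3] @ ys @ [a1, a2, a3]))" by blast
  have finDA: "finite DA" using DA(1) by (rule finite_subset) simp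
  have diff: "card (X - Y) + card (Y \<inter> X) = card X" if "finite X" for X Y :: "'a set"
  proof -
    have "X = (X - Y) \<union> (Y \<inter> X)" "(X - Y) \<inter> (Y \<inter> X) = {}" by auto
    thus ?thesis using that card_Un_disjoint[of "X - Y" "Y \<inter> X"] by simp
  qed
  have cA: "card (A - (U \<union> DA)) + 2 * mA = \<alpha>"
  proof -
    have "A - (U \<union> DA) = (A - U) - DA" "DA \<inter> (A - U) = DA \<inter> A" using DA(1) by auto
    thus ?thesis using diff[of "A - U" DA] DA(2) by (simp add: \<alpha>_def)
  qed
  have cB: "card (B - (U \<union> DA)) + mA = \<beta>"
  proof -
    have "B - (U \<union> DA) = (B - U) - DA" "DA \<inter> (B - U) = DA \<inter> B" using DA(1) by auto
    thus ?thesis using diff[of "B - U" DA] DA(3) by (simp add: \<beta>_def)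
  qed
  have "\<exists>D. D \<subseteq> (B \<union> A) - (U \<union> DA) \<and> card (D \<inter> B) = 2 * mB \<and> card (D \<inter> A) = mB \<and>
    (\<forall>R. R \<subseteq> B - (U \<union> DA) - D \<longrightarrow> card R = Suc mB \<longrightarrow>
      (\<exists>ys. distinct ys \<and> set ys = R \<union> D \<and> tight_path E ([b1, b2, b3] @ ys @ [c1, c2, c3])))"
  proof (rule sw.A_segment)
    show "near_extremal.h3 E n B A b1 b2 b3" "near_extremal.h3 E n B A c1 c2 c3"
      using e1(5) s2(5) by (simp_all add: swap)
    show "{b1, b2, b3, c1, c2, c3} \<subseteq> U \<union> DA" using mems by (auto simp: U_def)
    show "{b1, b2, b3} \<inter> {c1, c2, c3} = {}" using mems by (intro dm)
    show "2 * real mB + 1 / 10 * real n \<le> real (card (B - (U \<union> DA)))"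
      "real mB + 1 / 10 * real n \<le> real (card (A - (U \<union> DA)))"
    proof -
      have "real (card (A - (U \<union> DA))) = real mA + real mB + 1" "real (card (B - (U \<union> DA))) = 3 * real mB + 1"
        using arg_cong[OF cA, of real] arg_cong[OF cB, of real] by (simp_all add: m)
      thus "2 * real mB + 1 / 10 * real n \<le> real (card (B - (U \<union> DA)))"
        "real mB + 1 / 10 * real n \<le> real (card (A - (U \<union> DA)))" using m_ge by linarith+
    qed
    show "finite (U \<union> DA)" using finU finDA by simp
  qed (fact e1(2-4) s2(2-4) m_ge(2))+
  then obtain DB where DB: "DB \<subseteq> (B \<union> A) - (U \<union> DA)" "card (DB \<inter> B) = 2 * mB" "card (DB \<inter> A) = mB"
    and fillB: "\<And>R. R \<subseteq> B - (U \<union> DA) - DB \<Longrightarrow> card R = Suc mB \<Longrightarrow>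
      (\<exists>ys. distinct ys \<and> set ys = R \<union> DB \<and> tight_path E ([b1, b2, b3] @ ys @ [c1, c2, c3]))" by blast
  \<comment> \<open>Both block sets are fixed and no slot is filled yet: the leftovers of
    \<open>A\<close> and \<open>B\<close> have exactly the sizes mA + 1 and mB + 1 of the two slot
    sets.\<close>
  define RA RB where "RA = A - (U \<union> DA) - DB" and "RB = B - (U \<union> DA) - DB"
  have "DB \<inter> (A - (U \<union> DA)) = DB \<inter> A" "DB \<inter> (B - (U \<union> DA)) = DB \<inter> B" using DB(1) by auto
  hence "card RA + mB + 2 * mA = \<alpha>" "card RB + 2 * mB + mA = \<beta>"
    using diff[of "A - (U \<union> DA)" DB] diff[of "B - (U \<union> DA)" DB] DB(2,3) cA cB by (simp_all add: RA_def RB_def)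
  hence cR: "card RA = Suc mA" "card RB = Suc mB" using m by linarith+
  obtain ya where ya: "distinct ya" "set ya = RA \<union> DA" "tight_path E ([d1, d2, d3] @ ya @ [a1, a2, a3])"
    using fillA[of RA] cR by (auto simp: RA_def)
  obtain yb where yb: "distinct yb" "set yb = RB \<union> DB" "tight_path E ([b1, b2, b3] @ yb @ [c1, c2, c3])"
    using fillB[of RB] cR by (auto simp: RB_def)
  have t1: "tight_path E (S1 @ yb @ [c1, c2, c3])"
    using tight_path_glue[of E P1 b1 b2 b3 "yb @ [c1, c2, c3]"] pieces(1) yb(3) e1(1) by (simp add: piece_def)
  have t2: "tight_path E (S1 @ yb @ S2)"
    using tight_path_append[of E "S1 @ yb" "[c1, c2, c3]" Q2] t1 pieces(2) s2(1) by (simp add: piece_def)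
  have t3: "tight_path E (S1 @ yb @ S2 @ ya @ [a1, a2, a3])"
    using tight_path_glue[of E "S1 @ yb @ P2" d1 d2 d3 "ya @ [a1, a2, a3]"] t2 ya(3) e2(1) by simp
  let ?C = "S1 @ yb @ S2 @ ya"
  have take3: "take 3 ?C = [a1, a2, a3]" by (simp add: s1(1) numeral_3_eq_3)
  have sets: "set ?C = V"
  proof -
    have "set ?C = U \<union> (RA \<union> DA) \<union> (RB \<union> DB)" using ya(2) yb(2) by (auto simp: U_def)
    also have "\<dots> = V" using UV Z V_eq DA(1) DB(1) by (auto simp: RA_def RB_def U_def)
    finally show ?thesis .
  qed
  have dist: "distinct ?C"
  proof -
    have "set yb \<inter> U = {}" "set ya \<inter> U = {}" "set ya \<inter> set yb = {}"
      using DA(1) DB(1) disj(1) unfolding ya(2) yb(2) RA_def RB_def by auto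
    thus ?thesis using pieces ya(1) yb(1) by (auto simp: piece_def U_def)
  qed
  have "cycle_in V E ?C"
  proof (rule cycle_of_tight_path)
    show "tight_path E (?C @ take 3 ?C)" using t3 unfolding take3 by simp
    show "3 \<le> length ?C" by (simp add: s1(1))
  qed (use dist sets in auto)
  thus ?thesis unfolding has_hamiltonian_cycle_def using sets by blast
qed

section \<open>Extending pieces at their ends; the weight\<close>

lemma extend_triple:
  assumes xy: "x \<in> A \<union> B" "y \<in> A \<union> B" "z \<in> A \<union> B" "x \<noteq> y" "y \<noteq> z" "x \<noteq> z" and g: "g3 x y z" "g2 x y"
    and F: "finite F" "real (card F) \<le> 1 / 2 * real n"
    and C: "C = A \<and> even (cA x + cA y + cA z) \<or> C = B \<and> odd (cA x + cA y + cA z)"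
  shows "\<exists>u\<in>C - F. u \<notin> {x, y, z} \<and> h3 u x y \<and> {u, x, y, z} \<in> E"
proof -
  have "real (card C) \<le> real (card (C - F)) + real (card F)"
    using C F(1) card_Un_le[of "C - F" F] card_mono[of "(C - F) \<union> F" C] by fastforce
  hence big: "1 / 1000 * real n \<le> real (card (C - F))" using C F(2) card_bounds(3,4) by auto
  have "\<exists>u\<in>C - F. \<forall>T\<in>set [\<lambda>u. \<not> W {x, y, z, u}, g3 x y, g2 x, g2 y, \<lambda>u. u \<noteq> x, \<lambda>u. u \<noteq> y, \<lambda>u. u \<noteq> z]. T u"
    using few_W[OF g(1)] few_g3[OF g(2)] few_g2[OF xy(1)] few_g2[OF xy(2)] few_neq C big
    by (intro pick) auto
  then obtain u where u: "u \<in> C - F" "\<not> W {x, y, z, u}" "g3 x y u" "g2 x u" "g2 y u" "u \<noteq> x" "u \<noteq> y" "u \<noteq> z"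
    by auto
  have uAB: "u \<in> A \<union> B" using u(1) C by blast
  have "g3 u x y" "g2 u x" "g2 u y"
    using u(3-5) g3_commute(1)[of u x y] g3_commute(2)[of x u y] g2_commute[of u x] g2_commute[of u y] by simp_all
  hence "h3 u x y" using u(6,7) xy(1,2,4) g(2) uAB by (simp add: h3_def)
  moreover have "odd (cA x + cA y + cA z + cA u)" using C u(1) not_mem(2)[of u] by auto
  hence "{x, y, z, u} \<in> E" using xy u(6-8) uAB by (intro odd_edge[OF u(2)]) auto
  hence "{u, x, y, z} \<in> E" by (simp add: insert_commute)
  ultimately show ?thesis using u by blast
qed

text \<open>Parity forces the class \<open>C\<close> of the new vertex, since the new window has to
  meet \<open>A\<close> in an odd number of vertices. The conclusion \<open>h3 u x y\<close> keeps
  the front triple typical, so the step can be repeated.\<close>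

lemma prepend:
  assumes P: "piece (x # y # z # Q)" and h: "h3 x y z" and F: "finite F" "real (card F) \<le> 1 / 2 * real n"
    and C: "C = A \<and> even (cA x + cA y + cA z) \<or> C = B \<and> odd (cA x + cA y + cA z)"
    and sub: "set (x # y # z # Q) \<subseteq> F"
  shows "\<exists>u\<in>C - F. piece (u # x # y # z # Q) \<and> h3 u x y"
proof -
  have "x \<in> A \<union> B" "y \<in> A \<union> B" "z \<in> A \<union> B" "x \<noteq> y" "y \<noteq> z" "x \<noteq> z" "g3 x y z" "g2 x y"
    using h by (auto simp: h3_def)
  then obtain u where u: "u \<in> C - F" "h3 u x y" "{u, x, y, z} \<in> E" using extend_triple[OF _ _ _ _ _ _ _ _ F C] by blast
  have "u \<in> V" using u(1) C V_eq by auto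
  hence "piece (u # x # y # z # Q)" using u P sub by (auto simp: piece_def)
  thus ?thesis using u by blast
qed

text \<open>Exceptional vertices weigh 0, so a route through one of them is weighed by its other
  vertices.\<close>

fun wt :: "'a list \<Rightarrow> nat" where
  "wt [] = 0"
| "wt (v # P) = (if v \<in> A then 1 else if v \<in> B then 5 else 0) + wt P"

lemma wt_append [simp]: "wt (P @ Q) = wt P + wt Q"
  by (induction P) auto

lemma wt_card: "distinct P \<Longrightarrow> wt P = card (set P \<inter> A) + 5 * card (set P \<inter> B)"
  using not_mem by (induction P) (auto simp: Int_insert_left)

lemma starts_append: "starts X Y P \<Longrightarrow> starts X Y (P @ Q)"
  unfolding starts_def by fastforce

lemma ends_append: "ends X Y Q \<Longrightarrow> ends X Y (P @ Q)"
  unfolding ends_def by (metis append.assoc)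

text \<open>The fronts AAB, BAA, ABA and AAA are the four phases of the period AAAB. Parity then
  dictates every prepended class, and at most three steps lead back to the front ABA.\<close>

lemma complete_left:
  assumes P: "piece (x # y # z # Q)" and h: "h3 x y z" and F: "finite F" "real (card F) \<le> 1 / 4 * real n"
    and Q: "length Q \<le> 100"
  shows "x \<in> A \<Longrightarrow> y \<in> A \<Longrightarrow> z \<in> B \<Longrightarrow> \<exists>L. piece (L @ x # y # z # Q) \<and> starts A B (L @ x # y # z # Q) \<and>
      set L \<inter> F = {} \<and> list_all2 (\<in>) L [A, B, A]"
    and "x \<in> B \<Longrightarrow> y \<in> A \<Longrightarrow> z \<in> A \<Longrightarrow> \<exists>L. piece (L @ x # y # z # Q) \<and> starts A B (L @ x # y # z # Q) \<and>
      set L \<inter> F = {} \<and> list_all2 (\<in>) L [A]"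
    and "x \<in> A \<Longrightarrow> y \<in> B \<Longrightarrow> z \<in> A \<Longrightarrow> \<exists>L. piece (L @ x # y # z # Q) \<and> starts A B (L @ x # y # z # Q) \<and>
      set L \<inter> F = {} \<and> list_all2 (\<in>) L []"
    and "x \<in> A \<Longrightarrow> y \<in> A \<Longrightarrow> z \<in> A \<Longrightarrow> \<exists>L. piece (L @ x # y # z # Q) \<and> starts A B (L @ x # y # z # Q) \<and>
      set L \<inter> F = {} \<and> list_all2 (\<in>) L [A, B]"
proof -
  have step: "\<exists>u\<in>C - F. piece (u # x # y # z # Q) \<and> h3 u x y"
    if "piece (x # y # z # Q)" "h3 x y z" "length Q \<le> 110"
      "C = A \<and> even (cA x + cA y + cA z) \<or> C = B \<and> odd (cA x + cA y + cA z)" for C x y z Q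
  proof -
    let ?F = "F \<union> set (x # y # z # Q)"
    have "card ?F \<le> card F + 113"
      using card_Un_le[of F "set (x # y # z # Q)"] card_length[of "x # y # z # Q"] that(3) by simp
    moreover have "10 ^ 5 \<le> real n" by (rule order_trans[OF _ n_real]) simp
    ultimately have "real (card ?F) \<le> 1 / 2 * real n" using F(2) by simp
    thus ?thesis using prepend[OF that(1,2) _ _ that(4), of ?F] F(1) by blast
  qed
  note nm = not_mem(2)
  have BA: "\<exists>L. piece (L @ x # y # z # Q) \<and> starts A B (L @ x # y # z # Q) \<and>
      set L \<inter> F = {} \<and> list_all2 (\<in>) L [A]"
    if pr: "piece (x # y # z # Q)" "h3 x y z" "length Q \<le> 110" "x \<in> B" "y \<in> A" "z \<in> A" for x y z Q
  proof -
    obtain u where "u \<in> A - F" "piece (u # x # y # z # Q)" "h3 u x y"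
      using step[OF pr(1-3), of A] pr(4-6) nm[OF pr(4)] by auto
    thus ?thesis using pr(4,5) by (intro exI[of _ "[u]"]) (auto simp: starts_def)
  qed
  show "\<exists>L. piece (L @ x # y # z # Q) \<and> starts A B (L @ x # y # z # Q) \<and>
      set L \<inter> F = {} \<and> list_all2 (\<in>) L [A]" if "x \<in> B" "y \<in> A" "z \<in> A"
    using BA[OF P h _ that] Q by fastforce
  show "\<exists>L. piece (L @ x # y # z # Q) \<and> starts A B (L @ x # y # z # Q) \<and>
      set L \<inter> F = {} \<and> list_all2 (\<in>) L []" if "x \<in> A" "y \<in> B" "z \<in> A"
    using that P h by (intro exI[of _ "[]"]) (auto simp: starts_def)
  have AAA: "\<exists>L. piece (L @ x # y # z # Q) \<and> starts A B (L @ x # y # z # Q) \<and>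
      set L \<inter> F = {} \<and> list_all2 (\<in>) L [A, B]"
    if pr: "piece (x # y # z # Q)" "h3 x y z" "length Q \<le> 105" "x \<in> A" "y \<in> A" "z \<in> A" for x y z Q
  proof -
    obtain u where u: "u \<in> B - F" "piece (u # x # y # z # Q)" "h3 u x y"
      using step[OF pr(1,2), of B] pr(3-6) by auto
    then obtain L where L: "piece (L @ u # x # y # z # Q)" "starts A B (L @ u # x # y # z # Q)"
      "set L \<inter> F = {}" "list_all2 (\<in>) L [A]" using BA[OF u(2,3)] pr(3-5) by auto
    have "list_all2 (\<in>) (L @ [u]) ([A] @ [B])" using u(1) L(4) by (intro list_all2_appendI) auto
    thus ?thesis using L u(1) by (intro exI[of _ "L @ [u]"]) simp
  qed
  show "\<exists>L. piece (L @ x # y # z # Q) \<and> starts A B (L @ x # y # z # Q) \<and>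
      set L \<inter> F = {} \<and> list_all2 (\<in>) L [A, B]" if "x \<in> A" "y \<in> A" "z \<in> A"
    using AAA[OF P h _ that] Q by fastforce
  show "\<exists>L. piece (L @ x # y # z # Q) \<and> starts A B (L @ x # y # z # Q) \<and>
      set L \<inter> F = {} \<and> list_all2 (\<in>) L [A, B, A]" if m: "x \<in> A" "y \<in> A" "z \<in> B"
  proof -
    obtain u where u: "u \<in> A - F" "piece (u # x # y # z # Q)" "h3 u x y"
      using step[OF P h, of A] Q m nm[OF m(3)] by auto
    then obtain L where L: "piece (L @ u # x # y # z # Q)" "starts A B (L @ u # x # y # z # Q)"
      "set L \<inter> F = {}" "list_all2 (\<in>) L [A, B]" using AAA[OF u(2,3)] Q m by auto
    have "list_all2 (\<in>) (L @ [u]) ([A, B] @ [A])" using u(1) L(4) by (intro list_all2_appendI) auto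
    thus ?thesis using L u(1) by (intro exI[of _ "L @ [u]"]) simp
  qed
qed

end

lemma ex_conjunct1: "\<exists>x. P x \<and> Q x \<Longrightarrow> \<exists>x. P x"
  by blast

context near_extremal begin

lemma complete_right:
  assumes P: "piece (Q @ [x, y, z])" and h: "h3 x y z" and F: "finite F" "real (card F) \<le> 1 / 4 * real n"
    and Q: "length Q \<le> 100"
  shows "x \<in> A \<Longrightarrow> y \<in> B \<Longrightarrow> z \<in> B \<Longrightarrow> \<exists>R. piece (Q @ [x, y, z] @ R) \<and> ends B A (Q @ [x, y, z] @ R) \<and>
      set R \<inter> F = {} \<and> list_all2 (\<in>) R [B, A, B]"
    and "x \<in> B \<Longrightarrow> y \<in> B \<Longrightarrow> z \<in> A \<Longrightarrow> \<exists>R. piece (Q @ [x, y, z] @ R) \<and> ends B A (Q @ [x, y, z] @ R) \<and>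
      set R \<inter> F = {} \<and> list_all2 (\<in>) R [B]"
    and "x \<in> B \<Longrightarrow> y \<in> A \<Longrightarrow> z \<in> B \<Longrightarrow> \<exists>R. piece (Q @ [x, y, z] @ R) \<and> ends B A (Q @ [x, y, z] @ R) \<and>
      set R \<inter> F = {} \<and> list_all2 (\<in>) R []"
    and "x \<in> B \<Longrightarrow> y \<in> B \<Longrightarrow> z \<in> B \<Longrightarrow> \<exists>R. piece (Q @ [x, y, z] @ R) \<and> ends B A (Q @ [x, y, z] @ R) \<and>
      set R \<inter> F = {} \<and> list_all2 (\<in>) R [A, B]"
proof -
  interpret sw: near_extremal V E n B A Z by (rule swapped)
  have P': "sw.piece (z # y # x # rev Q)" "sw.h3 z y x"
    using piece_rev[OF P] h h3_commute(3) by (simp_all add: swap)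
  have *: "\<exists>R. piece (Q @ [x, y, z] @ R) \<and> ends B A (Q @ [x, y, z] @ R) \<and>
      set R \<inter> F = {} \<and> list_all2 (\<in>) R Xs"
    if ex: "\<exists>L. sw.piece (L @ z # y # x # rev Q) \<and> sw.starts B A (L @ z # y # x # rev Q) \<and> set L \<inter> F = {} \<and>
      list_all2 (\<in>) L (rev Xs)" for Xs
  proof -
    obtain L where L: "piece (L @ z # y # x # rev Q)" "starts B A (L @ z # y # x # rev Q)" "set L \<inter> F = {}"
      "list_all2 (\<in>) L (rev Xs)" using ex unfolding swap_starts by blast
    have eq: "rev (L @ z # y # x # rev Q) = Q @ [x, y, z] @ rev L" by simp
    have "piece (Q @ [x, y, z] @ rev L)" using piece_rev[OF L(1)] unfolding eq .
    moreover have "ends B A (Q @ [x, y, z] @ rev L)"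
      using L(2) ends_rev[of B A "L @ z # y # x # rev Q"] unfolding eq by blast
    moreover have "list_all2 (\<in>) (rev L) Xs" using L(4) by (simp only: list_all2_rev1)
    moreover have "set (rev L) \<inter> F = {}" using L(3) by simp
    ultimately show ?thesis by blast
  qed
  show "\<exists>R. piece (Q @ [x, y, z] @ R) \<and> ends B A (Q @ [x, y, z] @ R) \<and>
      set R \<inter> F = {} \<and> list_all2 (\<in>) R [B, A, B]" if "x \<in> A" "y \<in> B" "z \<in> B"
    using * sw.complete_left(1)[OF P' F] Q that by simp
  show "\<exists>R. piece (Q @ [x, y, z] @ R) \<and> ends B A (Q @ [x, y, z] @ R) \<and>
      set R \<inter> F = {} \<and> list_all2 (\<in>) R [B]" if "x \<in> B" "y \<in> B" "z \<in> A"
    using * sw.complete_left(2)[OF P' F] Q that by simp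
  show "\<exists>R. piece (Q @ [x, y, z] @ R) \<and> ends B A (Q @ [x, y, z] @ R) \<and>
      set R \<inter> F = {} \<and> list_all2 (\<in>) R []" if "x \<in> B" "y \<in> A" "z \<in> B"
    using *[of "[]"] sw.complete_left(3)[OF P' F] Q that by simp
  show "\<exists>R. piece (Q @ [x, y, z] @ R) \<and> ends B A (Q @ [x, y, z] @ R) \<and>
      set R \<inter> F = {} \<and> list_all2 (\<in>) R [A, B]" if "x \<in> B" "y \<in> B" "z \<in> B"
    using * sw.complete_left(4)[OF P' F] Q that by simp
qed

section \<open>Crossings and detours\<close>

text \<open>The length bound keeps the sets that later pieces must avoid small; what distinguishes
  crossings is the residue of \<open>w\<close> modulo 8.\<close>

definition crossing :: "'a set \<Rightarrow> nat \<Rightarrow> 'a list \<Rightarrow> bool" where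
  "crossing F w P \<longleftrightarrow> piece P \<and> starts A B P \<and> ends B A P \<and> set P \<inter> F = {} \<and> length P \<le> 20 \<and> wt P = w"

text \<open>\<open>wl\<close> and \<open>wr\<close> are the weights of the vertices that
  \<open>complete_left\<close> and \<open>complete_right\<close> add to reach ABA in front and BAB
  at the end: 7 for A, B, A, 11 for B, A, B, and so on.\<close>

lemma crossing_extending_core:
  assumes K: "piece K" "K = x # y # z # Q" "K = Q' @ [x', y', z']" "h3 x y z" "h3 x' y' z'" "length K \<le> 14"
    and F: "finite F" "real (card F) \<le> 1 / 5 * real n" "set K \<inter> F = {}"
    and left: "x \<in> A \<and> y \<in> A \<and> z \<in> B \<and> wl = 7 \<or> x \<in> B \<and> y \<in> A \<and> z \<in> A \<and> wl = 1 \<or>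
      x \<in> A \<and> y \<in> B \<and> z \<in> A \<and> wl = 0 \<or> x \<in> A \<and> y \<in> A \<and> z \<in> A \<and> wl = 6"
    and right: "x' \<in> A \<and> y' \<in> B \<and> z' \<in> B \<and> wr = 11 \<or> x' \<in> B \<and> y' \<in> B \<and> z' \<in> A \<and> wr = 5 \<or>
      x' \<in> B \<and> y' \<in> A \<and> z' \<in> B \<and> wr = 0 \<or> x' \<in> B \<and> y' \<in> B \<and> z' \<in> B \<and> wr = 6"
  shows "\<exists>P. crossing F (wl + wt K + wr) P \<and> set K \<subseteq> set P"
proof -
  have F': "real (card F) \<le> 1 / 4 * real n" using F(2) n_pos(1) by linarith
  have nm: "u \<in> B \<Longrightarrow> u \<notin> A" for u by (rule not_mem(2))
  have "\<exists>L. piece (L @ K) \<and> starts A B (L @ K) \<and> set L \<inter> F = {} \<and> wt L = wl \<and> length L \<le> 3"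
  proof -
    have "length Q \<le> 100" using K(2,6) by simp
    note c = complete_left[OF K(1)[unfolded K(2)] K(4) F(1) F' this]
    have "\<exists>L Xs. piece (L @ K) \<and> starts A B (L @ K) \<and> set L \<inter> F = {} \<and> list_all2 (\<in>) L Xs \<and>
      (Xs = [A, B, A] \<and> wl = 7 \<or> Xs = [A] \<and> wl = 1 \<or> Xs = [] \<and> wl = 0 \<or> Xs = [A, B] \<and> wl = 6)"
      using left unfolding K(2) by (elim disjE) (use c in blast)+
    then obtain L Xs where L: "piece (L @ K)" "starts A B (L @ K)" "set L \<inter> F = {}" "list_all2 (\<in>) L Xs"
      "Xs = [A, B, A] \<and> wl = 7 \<or> Xs = [A] \<and> wl = 1 \<or> Xs = [] \<and> wl = 0 \<or> Xs = [A, B] \<and> wl = 6" by blast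
    have "wt L = wl \<and> length L \<le> 3" using L(4,5) nm by (auto simp: list_all2_Cons2)
    thus ?thesis using L by blast
  qed
  then obtain L where L: "piece (L @ K)" "starts A B (L @ K)" "set L \<inter> F = {}" "wt L = wl" "length L \<le> 3" by blast
  have "\<exists>R. piece (L @ K @ R) \<and> ends B A (L @ K @ R) \<and> set R \<inter> F = {} \<and> wt R = wr \<and> length R \<le> 3"
  proof -
    have "length (L @ Q') \<le> 100" using K(3,6) L(5) by simp
    moreover have "piece ((L @ Q') @ [x', y', z'])" using L(1) K(3) by simp
    ultimately have c: "x' \<in> A \<Longrightarrow> y' \<in> B \<Longrightarrow> z' \<in> B \<Longrightarrow> \<exists>R. piece (L @ K @ R) \<and> ends B A (L @ K @ R) \<and>
        set R \<inter> F = {} \<and> list_all2 (\<in>) R [B, A, B]"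
      "x' \<in> B \<Longrightarrow> y' \<in> B \<Longrightarrow> z' \<in> A \<Longrightarrow> \<exists>R. piece (L @ K @ R) \<and> ends B A (L @ K @ R) \<and>
        set R \<inter> F = {} \<and> list_all2 (\<in>) R [B]"
      "x' \<in> B \<Longrightarrow> y' \<in> A \<Longrightarrow> z' \<in> B \<Longrightarrow> \<exists>R. piece (L @ K @ R) \<and> ends B A (L @ K @ R) \<and>
        set R \<inter> F = {} \<and> list_all2 (\<in>) R []"
      "x' \<in> B \<Longrightarrow> y' \<in> B \<Longrightarrow> z' \<in> B \<Longrightarrow> \<exists>R. piece (L @ K @ R) \<and> ends B A (L @ K @ R) \<and>
        set R \<inter> F = {} \<and> list_all2 (\<in>) R [A, B]"
      using complete_right[OF _ K(5) F(1) F', of "L @ Q'"] unfolding K(3) by simp_all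
    have "\<exists>R Xs. piece (L @ K @ R) \<and> ends B A (L @ K @ R) \<and> set R \<inter> F = {} \<and> list_all2 (\<in>) R Xs \<and>
      (Xs = [B, A, B] \<and> wr = 11 \<or> Xs = [B] \<and> wr = 5 \<or> Xs = [] \<and> wr = 0 \<or> Xs = [A, B] \<and> wr = 6)"
      using right by (elim disjE) (use c in blast)+
    then obtain R Xs where R: "piece (L @ K @ R)" "ends B A (L @ K @ R)" "set R \<inter> F = {}" "list_all2 (\<in>) R Xs"
      "Xs = [B, A, B] \<and> wr = 11 \<or> Xs = [B] \<and> wr = 5 \<or> Xs = [] \<and> wr = 0 \<or> Xs = [A, B] \<and> wr = 6" by blast
    have "wt R = wr \<and> length R \<le> 3" using R(4,5) nm by (auto simp: list_all2_Cons2)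
    thus ?thesis using R by blast
  qed
  then obtain R where R: "piece (L @ K @ R)" "ends B A (L @ K @ R)" "set R \<inter> F = {}" "wt R = wr" "length R \<le> 3" by blast
  have "crossing F (wl + wt K + wr) (L @ K @ R)"
    using R L(2-5) starts_append[OF L(2), of R] F(3) K(6) unfolding crossing_def by (auto simp: Int_Un_distrib2)
  thus ?thesis by (intro exI[of _ "L @ K @ R"]) auto
qed

lemmas crossing_of_core = crossing_extending_core[THEN ex_conjunct1]

text \<open>The smallest instance of the long paths: one block between two slots. The classes A ABA
  A weigh 9.\<close>

lemma join:
  assumes P: "piece P" "ends A B P" and Q: "piece Q" "starts A B Q" and PQ: "set P \<inter> set Q = {}"
    and F: "finite F" "real (card F) \<le> 1 / 4 * real n" "set P \<union> set Q \<subseteq> F"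
  shows "\<exists>M. piece (P @ M @ Q) \<and> set M \<inter> F = {} \<and> length M = 5 \<and> wt M = 9"
proof -
  obtain l1 l2 l3 P' where l: "P = P' @ [l1, l2, l3]" "l1 \<in> A" "l2 \<in> B" "l3 \<in> A" "h3 l1 l2 l3"
    using P(2) unfolding ends_def by blast
  obtain e1 e2 e3 Q' where e: "Q = [e1, e2, e3] @ Q'" "e1 \<in> A" "e2 \<in> B" "e3 \<in> A" "h3 e1 e2 e3"
    using Q(2) unfolding starts_def by blast
  have big: "7 / 10 * real n \<le> real (card (X - F))" if "X = A \<or> X = B" for X
  proof -
    have "card X \<le> card (X - F \<union> F)" using that F(1) by (intro card_mono) auto
    also have "\<dots> \<le> card (X - F) + card F" by (rule card_Un_le)
    finally show ?thesis using that F(2) card_bounds(3,4) by auto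
  qed
  have "1 / 10 * real n \<le> real (card (A - F))" "1 / 10 * real n \<le> real (card (B - F))"
    using big[of A] big[of B] n_pos(1) by simp_all
  then obtain p q r where b: "p \<in> A - F" "q \<in> B - F" "r \<in> A - F" "link (l1, l2, l3) (p, q, r)" "link (p, q, r) (e1, e2, e3)"
    using choose_block[OF l(5) e(5), of "A - F" "B - F" "\<lambda>_. 0"] by auto
  have h: "h3 p q r" using b(4) by (simp add: link_def)

  have pick1: "\<exists>x\<in>A - G. slot_ok x (k1, k2, k3) b" if "h3 k1 k2 k3" "link (k1, k2, k3) b" "finite G"
    "1 / 10 * real n \<le> real (card (A - G))" for k1 k2 k3 b G
  proof (rule ccontr)
    assume "\<not> ?thesis"
    hence "A - G \<subseteq> {x \<in> A \<union> B. \<not> slot_ok x (k1, k2, k3) b}" by blast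
    hence "card (A - G) \<le> card {x \<in> A \<union> B. \<not> slot_ok x (k1, k2, k3) b}" by (intro card_mono) auto
    hence "real (card (A - G)) \<le> 4 / 10 ^ 7 * real n"
      using few_slot_bad[OF that(1,2)] unfolding few_def by linarith
    moreover have "4 / 10 ^ 7 * real n < 1 / 10 * real n" using n_pos(1) by simp
    ultimately show False using that(4) by linarith
  qed
  have size: "1 / 10 * real n \<le> real (card (A - (F \<union> S)))" if "finite S" "card S \<le> 4" for S
  proof -
    have "card (A - F) \<le> card (A - (F \<union> S) \<union> S)" using that by (intro card_mono) auto
    also have "\<dots> \<le> card (A - (F \<union> S)) + card S" by (rule card_Un_le)
    finally have "real (card (A - F)) \<le> real (card (A - (F \<union> S))) + 4" using that(2) by linarith
    moreover have "10 ^ 5 \<le> real n" by (rule order_trans[OF _ n_real]) simp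
    ultimately show ?thesis using big[of A] by simp
  qed
  obtain x where x: "x \<in> A - (F \<union> {p, q, r})" "slot_ok x (l1, l2, l3) (p, q, r)"
    using pick1[OF l(5) b(4), of "F \<union> {p, q, r}"] size[of "{p, q, r}"] F(1) by (auto simp: card_insert_if)
  obtain y where y: "y \<in> A - (F \<union> {p, q, r, x})" "slot_ok y (p, q, r) (e1, e2, e3)"
    using pick1[OF h b(5), of "F \<union> {p, q, r, x}"] size[of "{p, q, r, x}"] F(1) by (auto simp: card_insert_if)
  let ?M = "[x, p, q, r, y]"
  have M: "?M = weave [x, y] [(p, q, r)]" by simp
  have dM: "distinct ?M" using x(1) y(1) h by (auto simp: h3_def)
  have MF: "set ?M \<inter> F = {}" using x(1) y(1) b by auto
  have sets: "{l1, l2, l3} \<subseteq> set P" "{e1, e2, e3} \<subseteq> set Q" by (auto simp: l(1) e(1))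
  have "tight_path E ([l1, l2, l3] @ weave [x, y] [(p, q, r)] @ [e1, e2, e3])"
  proof (rule weave_tight)
    show "chain (l1, l2, l3) [(p, q, r)] (e1, e2, e3)" using b(4,5) by simp
    show "slot_ok ([x, y] ! i) (((l1, l2, l3) # [(p, q, r)]) ! i) (([(p, q, r)] @ [(e1, e2, e3)]) ! i)"
      if "i \<le> length [(p, q, r)]" for i
      using that x(2) y(2) by (cases i) auto
    show "distinct (weave [x, y] [(p, q, r)])" using dM by simp
    show "set (weave [x, y] [(p, q, r)]) \<inter> {l1, l2, l3, e1, e2, e3} = {}"
      using MF sets F(3) by (simp only: M[symmetric]) blast
    show "{l1, l2, l3} \<inter> {e1, e2, e3} = {}" using sets PQ by (meson disjoint_iff subsetD)
  qed (use l e b x(1) y(1) in auto)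
  hence t: "tight_path E ([l1, l2, l3] @ ?M @ [e1, e2, e3])" by simp
  have "tight_path E (P @ ?M @ [e1, e2, e3])"
    using tight_path_glue[of E P' l1 l2 l3 "?M @ [e1, e2, e3]"] P(1) t l(1) by (simp add: piece_def)
  hence "tight_path E (P @ ?M @ Q)"
    using tight_path_append[of E "P @ ?M" "[e1, e2, e3]" Q'] Q(1) e(1) by (simp add: piece_def)
  moreover have "distinct (P @ ?M @ Q)" using P(1) Q(1) PQ dM MF F(3) unfolding piece_def by auto
  moreover have "set (P @ ?M @ Q) \<subseteq> V" using P(1) Q(1) x(1) y(1) b(1-3) in_V(1,2) by (auto simp: piece_def)
  ultimately have "piece (P @ ?M @ Q)" by (simp add: piece_def)
  moreover have "wt ?M = 9" using x(1) y(1) b not_mem(2)[of q] by auto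
  ultimately show ?thesis using MF by (intro exI[of _ ?M]) simp
qed

lemma pick_in:
  assumes "\<forall>P\<in>set Ps. few (1 / 10 ^ 7) P" "length Ps \<le> 100" "C \<subseteq> A \<union> B" "1 / 20 * real n \<le> real (card C)"
    and "finite F" "real (card F) \<le> 1 / 50 * real n"
  shows "\<exists>u\<in>C - F. \<forall>P\<in>set Ps. P u"
proof (rule pick[OF assms(1,2)])
  have "finite C" using finite_subset[OF assms(3)] by simp
  hence "card C \<le> card (C - F \<union> F)" using assms(5) by (intro card_mono) auto
  also have "\<dots> \<le> card (C - F) + card F" by (rule card_Un_le)
  finally have "real (card C) \<le> real (card (C - F)) + real (card F)" by linarith
  thus "1 / 1000 * real n \<le> real (card (C - F))" using assms(4,6) n_pos(1) by linarith
qed (use assms(3) in auto)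

lemma card_insert_real_le:
  assumes "finite F" "real (card F) \<le> 1 / 100 * real n" "length xs \<le> 1000"
  shows "finite (F \<union> set xs)" "real (card (F \<union> set xs)) \<le> 1 / 50 * real n"
proof -
  have "card (F \<union> set xs) \<le> card F + 1000"
    using card_Un_le[of F "set xs"] card_length[of xs] assms(3) by linarith
  moreover have "10 ^ 6 \<le> real n" by (rule order_trans[OF _ n_real]) simp
  ultimately show "real (card (F \<union> set xs)) \<le> 1 / 50 * real n" using assms(2) by simp
qed (use assms(1) in simp)

lemma h3_cons:
  assumes "u \<in> A \<union> B" "x \<in> A \<union> B" "y \<in> A \<union> B" "x \<noteq> y" "u \<noteq> x" "u \<noteq> y" "g3 x y u" "g2 x u" "g2 y u" "g2 x y"
  shows "h3 u x y" "h3 x y u"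
proof -
  show "h3 x y u" using assms unfolding h3_def by auto
  thus "h3 u x y" using h3_commute(1)[of u x y] h3_commute(2)[of x u y] by simp
qed

lemma edge_distinct: "{x, y, z, u} \<in> E \<Longrightarrow> distinct [x, y, z, u]"
  using edge[of "{x, y, z, u}"] card4[of x y z u] by simp

lemma extend_rich:
  assumes xy: "x \<in> A \<union> B" "y \<in> A \<union> B" "x \<noteq> y" "g2 x y" and C: "C \<subseteq> A \<union> B"
    and rich: "1 / 20 * real n \<le> real (card {u \<in> C. {x, y, z, u} \<in> E})"
    and F: "finite F" "real (card F) \<le> 1 / 100 * real n"
  shows "\<exists>u\<in>C - F. {u, x, y, z} \<in> E \<and> h3 u x y"
proof -
  have "\<exists>u\<in>{u \<in> C. {x, y, z, u} \<in> E} - F. \<forall>T\<in>set [g3 x y, g2 x, g2 y]. T u"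
    using few_g3[OF xy(4)] few_g2[OF xy(1)] few_g2[OF xy(2)] C F n_pos(1)
    by (intro pick_in rich) auto
  then obtain u where u: "u \<in> C - F" "{x, y, z, u} \<in> E" "g3 x y u" "g2 x u" "g2 y u" by auto
  have "distinct [x, y, z, u]" by (rule edge_distinct[OF u(2)])
  hence "h3 u x y" using u xy C by (intro h3_cons(1)) auto
  moreover have "{u, x, y, z} \<in> E" using u(2) by (simp add: insert_commute)
  ultimately show ?thesis using u(1) by blast
qed

text \<open>The AABB edge is the switching window of the core A A B A B B: the window before it has
  type AAAB, the one after it ABBB, and richness supplies both. The total weight is 7 + 18 +
  11.\<close>

lemma crossing_of_edge:
  assumes m: "a \<in> A" "x \<in> A" "b \<in> B" "b' \<in> B" and e: "{a, b, x, b'} \<in> E" and g: "g2 a b" "g2 x b'"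
    and rich: "1 / 10 * real n \<le> real (card {y \<in> A. {a, b, x, y} \<in> E})"
      "1 / 10 * real n \<le> real (card {z \<in> B. {x, b', b, z} \<in> E})"
    and F: "finite F" "real (card F) \<le> 1 / 1000 * real n" "{a, b, x, b'} \<inter> F = {}"
  shows "\<exists>P. crossing F 36 P"
proof -
  have n5: "10 ^ 5 \<le> real n" by (rule order_trans[OF _ n_real]) simp
  have F': "finite (F \<union> set xs)" "real (card (F \<union> set xs)) \<le> 1 / 100 * real n" if "length xs \<le> 10" for xs
    using card_Un_le[of F "set xs"] card_length[of xs] that F n5 by auto
  have d: "distinct [a, b, x, b']" by (rule edge_distinct[OF e])
  have r: "1 / 20 * real n \<le> real (card {y \<in> A. {a, b, x, y} \<in> E})"
      "1 / 20 * real n \<le> real (card {z \<in> B. {x, b', b, z} \<in> E})" using rich n_pos(1) by linarith+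
  obtain y where y: "y \<in> A - (F \<union> set [a, b, x, b'])" "{y, a, b, x} \<in> E" "h3 y a b"
    using extend_rich[OF _ _ _ g(1) _ r(1) F'[of "[a, b, x, b']"]] m d by auto
  obtain z where z: "z \<in> B - (F \<union> set [a, b, x, b', y])" "{z, x, b', b} \<in> E" "h3 z x b'"
    using extend_rich[OF _ _ _ g(2) _ r(2) F'[of "[a, b, x, b', y]"]] m d by auto
  let ?K = "[y, a, b, x, b', z]"
  have "{b, x, b', z} \<in> E" using z(2) by (simp add: insert_commute)
  moreover have "y \<noteq> z" using y z by auto
  ultimately have K: "piece ?K" using e d y z m in_V unfolding piece_def by auto
  have "h3 x b' z" using z(3) h3_commute(1)[of z x b'] h3_commute(2)[of x z b'] by simp
  hence "\<exists>P. crossing F (7 + wt ?K + 11) P"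
    using m y z F n_pos(1)
    by (intro crossing_of_core[OF K, of y a b "[x, b', z]" "[y, a, b]" x b' z F 7 11]) auto
  moreover have "wt ?K = 18" using m y z not_mem(2) by auto
  ultimately show ?thesis by simp
qed

text \<open>With the connecting vertices of \<open>join\<close>, of weight 9, a detour adds 23,
  which is -1 modulo 8, while the regular pattern adds 0 per period. So detours move the
  residue.\<close>

definition detour :: "'a set \<Rightarrow> 'a list \<Rightarrow> bool" where
  "detour F P \<longleftrightarrow> piece P \<and> starts A B P \<and> ends A B P \<and> set P \<inter> F = {} \<and> length P \<le> 20 \<and> wt P = 14"

text \<open>In A B A A B A the AABB edge is the middle window, and the windows before and after it
  are of type AAAB: the path re-enters the same pattern out of phase.\<close>

lemma detour_of_edge:
  assumes m: "a \<in> A" "x \<in> A" "b \<in> B" "b' \<in> B" and e: "{a, b, x, b'} \<in> E" and g: "g2 a b" "g2 x b'"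
    and rich: "1 / 10 * real n \<le> real (card {y \<in> A. {a, b, x, y} \<in> E})"
      "1 / 10 * real n \<le> real (card {y \<in> A. {x, b', a, y} \<in> E})"
    and F: "finite F" "real (card F) \<le> 1 / 1000 * real n" "{a, b, x, b'} \<inter> F = {}"
  shows "\<exists>P. detour F P"
proof -
  have n5: "10 ^ 5 \<le> real n" by (rule order_trans[OF _ n_real]) simp
  have F': "finite (F \<union> set xs)" "real (card (F \<union> set xs)) \<le> 1 / 100 * real n" if "length xs \<le> 10" for xs
    using card_Un_le[of F "set xs"] card_length[of xs] that F n5 by auto
  have d: "distinct [a, b, x, b']" by (rule edge_distinct[OF e])
  have r: "1 / 20 * real n \<le> real (card {y \<in> A. {a, b, x, y} \<in> E})"
      "1 / 20 * real n \<le> real (card {y \<in> A. {x, b', a, y} \<in> E})" using rich n_pos(1) by linarith+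
  obtain y where y: "y \<in> A - (F \<union> set [a, b, x, b'])" "{y, a, b, x} \<in> E" "h3 y a b"
    using extend_rich[OF _ _ _ g(1) _ r(1) F'[of "[a, b, x, b']"]] m d by auto
  obtain z where z: "z \<in> A - (F \<union> set [a, b, x, b', y])" "{z, x, b', a} \<in> E" "h3 z x b'"
    using extend_rich[OF _ _ _ g(2) _ r(2) F'[of "[a, b, x, b', y]"]] m d by auto
  let ?K = "[y, b, a, x, b', z]"
  have "{y, b, a, x} \<in> E" "{b, a, x, b'} \<in> E" "{a, x, b', z} \<in> E"
    using y(2) e z(2) by (simp_all add: insert_commute)
  hence K: "piece ?K" using d y z m in_V unfolding piece_def by auto
  have "h3 x b' z" using z(3) h3_commute(1)[of z x b'] h3_commute(2)[of x z b'] by simp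
  hence "ends A B ?K" unfolding ends_def using m z
    by (intro exI[of _ x] exI[of _ b'] exI[of _ z] exI[of _ "[y, b, a]"]) auto
  moreover have "h3 y b a" using y(3) h3_commute(2)[of y a b] by simp
  hence "starts A B ?K" unfolding starts_def using m y
    by (intro exI[of _ y] exI[of _ b] exI[of _ a] exI[of _ "[x, b', z]"]) auto
  moreover have "wt ?K = 14" using m y z not_mem(2) by auto
  moreover have "set ?K \<inter> F = {}" using y z F by auto
  ultimately show ?thesis using K unfolding detour_def by (intro exI[of _ ?K]) simp
qed

end

text \<open>Otherwise every edge has an end of degree one. The edges whose left end has degree one
  inject into \<open>X\<close>, those whose right end has degree one into \<open>Y\<close>.\<close>

lemma bipartite_path3:
  fixes G :: "('b \<times> 'b) set"
  assumes "finite X" "finite Y" "G \<subseteq> X \<times> Y" "card X + card Y < card G"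
  shows "\<exists>p q p' q'. (p, q) \<in> G \<and> (p', q) \<in> G \<and> (p, q') \<in> G \<and> p' \<noteq> p \<and> q' \<noteq> q"
proof (rule ccontr)
  assume no: "\<not> ?thesis"
  define G1 G2 where "G1 = {e \<in> G. \<forall>q'. (fst e, q') \<in> G \<longrightarrow> q' = snd e}"
    and "G2 = {e \<in> G. \<forall>p'. (p', snd e) \<in> G \<longrightarrow> p' = fst e}"
  have mem: "p \<in> X \<and> q \<in> Y" if "(p, q) \<in> G" for p q using that assms(3) by blast
  have G1: "(p, q) \<in> G1 \<longleftrightarrow> (p, q) \<in> G \<and> (\<forall>q'. (p, q') \<in> G \<longrightarrow> q' = q)" for p q by (simp add: G1_def)
  have G2: "(p, q) \<in> G2 \<longleftrightarrow> (p, q) \<in> G \<and> (\<forall>p'. (p', q) \<in> G \<longrightarrow> p' = p)" for p q by (simp add: G2_def)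
  have sub: "G1 \<subseteq> G" "G2 \<subseteq> G" by (simp_all add: G1_def G2_def Collect_restrict)
  have "card G1 \<le> card X"
  proof (rule card_inj_on_le[of fst])
    show "inj_on fst G1"
    proof (rule inj_onI, clarify)
      fix p q p' q' assume "(p, q) \<in> G1" "(p', q') \<in> G1" and eq: "fst (p, q) = fst (p', q')"
      moreover from eq have "p' = p" by simp
      ultimately show "p = p' \<and> q = q'" unfolding G1 by simp
    qed
    show "fst ` G1 \<subseteq> X"
    proof
      fix p assume "p \<in> fst ` G1"
      then obtain q where "(p, q) \<in> G" by (auto simp: G1)
      thus "p \<in> X" using mem by blast
    qed
  qed (fact assms(1))
  moreover have "card G2 \<le> card Y"
  proof (rule card_inj_on_le[of snd])
    show "inj_on snd G2"
    proof (rule inj_onI, clarify)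
      fix p q p' q' assume "(p, q) \<in> G2" "(p', q') \<in> G2" and eq: "snd (p, q) = snd (p', q')"
      moreover from eq have "q' = q" by simp
      ultimately show "p = p' \<and> q = q'" unfolding G2 by simp
    qed
    show "snd ` G2 \<subseteq> Y"
    proof
      fix q assume "q \<in> snd ` G2"
      then obtain p where "(p, q) \<in> G" by (auto simp: G2)
      thus "q \<in> Y" using mem by blast
    qed
  qed (fact assms(2))
  moreover have "G \<subseteq> G1 \<union> G2"
  proof
    fix e assume e: "e \<in> G"
    obtain p q where pq: "e = (p, q)" by (cases e)
    show "e \<in> G1 \<union> G2"
    proof (rule ccontr)
      assume "e \<notin> G1 \<union> G2"
      then obtain q' p' where "(p, q') \<in> G" "q' \<noteq> q" "(p', q) \<in> G" "p' \<noteq> p"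
        using e unfolding pq Un_iff G1 G2 by blast
      thus False using no e unfolding pq by blast
    qed
  qed
  hence "card G \<le> card (G1 \<union> G2)"
    using sub finite_subset[OF assms(3)] assms(1,2) by (intro card_mono) (auto intro: finite_subset)
  hence "card G \<le> card G1 + card G2" using card_Un_le[of G1 G2] by linarith
  ultimately show False using assms(4) by linarith
qed

section \<open>Crossings through a pair from \<open>A\<close> and \<open>B\<close> that is not
  typical\<close>

context near_extremal begin

lemma card_pairs_le:
  fixes e :: real
  assumes "0 \<le> e" "\<And>p. p \<in> A \<union> B \<Longrightarrow> real (card {q \<in> A \<union> B. \<not> P p q}) \<le> e * real n"
  shows "real (card {(p, q). p \<in> A \<union> B \<and> q \<in> A \<union> B \<and> \<not> P p q}) \<le> 3 * e * real n ^ 2"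
proof -
  have "{(p, q). p \<in> A \<union> B \<and> q \<in> A \<union> B \<and> \<not> P p q} = Sigma (A \<union> B) (\<lambda>p. {q \<in> A \<union> B. \<not> P p q})" by auto
  also have "real (card \<dots>) \<le> e * real n * real (card (A \<union> B))"
    using assms(2) by (intro card_Sigma_le) auto
  also have "\<dots> \<le> e * real n * (3 * real n)"
    using card_AB assms(1) n_pos(1) by (intro mult_left_mono) auto
  finally show ?thesis by (simp add: power2_eq_square)
qed

text \<open>Failure of \<open>g2\<close> gives 10^-7 n third vertices with 10^-7 n deviating fourth
  vertices each. Deviations that are missing odd sets are charged to AABB edges by
  \<open>missing_A\<close> and \<open>missing_B\<close>, so up to a tiny error a quarter of the
  count consists of AABB edges through the pair.\<close>

lemma many_AABB_of_bad_pair: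
  assumes m: "a \<in> A" "b \<in> B" and bad: "\<not> g2 a b"
  shows "1 / 10 ^ 15 * real n ^ 2 \<le> real (card {(p, q). p \<in> A \<and> q \<in> B \<and> {a, b, p, q} \<in> E})"
proof -
  let ?G = "{(p, q). p \<in> A \<and> q \<in> B \<and> {a, b, p, q} \<in> E}"
  have finG: "finite ?G" by (rule finite_subset[of _ "A \<times> B"]) auto
  let ?W = "Sigma {z \<in> A \<union> B. \<not> g3 a b z} (\<lambda>z. {u \<in> A \<union> B. W {a, b, z, u}})"
  have lower: "1 / 10 ^ 7 * real n * (1 / 10 ^ 7 * real n) \<le> real (card ?W)"
  proof -
    have "1 / 10 ^ 7 * real n * (1 / 10 ^ 7 * real n) \<le> 1 / 10 ^ 7 * real n * real (card {z \<in> A \<union> B. \<not> g3 a b z})"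
      using bad unfolding g2_def few_def by (intro mult_left_mono) auto
    also have "\<dots> \<le> real (card ?W)"
      by (intro card_Sigma_ge) (auto simp: g3_def few_def)
    finally show ?thesis .
  qed
  let ?S1 = "{x. (\<lambda>(p, q). (p, q)) x \<in> ?G}" and ?S2 = "{x. (\<lambda>(q, p). (p, q)) x \<in> ?G}"
  let ?S3 = "Sigma A (\<lambda>p. {q \<in> A. W {a, p, b, q}})" and ?S4 = "Sigma B (\<lambda>p. {q \<in> B. W {b, p, a, q}})"
  have "?W \<subseteq> ?S1 \<union> (?S2 \<union> (?S3 \<union> ?S4))"
  proof
    fix s assume "s \<in> ?W"
    then obtain z u where s: "s = (z, u)" "z \<in> A \<union> B" "u \<in> A \<union> B" "W {a, b, z, u}" by auto
    have eqs: "{a, z, b, u} = {a, b, z, u}" "{b, z, a, u} = {a, b, z, u}" "{a, b, u, z} = {a, b, z, u}" by auto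
    have par: "cA a + cA b + cA z + cA u = 2 \<and> {a, b, z, u} \<in> E \<or> odd (cA a + cA b + cA z + cA u)"
      using s(4) unfolding W4 by blast
    show "s \<in> ?S1 \<union> (?S2 \<union> (?S3 \<union> ?S4))"
      using s(2-4) par m not_mem(2)[of b] not_mem(2)[of z] not_mem(2)[of u] unfolding s(1)
      by (elim UnE) (simp_all add: eqs)
  qed
  moreover have "finite (?S1 \<union> (?S2 \<union> (?S3 \<union> ?S4)))"
    using finite_vimageI[OF finG, of "\<lambda>(p, q). (p, q)"] finite_vimageI[OF finG, of "\<lambda>(q, p). (p, q)"]
    by (simp add: vimage_def inj_on_def)
  ultimately have "card ?W \<le> card (?S1 \<union> (?S2 \<union> (?S3 \<union> ?S4)))" by (intro card_mono)
  also have "\<dots> \<le> card ?S1 + (card ?S2 + (card ?S3 + card ?S4))"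
    by (intro order_trans[OF card_Un_le] add_left_mono order_refl)
  finally have W: "card ?W \<le> card ?S1 + (card ?S2 + (card ?S3 + card ?S4))" .
  have "card ?S1 \<le> card ?G" "card ?S2 \<le> card ?G"
    by (intro card_preimage_le[OF finG]; auto simp: inj_on_def)+
  moreover have "real (card ?S3) \<le> real (card ?G) + 6 / 10 ^ 110 * real n ^ 2"
  proof -
    let ?U = "Sigma A (\<lambda>p. {q \<in> B. {a, p, b, q} \<in> E})"
    have "real (card ?S3) \<le> real (card ?U) + 3 / 10 ^ 110 * real n * real (card A)"
    proof (rule card_Sigma_mono)
      fix p assume p: "p \<in> A"
      show "real (card {q \<in> A. W {a, p, b, q}}) \<le> real (card {q \<in> B. {a, p, b, q} \<in> E}) + 3 / 10 ^ 110 * real n"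
      proof (cases "p = a")
        case True
        hence "{q \<in> A. W {a, p, b, q}} = {}" using W_distinct by fastforce
        thus ?thesis by (simp only: card.empty) simp
      qed (use missing_A[OF m(1) p m(2)] in auto)
    qed auto
    also have "?U = {(p, q). p \<in> A \<and> q \<in> B \<and> {a, b, p, q} \<in> E}" by (auto simp: insert_commute)
    also have "3 / 10 ^ 110 * real n * real (card A) \<le> 3 / 10 ^ 110 * real n * (2 * real n)"
      using card_bounds(1) n_pos(1) by (intro mult_left_mono) auto
    finally show ?thesis by (simp add: power2_eq_square)
  qed
  moreover have "real (card ?S4) \<le> real (card ?G) + 6 / 10 ^ 110 * real n ^ 2"
  proof -
    let ?U = "Sigma B (\<lambda>p. {q \<in> A. {b, p, a, q} \<in> E})"
    have "real (card ?S4) \<le> real (card ?U) + 3 / 10 ^ 110 * real n * real (card B)"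
    proof (rule card_Sigma_mono)
      fix p assume p: "p \<in> B"
      show "real (card {q \<in> B. W {b, p, a, q}}) \<le> real (card {q \<in> A. {b, p, a, q} \<in> E}) + 3 / 10 ^ 110 * real n"
      proof (cases "p = b")
        case True
        hence "{q \<in> B. W {b, p, a, q}} = {}" using W_distinct by fastforce
        thus ?thesis by (simp only: card.empty) simp
      qed (use missing_B[OF m(2) p m(1)] in auto)
    qed auto
    also have "card ?U \<le> card ?G"
    proof -
      have "{b, p, a, q} = {a, b, q, p}" for p q by auto
      hence "?U = {x. (\<lambda>(q, p). (p, q)) x \<in> ?G}" by auto
      thus ?thesis using card_preimage_le[OF finG, of "\<lambda>(q, p). (p, q)"] by (simp add: inj_on_def)
    qed
    also have "3 / 10 ^ 110 * real n * real (card B) \<le> 3 / 10 ^ 110 * real n * (2 * real n)"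
      using card_bounds(2) n_pos(1) by (intro mult_left_mono) auto
    finally show ?thesis by (simp add: power2_eq_square)
  qed
  ultimately have "real (card ?W) \<le> 4 * real (card ?G) + 12 / 10 ^ 110 * real n ^ 2" using W by linarith
  moreover have "1 / 10 ^ 7 * real n * (1 / 10 ^ 7 * real n) = 1 / 10 ^ 14 * real n ^ 2"
    by (simp add: power2_eq_square)
  moreover have "0 \<le> real n ^ 2" by simp
  ultimately show ?thesis using lower by (simp only: pow_simps; linarith)
qed

definition typical :: "'a \<Rightarrow> 'a \<Rightarrow> 'a \<Rightarrow> 'a \<Rightarrow> bool" where
  "typical a b p q \<longleftrightarrow> g3 a p q \<and> g3 b p q \<and> g2 a p \<and> g2 a q \<and> g2 b p \<and> g2 b q \<and> g2 p q"

text \<open>Pairs that are atypical or meet \<open>F\<close> have density of order 10^-20 and cannot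
  exhaust the 10^-15 n^2 AABB edges at the bad pair. A quadratic number remains, more than the
  linear bound of \<open>bipartite_path3\<close>.\<close>

lemma typical_edges:
  assumes m: "a \<in> A" "b \<in> B" and bad: "\<not> g2 a b"
    and F: "finite F" "real (card F) \<le> 1 / 10 ^ 20 * real n"
  shows "card A + card B < card {(p, q). p \<in> A - F \<and> q \<in> B - F \<and> {a, b, p, q} \<in> E \<and> typical a b p q}"
proof -
  let ?G = "{(p, q). p \<in> A \<and> q \<in> B \<and> {a, b, p, q} \<in> E}"
  let ?H = "{(p, q). p \<in> A - F \<and> q \<in> B - F \<and> {a, b, p, q} \<in> E \<and> typical a b p q}"
  let ?X = "\<lambda>P. {(p, q). p \<in> A \<union> B \<and> q \<in> A \<union> B \<and> \<not> P p q}"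
  have finX: "finite (?X P)" for P by (rule finite_subset[of _ "(A \<union> B) \<times> (A \<union> B)"]) auto
  have ab: "a \<in> A \<union> B" "b \<in> A \<union> B" using m by auto
  have flip: "real (card (?X (\<lambda>p q. P q p))) \<le> real (card (?X P))" for P :: "'a \<Rightarrow> 'a \<Rightarrow> bool"
  proof -
    have "?X (\<lambda>p q. P q p) = {x. prod.swap x \<in> ?X P}" by auto
    thus ?thesis using card_preimage_le[OF finX, of prod.swap P] by simp
  qed
  have g2c: "real (card (?X (\<lambda>p q. g2 v q))) \<le> 1 / 10 ^ 20 * real n ^ 2" if "v \<in> A \<union> B" for v
  proof -
    have "real (card (?X (\<lambda>p q. g2 v q))) \<le> 3 * (1 / 10 ^ 22) * real n ^ 2"
      using few_g2_strong[OF that] unfolding few_def by (intro card_pairs_le) auto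
    thus ?thesis using zero_le_power2[of "real n"] by (simp only: pow_simps; linarith)
  qed
  have g2pq: "real (card (?X g2)) \<le> 1 / 10 ^ 20 * real n ^ 2"
  proof -
    have "real (card (?X g2)) \<le> 3 * (1 / 10 ^ 22) * real n ^ 2"
      using few_g2_strong unfolding few_def by (intro card_pairs_le) auto
    thus ?thesis using zero_le_power2[of "real n"] by (simp only: pow_simps; linarith)
  qed
  have fF: "real (card (?X (\<lambda>p q. q \<notin> F))) \<le> 3 / 10 ^ 20 * real n ^ 2"
  proof -
    have "real (card (?X (\<lambda>p q. q \<notin> F))) \<le> 3 * (1 / 10 ^ 20) * real n ^ 2"
      using few_notin[OF F] unfolding few_def by (intro card_pairs_le) auto
    thus ?thesis by simp
  qed
  have g3c: "real (card (?X (g3 v))) \<le> 1 / 10 ^ 20 * real n ^ 2" if "v \<in> A \<union> B" for v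
    using not_g3_pairs[OF that] zero_le_power2[of "real n"] by (simp only: pow_simps; linarith)
  define X1 X2 X3 X4 X5 X6 X7 X8 X9 where "X1 = ?X (g3 a)" and "X2 = ?X (g3 b)"
    and "X3 = ?X (\<lambda>p q. g2 a q)" and "X4 = ?X (\<lambda>p q. g2 b q)"
    and "X5 = ?X (\<lambda>p q. g2 a p)" and "X6 = ?X (\<lambda>p q. g2 b p)" and "X7 = ?X g2"
    and "X8 = ?X (\<lambda>p q. p \<notin> F)" and "X9 = ?X (\<lambda>p q. q \<notin> F)"
  note X_defs = X1_def X2_def X3_def X4_def X5_def X6_def X7_def X8_def X9_def
  have X: "real (card X1) \<le> 1 / 10 ^ 20 * real n ^ 2" "real (card X2) \<le> 1 / 10 ^ 20 * real n ^ 2"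
    "real (card X3) \<le> 1 / 10 ^ 20 * real n ^ 2" "real (card X4) \<le> 1 / 10 ^ 20 * real n ^ 2"
    "real (card X5) \<le> 1 / 10 ^ 20 * real n ^ 2" "real (card X6) \<le> 1 / 10 ^ 20 * real n ^ 2"
    "real (card X7) \<le> 1 / 10 ^ 20 * real n ^ 2"
    "real (card X8) \<le> 3 / 10 ^ 20 * real n ^ 2" "real (card X9) \<le> 3 / 10 ^ 20 * real n ^ 2"
    unfolding X_defs
    by (fact g3c[OF ab(1)] g3c[OF ab(2)] g2c[OF ab(1)] g2c[OF ab(2)] g2pq fF
      order_trans[OF flip g2c[OF ab(1)]] order_trans[OF flip g2c[OF ab(2)]] order_trans[OF flip fF])+
  have finXs: "finite X1" "finite X2" "finite X3" "finite X4" "finite X5" "finite X6" "finite X7" "finite X8" "finite X9"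
    unfolding X_defs by (rule finX)+
  let ?U = "X1 \<union> (X2 \<union> (X3 \<union> (X4 \<union> (X5 \<union> (X6 \<union> (X7 \<union> (X8 \<union> X9)))))))"
  have finH: "finite ?H" by (rule finite_subset[of _ "A \<times> B"]) auto
  have "?G \<subseteq> ?H \<union> ?U"
  proof
    fix s assume "s \<in> ?G"
    then obtain p q where s: "s = (p, q)" "p \<in> A" "q \<in> B" "{a, b, p, q} \<in> E" by auto
    show "s \<in> ?H \<union> ?U"
      using s(2-4) unfolding s(1) typical_def X_defs by (simp; blast)
  qed
  hence "card ?G \<le> card (?H \<union> ?U)" using finXs finH by (intro card_mono) simp_all
  also have "\<dots> \<le> card ?H + (card X1 + (card X2 + (card X3 + (card X4 + (card X5 + (card X6 + (card X7 +
      (card X8 + card X9))))))))"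
    by (intro order_trans[OF card_Un_le] add_left_mono order_refl)
  finally have "card ?G \<le> card ?H + (card X1 + (card X2 + (card X3 + (card X4 + (card X5 + (card X6 + (card X7 +
      (card X8 + card X9))))))))" .
  hence "real (card ?G) \<le> real (card ?H) + 13 * (1 / 10 ^ 20 * real n ^ 2)"
    using X by (simp only: pow_simps; linarith)
  hence "1 / 10 ^ 15 * real n ^ 2 \<le> real (card ?H) + 13 * (1 / 10 ^ 20 * real n ^ 2)"
    using many_AABB_of_bad_pair[OF m bad] by linarith
  hence "1 / 10 ^ 16 * real n ^ 2 \<le> real (card ?H)"
    using zero_le_power2[of "real n"] by (simp only: pow_simps; linarith)
  moreover have "10 ^ 17 \<le> real n" by (rule order_trans[OF _ n_real]) simp
  hence "10 ^ 17 * real n \<le> real n ^ 2" unfolding power2_eq_square by (intro mult_right_mono) auto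
  ultimately have "10 * real n \<le> real (card ?H)" by simp
  hence "real (card A + card B) < real (card ?H)" using card_bounds(1,2) n_pos(1) unfolding of_nat_add by linarith
  thus ?thesis by (simp only: of_nat_less_iff)
qed

text \<open>Pairs inside \<open>M\<close> may be untypical; the conditions concern its two ends,
  where parity must admit a vertex of \<open>A\<close> in front and one of \<open>B\<close>
  behind.\<close>

lemma close_core:
  assumes M: "piece M" "M = s # t # u # Q" "M = Q' @ [u', t', s']" "length M \<le> 10" "set M \<subseteq> A \<union> B"
    and l: "g3 s t u" "g2 s t" "even (cA s + cA t + cA u)"
    and r: "g3 s' t' u'" "g2 s' t'" "odd (cA s' + cA t' + cA u')"
    and F: "finite F" "real (card F) \<le> 1 / 100 * real n"
  shows "\<exists>y z. y \<in> A - F \<and> z \<in> B - F \<and> piece (y # M @ [z]) \<and> h3 y s t \<and> h3 t' s' z"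
proof -
  have d: "distinct (s # t # u # Q)" "distinct (Q' @ [u', t', s'])"
    using M(1) unfolding M(2)[symmetric] M(3)[symmetric] piece_def by blast+
  have sub: "{s, t, u} \<subseteq> A \<union> B" "{s', t', u'} \<subseteq> A \<union> B"
    using M(5) by (simp add: M(2), simp add: M(3))
  let ?F = "F \<union> set M"
  have F': "finite ?F" "real (card ?F) \<le> 1 / 2 * real n"
    using card_insert_real_le[OF F, of M] M(4) n_pos(1) by auto
  obtain y where y: "y \<in> A - ?F" "h3 y s t" "{y, s, t, u} \<in> E"
    using extend_triple[of s t u ?F A] l F' d(1) sub(1) by auto
  obtain z where z: "z \<in> B - ?F" "h3 z s' t'" "{z, s', t', u'} \<in> E"
    using extend_triple[of s' t' u' ?F B] r F' d(2) sub(2) by auto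
  have "tight_path E (y # M)" using M(1) y(3) unfolding M(2) piece_def by simp
  moreover have "tight_path E ([u', t', s'] @ [z])" using z(3) by (simp add: insert_commute)
  ultimately have "tight_path E ((y # Q') @ [u', t', s'] @ [z])"
    using tight_path_glue[of E "y # Q'" u' t' s' "[z]"] M(3) by simp
  hence "tight_path E (y # M @ [z])" using M(3) by simp
  moreover have "y \<noteq> z" using y(1) z(1) not_mem(1) by auto
  hence "distinct (y # M @ [z])" "set (y # M @ [z]) \<subseteq> V" using y(1) z(1) M(1) in_V by (auto simp: piece_def)
  moreover have "h3 t' s' z" using z(2) h3_commute(1)[of z s' t'] h3_commute(2)[of s' z t'] h3_commute(1)[of s' t' z] by simp
  ultimately show ?thesis using y z unfolding piece_def by blast
qed

text \<open>The pair a, b cannot be extended in the usual way, but a typical p, q forming an AABB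
  edge with it gives the cores a q p b and a p q b. A path p' q p q' of such pairs gives two cores
  with three consecutive AABB windows. The weights 36, 30, 42, 24 are 4, 6, 2, 0 modulo 8, all even
  residues.\<close>

lemma crossing_of_bad_pair:
  assumes m: "a \<in> A" "b \<in> B" and bad: "\<not> g2 a b"
    and F: "finite F" "real (card F) \<le> 1 / 10 ^ 20 * real n" "a \<notin> F" "b \<notin> F"
    and w: "w \<in> {36, 30, 42, 24}"
  shows "\<exists>P. crossing F w P"
proof -
  let ?F = "F \<union> {a, b}"
  have n25: "10 ^ 25 \<le> real n" by (rule order_trans[OF _ n_real]) simp
  let ?H = "{(p, q). p \<in> A - F \<and> q \<in> B - F \<and> {a, b, p, q} \<in> E \<and> typical a b p q}"
  have "\<exists>p q p' q'. (p, q) \<in> ?H \<and> (p', q) \<in> ?H \<and> (p, q') \<in> ?H \<and> p' \<noteq> p \<and> q' \<noteq> q"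
    using typical_edges[OF m bad F(1,2)] by (intro bipartite_path3[of A B]) auto
  then obtain p q p' q' where pq: "(p, q) \<in> ?H" "(p', q) \<in> ?H" "(p, q') \<in> ?H" "p' \<noteq> p" "q' \<noteq> q" by blast
  have mem: "p \<in> A" "p' \<in> A" "q \<in> B" "q' \<in> B" "p \<notin> F" "p' \<notin> F" "q \<notin> F" "q' \<notin> F" using pq by auto
  have e: "{a, b, p, q} \<in> E" "{a, b, p', q} \<in> E" "{a, b, p, q'} \<in> E" using pq by auto
  have ty: "typical a b p q" "typical a b p' q" "typical a b p q'" using pq by auto
  have d: "distinct [a, b, p, q]" "distinct [a, b, p', q]" "distinct [a, b, p, q']"
    using e edge_distinct by blast+
  have dd: "distinct [a, b, p, q, p', q']" using d pq(4,5) m mem not_mem by auto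
  have nA: "b \<notin> A" "q \<notin> A" "q' \<notin> A" using m mem not_mem by auto
  have F': "real (card F) \<le> 1 / 100 * real n" "real (card F) \<le> 1 / 5 * real n"
    using F(2) n_pos(1) by (simp only: pow_simps; linarith)+
  note G = ty[unfolded typical_def] and c = g3_commute g2_commute
  have core: "\<exists>P. crossing F (wl + (6 + wt M) + wr) P"
    if M: "piece M" "M = s # t # u # Q" "M = Q' @ [u', t', s']" "length M \<le> 10" "set M \<subseteq> A \<union> B" "set M \<inter> F = {}"
    and l: "g3 s t u" "g2 s t" "even (cA s + cA t + cA u)"
    and r: "g3 s' t' u'" "g2 s' t'" "odd (cA s' + cA t' + cA u')"
    and left: "s \<in> A \<and> t \<in> B \<and> wl = 7 \<or> s \<in> B \<and> t \<in> A \<and> wl = 0 \<or> s \<in> A \<and> t \<in> A \<and> wl = 6"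
    and right: "t' \<in> A \<and> s' \<in> B \<and> wr = 11 \<or> t' \<in> B \<and> s' \<in> A \<and> wr = 0 \<or> t' \<in> B \<and> s' \<in> B \<and> wr = 6"
    for M s t u Q Q' u' t' s' wl wr
  proof -
    obtain y z where yz: "y \<in> A - F" "z \<in> B - F" "piece (y # M @ [z])" "h3 y s t" "h3 t' s' z"
      using close_core[OF M(1-5) l r F(1) F'(1)] by blast
    have "\<exists>P. crossing F (wl + wt (y # M @ [z]) + wr) P"
    proof (rule crossing_of_core[OF yz(3) _ _ yz(4,5) _ F(1) F'(2)])
      show "y # M @ [z] = y # s # t # ((u # Q) @ [z])" "y # M @ [z] = (y # Q' @ [u']) @ [t', s', z]"
        by (simp add: M(2), simp add: M(3))
      show "set (y # M @ [z]) \<inter> F = {}" using yz M(6) by auto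
    qed (use yz left right M(4) in auto)
    moreover have "wt (y # M @ [z]) = 6 + wt M" using yz(1,2) not_mem(2)[of z] by simp
    ultimately show ?thesis by (simp only:)
  qed
  have VV: "a \<in> V" "b \<in> V" "p \<in> V" "q \<in> V" "p' \<in> V" "q' \<in> V" using m mem in_V by auto
  have mAB: "set M \<subseteq> A \<union> B" "set M \<inter> F = {}" if "set M \<subseteq> {a, b, p, q, p', q'}" for M
    using that m mem F(3,4) by auto
  have gs: "g3 a q p" "g2 a q" "g3 b p q" "g2 b p" "g3 a p q" "g2 a p" "g3 b q p" "g2 b q"
    "g3 p' q a" "g2 p' q" "g3 q' p b" "g2 q' p" "g3 q' p a" "g3 p' q b"
    using G c(2)[of a q p] c(2)[of b q p] c(2)[of p' q a] c(1)[of p' a q] c(3)[of q' p b] c(3)[of q' p a]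
      c(2)[of p' q b] c(1)[of p' b q] c(4)[of q' p] by simp_all
  have ds: "distinct [a, q, p, b]" "distinct [a, p, q, b]" "distinct [p', q, a, b, p, q']"
    "distinct [q', p, a, b, q, p']" using dd by auto
  consider "w = 36" | "w = 30" | "w = 42" | "w = 24" using w by auto
  thus ?thesis
  proof cases
    case 1
    let ?M = "[a, q, p, b]"
    have P: "piece ?M" using e ds VV by (simp add: piece_def insert_commute)
    have "wt ?M = 12" using m mem nA by simp
    moreover have "\<exists>P. crossing F (7 + (6 + wt ?M) + 11) P"
      by (rule core[OF P, of a q p "[b]" "[a]" q p b])
        (use gs m mem nA mAB[of ?M] in simp_all)
    ultimately show ?thesis using 1 by simp
  next
    case 2
    let ?M = "[a, p, q, b]"
    have P: "piece ?M" using e ds VV by (simp add: piece_def insert_commute)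
    have "wt ?M = 12" using m mem nA by simp
    moreover have "\<exists>P. crossing F (6 + (6 + wt ?M) + 6) P"
      by (rule core[OF P, of a p q "[b]" "[a]" p q b])
        (use gs m mem nA mAB[of ?M] in simp_all)
    ultimately show ?thesis using 2 by simp
  next
    case 3
    let ?M = "[p', q, a, b, p, q']"
    have P: "piece ?M" using e ds VV by (simp add: piece_def insert_commute)
    have "wt ?M = 18" using m mem nA by simp
    moreover have "\<exists>P. crossing F (7 + (6 + wt ?M) + 11) P"
      by (rule core[OF P, of p' q a "[b, p, q']" "[p', q, a]" b p q'])
        (use gs m mem nA mAB[of ?M] in simp_all)
    ultimately show ?thesis using 3 by simp
  next
    case 4
    let ?M = "[q', p, a, b, q, p']"
    have P: "piece ?M" using e ds VV by (simp add: piece_def insert_commute)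
    have "wt ?M = 18" using m mem nA by simp
    moreover have "\<exists>P. crossing F (0 + (6 + wt ?M) + 0) P"
      by (rule core[OF P, of q' p a "[b, q, p']" "[q', p, a]" b q p'])
        (use gs m mem nA mAB[of ?M] in simp_all)
    ultimately show ?thesis using 4 by simp
  qed
qed

section \<open>Finding an AABB edge fit for a crossing when all pairs are typical\<close>

definition richA :: "'a \<Rightarrow> 'a \<Rightarrow> 'a \<Rightarrow> bool" where
  "richA x y z \<longleftrightarrow> 1 / 10 * real n \<le> real (card {u \<in> A. {x, y, z, u} \<in> E})"

definition richB :: "'a \<Rightarrow> 'a \<Rightarrow> 'a \<Rightarrow> bool" where
  "richB x y z \<longleftrightarrow> 1 / 10 * real n \<le> real (card {u \<in> B. {x, y, z, u} \<in> E})"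

lemma rich_commute: "richA x y z = richA y x z" "richA x y z = richA x z y"
  "richB x y z = richB y x z" "richB x y z = richB x z y"
  unfolding richA_def richB_def by (simp_all add: insert_commute)

lemma swap_rich: "near_extremal.richA E n B = richB" "near_extremal.richB E n A = richA"
proof -
  interpret sw: near_extremal V E n B A Z by (rule swapped)
  show "near_extremal.richA E n B = richB" "near_extremal.richB E n A = richA"
    by (intro ext, simp add: richA_def richB_def sw.richA_def sw.richB_def)+
qed

lemma richA_of_g3:
  assumes "x \<in> A" "y \<in> A" "z \<in> B" "x \<noteq> y" "g3 x y z"
  shows "richA x y z"
proof -
  have nz: "z \<notin> A" using assms(3) not_mem by blast
  have "A \<subseteq> {u \<in> A. {x, y, z, u} \<in> E} \<union> ({u \<in> A \<union> B. \<not> \<not> W {x, y, z, u}} \<union> {x, y})"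
  proof
    fix u assume u: "u \<in> A"
    show "u \<in> {u \<in> A. {x, y, z, u} \<in> E} \<union> ({u \<in> A \<union> B. \<not> \<not> W {x, y, z, u}} \<union> {x, y})"
    proof (cases "u \<in> {x, y} \<or> W {x, y, z, u}")
      case True
      thus ?thesis using u by blast
    next
      case False
      hence "{x, y, z, u} \<in> E" using assms u nz by (intro odd_edge) auto
      thus ?thesis using u by blast
    qed
  qed
  hence "card A \<le> card ({u \<in> A. {x, y, z, u} \<in> E} \<union> ({u \<in> A \<union> B. \<not> \<not> W {x, y, z, u}} \<union> {x, y}))"
    by (intro card_mono) auto
  also have "\<dots> \<le> card {u \<in> A. {x, y, z, u} \<in> E} + (card {u \<in> A \<union> B. \<not> \<not> W {x, y, z, u}} + card {x, y})"
    by (intro order_trans[OF card_Un_le] add_left_mono order_refl)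
  finally have "real (card A) \<le> real (card {u \<in> A. {x, y, z, u} \<in> E}) + (1 / 10 ^ 7 * real n + 2)"
    using assms(4,5) unfolding g3_def few_def by simp
  moreover have "10 ^ 7 \<le> real n" by (rule order_trans[OF _ n_real]) simp
  ultimately show ?thesis using card_bounds(3) unfolding richA_def by simp
qed

lemma richB_of_g3:
  assumes "x \<in> B" "y \<in> B" "z \<in> A" "x \<noteq> y" "g3 x y z"
  shows "richB x y z"
proof -
  interpret sw: near_extremal V E n B A Z by (rule swapped)
  show ?thesis using sw.richA_of_g3[OF assms(1-4)] assms(5) by (simp add: swap swap_rich)
qed

lemma many_B_of_poor:
  assumes "a \<in> A" "x \<in> A" "b \<in> B" "a \<noteq> x" "\<not> richA a x b"
  shows "89 / 100 * real n \<le> real (card {u \<in> B. {a, x, b, u} \<in> E})"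
proof -
  have "n \<le> card {u \<in> A. {a, x, b, u} \<in> E} + card {u \<in> B. {a, x, b, u} \<in> E} + card {u \<in> Z. {a, x, b, u} \<in> E} + 1"
    using assms(1-4) in_V not_mem by (intro codeg_split) blast+
  moreover have "card {u \<in> Z. {a, x, b, u} \<in> E} \<le> card Z" by (intro card_mono) auto
  moreover have "real (card Z) \<le> 1 / 1000 * real n"
    using cardZ_le n_pos(1) by (simp only: pow_simps; linarith)
  moreover have "10 ^ 7 \<le> real n" by (rule order_trans[OF _ n_real]) simp
  ultimately show ?thesis using assms(5) unfolding richA_def by simp
qed

text \<open>These are the hypotheses of \<open>crossing_of_edge\<close>. Exchanging the two classes
  and reading the core backwards leaves the condition unchanged.\<close>

definition usable :: "'a set \<Rightarrow> bool" where
  "usable F \<longleftrightarrow> (\<exists>a x b b'. a \<in> A - F \<and> x \<in> A - F \<and> b \<in> B - F \<and> b' \<in> B - F \<and> {a, b, x, b'} \<in> E \<and>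
     g2 a b \<and> g2 x b' \<and> richA a b x \<and> richB x b' b)"

lemma crossing_of_usable:
  assumes "usable F" "finite F" "real (card F) \<le> 1 / 1000 * real n"
  shows "\<exists>P. crossing F 36 P"
proof -
  obtain a x b b' where u: "a \<in> A - F" "x \<in> A - F" "b \<in> B - F" "b' \<in> B - F" "{a, b, x, b'} \<in> E"
     "g2 a b" "g2 x b'" "richA a b x" "richB x b' b" using assms(1) unfolding usable_def by blast
  show ?thesis using u(1-4) u(8,9) unfolding richA_def richB_def
    by (intro crossing_of_edge[OF _ _ _ _ u(5-7) _ _ assms(2,3)]) auto
qed

lemma swap_usable: "near_extremal.usable E n B A F = usable F"
proof -
  interpret sw: near_extremal V E n B A Z by (rule swapped)
  have "sw.usable F \<longleftrightarrow> (\<exists>b y a a'. b \<in> B - F \<and> y \<in> B - F \<and> a \<in> A - F \<and> a' \<in> A - F \<and> {b, a, y, a'} \<in> E \<and>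
     g2 b a \<and> g2 y a' \<and> richB b a y \<and> richA y a' a)"
    unfolding sw.usable_def by (simp add: swap swap_rich)
  also have "\<dots> \<longleftrightarrow> (\<exists>a x b b'. a \<in> A - F \<and> x \<in> A - F \<and> b \<in> B - F \<and> b' \<in> B - F \<and> {a, b, x, b'} \<in> E \<and>
     g2 a b \<and> g2 x b' \<and> richA a b x \<and> richB x b' b)" (is "?l \<longleftrightarrow> ?r")
  proof
    assume ?l
    then obtain b y a a' where h: "b \<in> B - F" "y \<in> B - F" "a \<in> A - F" "a' \<in> A - F" "{b, a, y, a'} \<in> E"
     "g2 b a" "g2 y a'" "richB b a y" "richA y a' a" by blast
    have "{a', y, a, b} \<in> E" "g2 a' y" "g2 a b" "richA a' y a" "richB a b y"
      using h(5-9) g2_commute rich_commute(1)[of y a' a] rich_commute(3)[of b a y]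
      by (auto simp: insert_commute)
    thus ?r using h(1-4) by blast
  next
    assume ?r
    then obtain a x b b' where h: "a \<in> A - F" "x \<in> A - F" "b \<in> B - F" "b' \<in> B - F" "{a, b, x, b'} \<in> E"
     "g2 a b" "g2 x b'" "richA a b x" "richB x b' b" by blast
    have "{b', x, b, a} \<in> E" "g2 b' x" "g2 b a" "richB b' x b" "richA b a x"
      using h(5-9) g2_commute rich_commute(1)[of a b x] rich_commute(3)[of x b' b]
      by (auto simp: insert_commute)
    thus ?l using h(1-4) by blast
  qed
  finally show ?thesis unfolding usable_def .
qed

text \<open>Such a pair lacks most of its AAAB sets: it has 0.88 n third vertices with fewer than n
  / 10 extensions in \<open>A\<close> each. If no edge is usable, heavy pairs will have to carry all
  AABB edges.\<close>

definition heavy :: "'a set \<Rightarrow> 'a \<Rightarrow> 'a \<Rightarrow> bool" where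
  "heavy F a x \<longleftrightarrow> a \<in> A - F \<and> x \<in> A - F \<and> a \<noteq> x \<and> 88 / 100 * real n \<le> real (card {b \<in> B - F. \<not> richA a x b})"

lemma heavy_sym: "heavy F a x \<longleftrightarrow> heavy F x a"
  unfolding heavy_def using rich_commute(1)[of a x] by auto

text \<open>By the codegree the poor triple a, x, b has 0.89 n extensions u in \<open>B\<close>. For
  almost all of them \<open>g3 a b u\<close> makes the B side rich, and the edge would be usable
  unless a, x, u is poor as well. So poverty of one triple spreads over the whole pair.\<close>

lemma heavy_of_poor:
  assumes no: "\<not> usable F" and good: "\<And>a b. a \<in> A - F \<Longrightarrow> b \<in> B - F \<Longrightarrow> g2 a b"
    and F: "finite F" "real (card F) \<le> 1 / 1000 * real n"
    and m: "a \<in> A - F" "x \<in> A - F" "b \<in> B - F" "a \<noteq> x" and poor: "\<not> richA a x b"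
  shows "heavy F a x"
proof -
  let ?N = "{u \<in> B. {a, x, b, u} \<in> E}" and ?T = "{u \<in> A \<union> B. \<not> g3 a b u}"
  have "?N \<subseteq> {u \<in> B - F. \<not> richA a x u} \<union> (?T \<union> F)"
  proof
    fix u assume u: "u \<in> ?N"
    show "u \<in> {u \<in> B - F. \<not> richA a x u} \<union> (?T \<union> F)"
    proof (cases "u \<in> F \<or> \<not> g3 a b u")
      case False
      hence uB: "u \<in> B - F" "g3 b u a" using u g3_commute(1)[of a b u] g3_commute(2)[of b a u] by auto
      have "distinct [a, x, b, u]" using u edge_distinct by blast
      hence "richB b u a" using uB m by (intro richB_of_g3) auto
      hence "richB a b u" using rich_commute(3,4) by metis
      moreover have "{x, u, a, b} \<in> E" using u by (auto simp: insert_commute)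
      ultimately have "\<not> richA x u a" using no m uB(1) good unfolding usable_def by blast
      hence "\<not> richA a x u" using rich_commute(1,2) by metis
      thus ?thesis using uB(1) by blast
    qed (use u in blast)
  qed
  hence "card ?N \<le> card ({u \<in> B - F. \<not> richA a x u} \<union> (?T \<union> F))" using F(1) by (intro card_mono) auto
  also have "\<dots> \<le> card {u \<in> B - F. \<not> richA a x u} + (card ?T + card F)"
    by (intro order_trans[OF card_Un_le] add_left_mono order_refl)
  finally have "real (card ?N) \<le> real (card {u \<in> B - F. \<not> richA a x u}) + (1 / 10 ^ 7 * real n + 1 / 1000 * real n)"
    using few_g3[OF good[OF m(1,3)]] F(2) unfolding few_def by simp
  moreover have "89 / 100 * real n \<le> real (card ?N)" using m poor by (intro many_B_of_poor) auto
  ultimately show ?thesis using m(1,2,4) unfolding heavy_def by simp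
qed

text \<open>If the pair in \<open>B\<close> is not heavy, its triples are rich by
  \<open>heavy_of_poor\<close>; an unusable edge must then be poor on the A side, which makes its
  pair in \<open>A\<close> heavy.\<close>

lemma edge_heavy:
  assumes no: "\<not> usable F" and good: "\<And>a b. a \<in> A - F \<Longrightarrow> b \<in> B - F \<Longrightarrow> g2 a b"
    and F: "finite F" "real (card F) \<le> 1 / 1000 * real n"
    and m: "a \<in> A - F" "x \<in> A - F" "b \<in> B - F" "b' \<in> B - F" "{a, x, b, b'} \<in> E"
  shows "heavy F a x \<or> near_extremal.heavy E n B A F b b'"
proof (rule disjCI)
  interpret sw: near_extremal V E n B A Z by (rule swapped)
  assume nh: "\<not> sw.heavy F b b'"
  have d: "a \<noteq> x" "b \<noteq> b'" using edge_distinct[OF m(5)] by auto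
  have "sw.heavy F b b'" if "\<not> richB b b' a"
    using that no good g2_commute F m d by (intro sw.heavy_of_poor) (auto simp: swap swap_usable swap_rich)
  hence "richB b b' a" using nh by blast
  hence "richB a b b'" using rich_commute(3,4) by metis
  moreover have "{x, b', a, b} \<in> E" using m(5) by (auto simp: insert_commute)
  ultimately have "\<not> richA x b' a" using no m good unfolding usable_def by blast
  hence "\<not> richA a x b'" using rich_commute(1,2) by metis
  thus "heavy F a x" using heavy_of_poor[OF no good F m(1,2,4) d(1)] by blast
qed

lemma poor_missing:
  assumes F: "finite F" "real (card F) \<le> 1 / 1000 * real n" and poor: "\<not> richA a x b"
  shows "89 / 100 * real n \<le> real (card {y \<in> A - F. y \<noteq> a \<and> y \<noteq> x \<and> {a, x, b, y} \<notin> E})"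
proof -
  let ?M = "{y \<in> A - F. y \<noteq> a \<and> y \<noteq> x \<and> {a, x, b, y} \<notin> E}" and ?N = "{u \<in> A. {a, x, b, u} \<in> E}"
  have "A \<subseteq> ?M \<union> (?N \<union> (F \<union> {a, x}))" by blast
  hence "card A \<le> card (?M \<union> (?N \<union> (F \<union> {a, x})))" using F(1) by (intro card_mono) auto
  also have "\<dots> \<le> card ?M + (card ?N + (card F + card {a, x}))"
    by (intro order_trans[OF card_Un_le] add_left_mono order_refl)
  also have "card {a, x} \<le> 2" by (simp add: card_insert_if)
  finally have "real (card A) \<le> real (card ?M) + (real (card ?N) + (real (card F) + 2))" by linarith
  moreover have "real (card ?N) \<le> 1 / 10 * real n" using poor unfolding richA_def by simp
  moreover have "10 ^ 7 \<le> real n" by (rule order_trans[OF _ n_real]) simp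
  ultimately show ?thesis using card_bounds(3) F(2) by simp
qed

text \<open>A heavy pair at \<open>a\<close> accounts for 3/4 n^2 missing AAAB sets through
  \<open>a\<close>, while \<open>W_triples\<close> allows only 10^-36 n^3 deviating triples
  there.\<close>

lemma heavy_degree:
  assumes F: "finite F" "real (card F) \<le> 1 / 1000 * real n" and a: "a \<in> A - F"
  shows "real (card {x. heavy F a x}) \<le> 1 / 1000 * real n"
proof -
  let ?T = "{(p, q, u). p \<in> A \<union> B \<and> q \<in> A \<union> B \<and> u \<in> A \<union> B \<and> W {a, p, q, u}}"
  have "(3 / 4 * real n ^ 2) * real (card {x. heavy F a x}) \<le> real (card ?T)"
  proof (rule card_le_of_fibres)
    show "finite ?T" by (rule finite_subset[of _ "(A \<union> B) \<times> (A \<union> B) \<times> (A \<union> B)"]) auto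
    show "{x. heavy F a x} \<subseteq> A" unfolding heavy_def by auto
    fix x assume "x \<in> {x. heavy F a x}"
    hence h: "heavy F a x" by simp
    hence x: "x \<in> A - F" "a \<noteq> x" "88 / 100 * real n \<le> real (card {b \<in> B - F. \<not> richA a x b})"
      by (auto simp: heavy_def)
    let ?P = "{b \<in> B - F. \<not> richA a x b}" and ?Y = "\<lambda>b. {y \<in> A - F. y \<noteq> a \<and> y \<noteq> x \<and> {a, x, b, y} \<notin> E}"
    have "3 / 4 * real n ^ 2 \<le> 89 / 100 * real n * (88 / 100 * real n)"
      using zero_le_power2[of "real n"] by (simp add: power2_eq_square)
    also have "\<dots> \<le> 89 / 100 * real n * real (card ?P)" using x(3) by (intro mult_left_mono) auto
    also have "\<dots> \<le> real (card (Sigma ?P ?Y))" using poor_missing[OF F] by (intro card_Sigma_ge) auto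
    also have "card (Sigma ?P ?Y) \<le> card {y. (x, y) \<in> ?T}"
    proof (rule card_mono)
      show "finite {y. (x, y) \<in> ?T}" by (rule finite_subset[of _ "(A \<union> B) \<times> (A \<union> B)"]) auto
      show "Sigma ?P ?Y \<subseteq> {y. (x, y) \<in> ?T}"
      proof
        fix s assume "s \<in> Sigma ?P ?Y"
        then obtain b y where s: "s = (b, y)" "b \<in> B" "y \<in> A" "y \<noteq> a" "y \<noteq> x" "{a, x, b, y} \<notin> E" by auto
        have "W {a, x, b, y}" unfolding W4 using s a x(1,2) not_mem(2)[of b] by auto
        thus "s \<in> {y. (x, y) \<in> ?T}" using s x(1) by simp
      qed
    qed
    finally show "3 / 4 * real n ^ 2 \<le> real (card {y. (x, y) \<in> ?T})" by simp
  qed auto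
  also have "\<dots> \<le> 1 / 10 ^ 36 * real n ^ 3" using a by (intro W_triples) simp
  finally have "real n ^ 2 * (3 / 4 * real (card {x. heavy F a x})) \<le> real n ^ 2 * (1 / 10 ^ 36 * real n)"
    by (simp add: power2_eq_square power3_eq_cube mult_ac)
  moreover have "0 < real n ^ 2" using n_pos(1) by simp
  ultimately have "3 / 4 * real (card {x. heavy F a x}) \<le> 1 / 10 ^ 36 * real n" by (rule mult_left_le_imp_le)
  thus ?thesis using n_pos(1) by (simp only: pow_simps; linarith)
qed

text \<open>By \<open>heavy_degree\<close> the missing AAAB sets over a heavy pair can be chosen
  without a second heavy pair. Such a set then determines its heavy pair, which may occupy any of
  three pairs of places in the tuple, so each heavy pair is paid three times: 3 * 3/4 = 9/4. That
  this exceeds 2 decides the comparison in \<open>usable_exists\<close>.\<close>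

lemma heavy_missing:
  assumes F: "finite F" "real (card F) \<le> 1 / 1000 * real n"
  defines "T \<equiv> {((a, x, b), y). a \<in> A - F \<and> x \<in> A - F \<and> a \<noteq> x \<and> b \<in> B - F \<and> y \<in> A - F \<and> y \<noteq> a \<and> y \<noteq> x \<and> {a, x, b, y} \<notin> E}"
  shows "9 / 4 * real n ^ 2 * real (card {(a, x). heavy F a x}) \<le> real (card T)"
proof -
  let ?H = "{(a, x). heavy F a x}"
  let ?S = "\<lambda>(a, x). Sigma {b \<in> B - F. \<not> richA a x b} (\<lambda>b. {y \<in> A - F. y \<noteq> a \<and> y \<noteq> x \<and> {a, x, b, y} \<notin> E \<and>
    \<not> heavy F a y \<and> \<not> heavy F x y})"
  let ?Q = "Sigma ?H ?S"
  have finT: "finite T" unfolding T_def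
    by (rule finite_subset[of _ "(A \<times> A \<times> B) \<times> A"]) auto
  have finH: "finite ?H" by (rule finite_subset[of _ "A \<times> A"]) (auto simp: heavy_def)
  have Q: "3 / 4 * real n ^ 2 * real (card ?H) \<le> real (card ?Q)"
  proof (rule card_Sigma_ge[OF finH])
    fix h assume "h \<in> ?H"
    then obtain a x where h: "h = (a, x)" "heavy F a x" by auto
    have ax: "a \<in> A - F" "x \<in> A - F" "88 / 100 * real n \<le> real (card {b \<in> B - F. \<not> richA a x b})"
      using h(2) by (auto simp: heavy_def)
    show "finite (?S h)" by (auto simp: h(1))
    have "87 / 100 * real n \<le> real (card {y \<in> A - F. y \<noteq> a \<and> y \<noteq> x \<and> {a, x, b, y} \<notin> E \<and> \<not> heavy F a y \<and> \<not> heavy F x y})"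
      (is "_ \<le> real (card ?Y)") if "\<not> richA a x b" for b
    proof -
      have fin: "finite {y. heavy F u y}" for u by (rule finite_subset[of _ A]) (auto simp: heavy_def)
      have "{y \<in> A - F. y \<noteq> a \<and> y \<noteq> x \<and> {a, x, b, y} \<notin> E} \<subseteq> ?Y \<union> ({y. heavy F a y} \<union> {y. heavy F x y})" by blast
      hence "card {y \<in> A - F. y \<noteq> a \<and> y \<noteq> x \<and> {a, x, b, y} \<notin> E} \<le> card (?Y \<union> ({y. heavy F a y} \<union> {y. heavy F x y}))"
        using fin by (intro card_mono) auto
      also have "\<dots> \<le> card ?Y + (card {y. heavy F a y} + card {y. heavy F x y})"
        by (intro order_trans[OF card_Un_le] add_left_mono order_refl)
      finally show ?thesis using poor_missing[OF F that] heavy_degree[OF F ax(1)] heavy_degree[OF F ax(2)] by linarith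
    qed
    hence "87 / 100 * real n * real (card {b \<in> B - F. \<not> richA a x b}) \<le> real (card (?S h))"
      unfolding h(1) prod.case by (intro card_Sigma_ge) auto
    moreover have "87 / 100 * real n * (88 / 100 * real n) \<le> 87 / 100 * real n * real (card {b \<in> B - F. \<not> richA a x b})"
      using ax(3) by (intro mult_left_mono) auto
    moreover have "3 / 4 * real n ^ 2 \<le> 87 / 100 * real n * (88 / 100 * real n)"
      using zero_le_power2[of "real n"] by (simp add: power2_eq_square)
    ultimately show "3 / 4 * real n ^ 2 \<le> real (card (?S h))" by linarith
  qed
  have el: "heavy F a x \<and> b \<in> B - F \<and> y \<in> A - F \<and> y \<noteq> a \<and> y \<noteq> x \<and> {a, x, b, y} \<notin> E \<and>
      \<not> heavy F a y \<and> \<not> heavy F x y \<and> a \<in> A - F \<and> x \<in> A - F \<and> a \<noteq> x"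
    if "((a, x), (b, y)) \<in> ?Q" for a x b y
    using that by (auto simp: heavy_def)
  define T1 T2 T3 where "T1 = {((u, v, b), w). ((u, v, b), w) \<in> T \<and> heavy F u v \<and> \<not> heavy F u w \<and> \<not> heavy F v w}"
    and "T2 = {((u, v, b), w). ((u, v, b), w) \<in> T \<and> heavy F u w \<and> \<not> heavy F u v \<and> \<not> heavy F v w}"
    and "T3 = {((u, v, b), w). ((u, v, b), w) \<in> T \<and> heavy F v w \<and> \<not> heavy F u v \<and> \<not> heavy F u w}"
  have subs: "T1 \<subseteq> T" "T2 \<subseteq> T" "T3 \<subseteq> T" by (auto simp: T1_def T2_def T3_def)
  hence fins: "finite T1" "finite T2" "finite T3" using finT finite_subset by blast+
  have "card ?Q \<le> card T1"
  proof (rule card_inj_on_le[of "\<lambda>((a, x), (b, y)). ((a, x, b), y)"])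
    show "(\<lambda>((a, x), (b, y)). ((a, x, b), y)) ` ?Q \<subseteq> T1"
    proof (rule image_subsetI)
      fix s assume sQ: "s \<in> ?Q"
      obtain a x b y where s: "s = ((a, x), (b, y))" by (metis surj_pair)
      from el[OF sQ[unfolded s]] show "(\<lambda>((a, x), (b, y)). ((a, x, b), y)) s \<in> T1" unfolding s prod.case by (simp add: T1_def T_def)
    qed
  qed (auto simp: inj_on_def fins)
  moreover have "card ?Q \<le> card T2"
  proof (rule card_inj_on_le[of "\<lambda>((a, x), (b, y)). ((a, y, b), x)"])
    show "(\<lambda>((a, x), (b, y)). ((a, y, b), x)) ` ?Q \<subseteq> T2"
    proof (rule image_subsetI)
      fix s assume sQ: "s \<in> ?Q"
      obtain a x b y where s: "s = ((a, x), (b, y))" by (metis surj_pair)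
      from el[OF sQ[unfolded s]] show "(\<lambda>((a, x), (b, y)). ((a, y, b), x)) s \<in> T2" unfolding s prod.case
        using heavy_sym[of F y x] by (auto simp: T2_def T_def insert_commute)
    qed
  qed (auto simp: inj_on_def fins)
  moreover have "card ?Q \<le> card T3"
  proof (rule card_inj_on_le[of "\<lambda>((a, x), (b, y)). ((y, a, b), x)"])
    show "(\<lambda>((a, x), (b, y)). ((y, a, b), x)) ` ?Q \<subseteq> T3"
    proof (rule image_subsetI)
      fix s assume sQ: "s \<in> ?Q"
      obtain a x b y where s: "s = ((a, x), (b, y))" by (metis surj_pair)
      from el[OF sQ[unfolded s]] show "(\<lambda>((a, x), (b, y)). ((y, a, b), x)) s \<in> T3" unfolding s prod.case
        using heavy_sym[of F y x] heavy_sym[of F y a] by (auto simp: T3_def T_def insert_commute)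
    qed
  qed (auto simp: inj_on_def fins)
  moreover have "card T1 + card T2 + card T3 \<le> card T"
  proof -
    have "T1 \<inter> T2 = {}" "(T1 \<union> T2) \<inter> T3 = {}" by (auto simp: T1_def T2_def T3_def)
    hence "card (T1 \<union> T2 \<union> T3) = card T1 + card T2 + card T3" using fins by (simp add: card_Un_disjoint)
    moreover have "card (T1 \<union> T2 \<union> T3) \<le> card T" using subs finT by (intro card_mono) auto
    ultimately show ?thesis by simp
  qed
  ultimately have "3 * card ?Q \<le> card T" by linarith
  hence "3 * real (card ?Q) \<le> real (card T)" by linarith
  thus ?thesis using Q by linarith
qed

text \<open>Without usable edges every $AABB$ edge contains a heavy pair, while the codegree condition forces many such edges
and heavy pairs miss most of them. Added to the mirror image of the inequality below, this becomes contradictory.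
The left-hand side can be negative; only the sum of both sides is controlled, through $|A| + |B| + |Z| = 2n$.\<close>

lemma half_count:
  assumes F: "finite F" "card F \<le> 1000" "Z \<subseteq> F"
  defines "X \<equiv> {(a, x, b). a \<in> A - F \<and> x \<in> A - F \<and> a \<noteq> x \<and> b \<in> B - F}"
    and "N \<equiv> {(a, x, b, b'). a \<in> A - F \<and> x \<in> A - F \<and> b \<in> B - F \<and> b' \<in> B - F \<and> {a, x, b, b'} \<in> E}"
  shows "real (card X) * (real n + 1 - real (card A) - real (card Z)) \<le>
    real (card N) - 9 / 4 * real n ^ 2 * real (card {(a, x). heavy F a x}) + 1 / 10 ^ 30 * real n ^ 3"
proof -
  have Fn: "real (card F) \<le> 1 / 1000 * real n"
  proof -
    have "10 ^ 7 \<le> real n" by (rule order_trans[OF _ n_real]) simp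
    thus ?thesis using F(2) by simp
  qed
  have finX: "finite X" unfolding X_def by (rule finite_subset[of _ "A \<times> A \<times> B"]) auto
  let ?Y = "\<lambda>(a, x, b). {y \<in> A - F. y \<noteq> a \<and> y \<noteq> x \<and> {a, x, b, y} \<notin> E}"
  let ?D = "\<lambda>(a, x, b). {b' \<in> B - F. {a, x, b, b'} \<in> E}"
  let ?F = "\<lambda>(a, x, b). {f \<in> F. {a, x, b, f} \<in> E}"
  \<comment> \<open>The codegree yields n - 1 extensions, and a and x lie in \<open>A - F\<close>
    without extending the triple. These two vertices turn the -1 of the codegree into the +1
    here.\<close>
  have point: "real (card (?Y t)) + (real n + 1) \<le> real (card (A - F)) + real (card (?D t)) + real (card (?F t))"
    if tX: "t \<in> X" for t
  proof -
    obtain a x b where t: "t = (a, x, b)" "a \<in> A - F" "x \<in> A - F" "a \<noteq> x" "b \<in> B - F" using tX by (auto simp: X_def)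
    let ?N = "{y \<in> A - F. {a, x, b, y} \<in> E}"
    have "a \<noteq> b" "x \<noteq> b" using t not_mem(1) by auto
    hence T: "{a, x, b} \<subseteq> V" "card {a, x, b} = 3" using t in_V by auto
    have ne: "y \<noteq> a \<and> y \<noteq> x" if "{a, x, b, y} \<in> E" for y using edge_distinct[OF that] by auto
    have "{u \<in> V. insert u {a, x, b} \<in> E} \<subseteq> ?N \<union> (?D t \<union> ?F t)"
      using V_eq F(3) unfolding t(1) by (auto simp: insert_commute)
    hence "card {u \<in> V. insert u {a, x, b} \<in> E} \<le> card (?N \<union> (?D t \<union> ?F t))"
      using F(1) by (intro card_mono) (auto simp: t(1))
    also have "\<dots> \<le> card ?N + (card (?D t) + card (?F t))"
      by (intro order_trans[OF card_Un_le] add_left_mono order_refl)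
    finally have 1: "n \<le> card ?N + (card (?D t) + card (?F t)) + 1" using codeg[OF T] by linarith
    have sub: "?N \<union> ?Y t \<union> {a, x} \<subseteq> A - F" using t by auto
    have "?N \<inter> ?Y t = {}" "(?N \<union> ?Y t) \<inter> {a, x} = {}" using ne by (auto simp: t(1))
    hence c: "card (?N \<union> ?Y t \<union> {a, x}) = card ?N + card (?Y t) + 2"
      using t(4) by (simp add: card_Un_disjoint t(1))
    have "card (?N \<union> ?Y t \<union> {a, x}) \<le> card (A - F)" by (rule card_mono[OF _ sub]) simp
    hence "card ?N + card (?Y t) + 2 \<le> card (A - F)" unfolding c .
    thus ?thesis using 1 by linarith
  qed
  have "real (card (Sigma X ?Y)) + real (card X) * (real n + 1) = (\<Sum>t\<in>X. real (card (?Y t)) + (real n + 1))"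
    using finX by (simp add: sum.distrib split_beta)
  also have "\<dots> \<le> (\<Sum>t\<in>X. real (card (A - F)) + real (card (?D t)) + real (card (?F t)))"
    using point by (intro sum_mono)
  also have "\<dots> = real (card X) * real (card (A - F)) + real (card (Sigma X ?D)) + real (card (Sigma X ?F))"
    using finX F(1) by (simp add: sum.distrib split_beta)
  finally have main: "real (card (Sigma X ?Y)) + real (card X) * (real n + 1) \<le>
     real (card X) * real (card (A - F)) + real (card (Sigma X ?D)) + real (card (Sigma X ?F))" .
  have Y: "9 / 4 * real n ^ 2 * real (card {(a, x). heavy F a x}) \<le> real (card (Sigma X ?Y))"
  proof -
    have "Sigma X ?Y = {((a, x, b), y). a \<in> A - F \<and> x \<in> A - F \<and> a \<noteq> x \<and> b \<in> B - F \<and> y \<in> A - F \<and> y \<noteq> a \<and>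
       y \<noteq> x \<and> {a, x, b, y} \<notin> E}" by (auto simp: X_def)
    thus ?thesis using heavy_missing[OF F(1) Fn] by simp
  qed
  have D: "card (Sigma X ?D) \<le> card N"
  proof -
    have finN: "finite N" unfolding N_def by (rule finite_subset[of _ "A \<times> A \<times> B \<times> B"]) auto
    show ?thesis
    proof (rule card_inj_on_le[of "\<lambda>((a, x, b), b'). (a, x, b, b')"])
      show "(\<lambda>((a, x, b), b'). (a, x, b, b')) ` Sigma X ?D \<subseteq> N" by (auto simp: X_def N_def)
    qed (auto simp: inj_on_def intro: finN)
  qed
  \<comment> \<open>Vertices of \<open>F\<close> in \<open>A\<close> or \<open>Z\<close> may extend
    every triple, those in \<open>B\<close> only few by \<open>B_sparse\<close>. The share of
    \<open>F \<inter> A\<close> is recovered when \<open>card (A - F)\<close> is replaced by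
    \<open>card A\<close>.\<close>
  have FF: "real (card (Sigma X ?F)) \<le> real (card X) * (real (card (F \<inter> A)) + real (card Z)) + 1000 * (1 / 10 ^ 37 * real n ^ 3)"
  proof -
    have deg: "real (card {t \<in> X. f \<in> ?F t}) \<le> (if f \<in> A \<or> f \<in> Z then real (card X) else 1 / 10 ^ 37 * real n ^ 3)" for f
    proof -
      consider "f \<in> A \<or> f \<in> Z" | "f \<in> B" | "f \<notin> V" using V_eq by blast
      thus ?thesis
      proof cases
        case 1
        have "card {t \<in> X. f \<in> ?F t} \<le> card X" using finX by (intro card_mono) auto
        thus ?thesis using 1 by simp
      next
        case 2
        let ?R = "{(b, a, a'). b \<in> B \<and> a \<in> A \<and> a' \<in> A \<and> {f, b, a, a'} \<in> E}"
        have finR: "finite ?R" by (rule finite_subset[of _ "B \<times> A \<times> A"]) auto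
        have "card {t \<in> X. f \<in> ?F t} \<le> card ?R"
        proof (rule card_inj_on_le[of "\<lambda>(a, x, b). (b, a, x)"])
          have "{a, x, b, f} = {f, b, a, x}" for a x b by auto
          thus "(\<lambda>(a, x, b). (b, a, x)) ` {t \<in> X. f \<in> ?F t} \<subseteq> ?R" by (auto simp: X_def)
          show "finite ?R" by (rule finR)
        qed (auto simp: inj_on_def)
        thus ?thesis using B_sparse[OF 2] 2 not_mem by auto
      next
        case 3
        hence "{t \<in> X. f \<in> ?F t} = {}" using edge by fastforce
        thus ?thesis using zero_le_power[of "real n" 3] by (simp only: card.empty) simp
      qed
    qed
    have "card (Sigma X ?F) \<le> card (Sigma F (\<lambda>f. {t \<in> X. f \<in> ?F t}))"
      by (rule card_inj_on_le[of prod.swap]) (use finX F(1) in \<open>auto simp: inj_on_def\<close>)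
    also have "\<dots> = (\<Sum>f\<in>F. card {t \<in> X. f \<in> ?F t})" using finX F(1) by (intro card_SigmaI) auto
    finally have "real (card (Sigma X ?F)) \<le> (\<Sum>f\<in>F. real (card {t \<in> X. f \<in> ?F t}))"
      by (simp only: of_nat_sum[symmetric] of_nat_le_iff)
    also have "\<dots> \<le> (\<Sum>f\<in>F. if f \<in> A \<or> f \<in> Z then real (card X) else 1 / 10 ^ 37 * real n ^ 3)"
      by (intro sum_mono deg)
    also have "\<dots> = real (card (F \<inter> {f. f \<in> A \<or> f \<in> Z})) * real (card X) + real (card (F \<inter> - {f. f \<in> A \<or> f \<in> Z})) * (1 / 10 ^ 37 * real n ^ 3)"
      using F(1) by (simp add: sum.If_cases)
    also have "F \<inter> {f. f \<in> A \<or> f \<in> Z} = (F \<inter> A) \<union> Z" using F(3) by auto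
    also have "real (card ((F \<inter> A) \<union> Z)) * real (card X) \<le> (real (card (F \<inter> A)) + real (card Z)) * real (card X)"
      using card_Un_le[of "F \<inter> A" Z] by (intro mult_right_mono) auto
    also have "real (card (F \<inter> - {f. f \<in> A \<or> f \<in> Z})) * (1 / 10 ^ 37 * real n ^ 3) \<le> 1000 * (1 / 10 ^ 37 * real n ^ 3)"
      using card_mono[OF F(1), of "F \<inter> - {f. f \<in> A \<or> f \<in> Z}"] F(2) by (intro mult_right_mono) auto
    finally show ?thesis by (simp add: mult.commute)
  qed
  have cA: "real (card (A - F)) + real (card (F \<inter> A)) = real (card A)"
    using card_Diff_subset_Int[of A F] F(1) card_mono[of A "A \<inter> F"] by (simp add: Int_commute)
  have "real (card X) * real (card A) = real (card X) * real (card (A - F)) + real (card X) * real (card (F \<inter> A))"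
    by (simp only: cA[symmetric] distrib_left)
  hence "real (card (Sigma X ?Y)) + real (card X) * (real n + 1) \<le>
     real (card X) * real (card A) + real (card X) * real (card Z) + real (card N) + 1000 * (1 / 10 ^ 37 * real n ^ 3)"
    using main D FF by (simp only: distrib_left; linarith)
  moreover have "1000 * (1 / 10 ^ 37 * real n ^ 3) \<le> 1 / 10 ^ 30 * real n ^ 3"
    using zero_le_power[of "real n" 3] by simp
  ultimately show ?thesis using Y by (simp only: right_diff_distrib distrib_left; linarith)
qed

end

text \<open>The two mirror inequalities have different numbers of triples in front of
  \<open>s\<close>, and \<open>s\<close> may be negative. They become comparable only after division
  by \<open>X\<close>.\<close>

lemma quotient_bound:
  fixes m X N P e s :: real
  assumes "0 < m" "98 / 100 * m ^ 3 \<le> X" "X \<le> 101 / 100 * m ^ 3" "0 \<le> N" "0 \<le> P" "0 \<le> e"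
    and "X * s \<le> N - 9 / 4 * m ^ 2 * P + e"
  shows "s \<le> (N + e) / (98 / 100 * m ^ 3) - 9 / 4 * m ^ 2 * P / (101 / 100 * m ^ 3)"
proof -
  have m3: "0 < 98 / 100 * m ^ 3" using assms(1) by simp
  hence X: "0 < X" using assms(2) by linarith
  have "s = X * s / X" using X by simp
  also have "\<dots> \<le> (N - 9 / 4 * m ^ 2 * P + e) / X" using assms(7) X by (intro divide_right_mono) auto
  also have "\<dots> = (N + e) / X - 9 / 4 * m ^ 2 * P / X" by (simp add: diff_divide_distrib add_divide_distrib)
  finally have "s \<le> (N + e) / X - 9 / 4 * m ^ 2 * P / X" .
  moreover have "(N + e) / X \<le> (N + e) / (98 / 100 * m ^ 3)"
    using assms m3 X by (intro divide_left_mono) auto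
  moreover have "9 / 4 * m ^ 2 * P / (101 / 100 * m ^ 3) \<le> 9 / 4 * m ^ 2 * P / X"
    using assms m3 X by (intro divide_left_mono) auto
  ultimately show ?thesis by linarith
qed

context near_extremal begin

lemma card_triples:
  assumes F: "finite F" "real (card F) \<le> 1 / 1000 * real n"
  defines "X \<equiv> {(a, x, b). a \<in> A - F \<and> x \<in> A - F \<and> a \<noteq> x \<and> b \<in> B - F}"
  shows "98 / 100 * real n ^ 3 \<le> real (card X)" "real (card X) \<le> 101 / 100 * real n ^ 3"
proof -
  have n5: "10 ^ 5 \<le> real n" by (rule order_trans[OF _ n_real]) simp
  have X: "X = Sigma (A - F) (\<lambda>a. (A - F - {a}) \<times> (B - F))" by (auto simp: X_def)
  define \<alpha> \<beta> where "\<alpha> = real (card (A - F))" and "\<beta> = real (card (B - F))"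
  have diff: "real (card S) \<le> real (card (S - F)) + real (card F)" if "finite S" for S
    using card_Un_le[of "S - F" F] card_mono[of "S - F \<union> F" S] that F(1) by auto
  have \<alpha>: "998 / 1000 * real n \<le> \<alpha>" "\<alpha> \<le> 1001 / 1000 * real n"
    using diff[of A] F(2) card_bounds(1,3) card_mono[of A "A - F"] by (auto simp: \<alpha>_def)
  have \<beta>: "998 / 1000 * real n \<le> \<beta>" "\<beta> \<le> 1001 / 1000 * real n"
    using diff[of B] F(2) card_bounds(2,4) card_mono[of B "B - F"] by (auto simp: \<beta>_def)
  have fibre: "real (card ((A - F - {a}) \<times> (B - F))) = (\<alpha> - 1) * \<beta>" if "a \<in> A - F" for a
  proof -
    have "0 < card (A - F)" using that by (auto simp: card_gt_0_iff)
    hence "real (card (A - F - {a})) = \<alpha> - 1" using that by (simp add: \<alpha>_def of_nat_diff)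
    thus ?thesis by (simp add: card_cartesian_product \<beta>_def)
  qed
  have "(\<alpha> - 1) * \<beta> * \<alpha> \<le> real (card X)" unfolding X \<alpha>_def
    using fibre by (intro card_Sigma_ge) (auto simp: \<alpha>_def)
  moreover have "997 / 1000 * real n * (998 / 1000 * real n) * (998 / 1000 * real n) \<le> (\<alpha> - 1) * \<beta> * \<alpha>"
    using \<alpha> \<beta> n5 by (intro mult_mono) auto
  moreover have "98 / 100 * real n ^ 3 \<le> 997 / 1000 * real n * (998 / 1000 * real n) * (998 / 1000 * real n)"
    using zero_le_power[of "real n" 3] by (simp add: power3_eq_cube)
  ultimately show "98 / 100 * real n ^ 3 \<le> real (card X)" by linarith
  have "real (card X) \<le> (\<alpha> - 1) * \<beta> * \<alpha>" unfolding X \<alpha>_def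
    using fibre by (intro card_Sigma_le) (auto simp: \<alpha>_def)
  moreover have "(\<alpha> - 1) * \<beta> * \<alpha> \<le> 1001 / 1000 * real n * (1001 / 1000 * real n) * (1001 / 1000 * real n)"
    using \<alpha> \<beta> n5 by (intro mult_mono) auto
  moreover have "1001 / 1000 * real n * (1001 / 1000 * real n) * (1001 / 1000 * real n) \<le> 101 / 100 * real n ^ 3"
    using zero_le_power[of "real n" 3] by (simp add: power3_eq_cube)
  ultimately show "real (card X) \<le> 101 / 100 * real n ^ 3" by linarith
qed

text \<open>If no edge is usable, each AABB edge contains a heavy pair, so there are at most about
  n^2 (P + P') of them, while heavy pairs cost 9/4 n^2 missing odd sets each. Summed over both sides
  the codegree condition leaves s + s' = 2 - |Z|, which is at least 1. With codegree n - 2 this sum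
  would be -|Z| and the argument would give nothing.\<close>

lemma usable_exists:
  assumes F: "finite F" "card F \<le> 1000" "Z \<subseteq> F" and Z: "card Z \<le> 1"
    and good: "\<And>a b. a \<in> A - F \<Longrightarrow> b \<in> B - F \<Longrightarrow> g2 a b"
  shows "usable F"
proof (rule ccontr)
  assume no: "\<not> usable F"
  interpret sw: near_extremal V E n B A Z by (rule swapped)
  define m where "m = real n"
  have m: "0 < m" "10 ^ 10 \<le> m" using n_pos(1) order_trans[OF _ n_real, of "10 ^ 10"] by (simp_all add: m_def)
  have Fn: "real (card F) \<le> 1 / 1000 * real n" using F(2) m by (simp add: m_def)
  define N where "N = {(a, x, b, b'). a \<in> A - F \<and> x \<in> A - F \<and> b \<in> B - F \<and> b' \<in> B - F \<and> {a, x, b, b'} \<in> E}"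
  define N' where "N' = {(a, x, b, b'). a \<in> B - F \<and> x \<in> B - F \<and> b \<in> A - F \<and> b' \<in> A - F \<and> {a, x, b, b'} \<in> E}"
  let ?H = "{(a, x). heavy F a x}" and ?H' = "{(b, b'). sw.heavy F b b'}"
  define P P' where "P = real (card ?H)" and "P' = real (card ?H')"
  have finN: "finite N" unfolding N_def by (rule finite_subset[of _ "A \<times> A \<times> B \<times> B"]) auto
  have "card N' \<le> card N"
  proof (rule card_inj_on_le[of "\<lambda>(b, b', a, x). (a, x, b, b')"])
    have "{b, b', a, x} = {a, x, b, b'}" for a x b b' :: 'a by auto
    thus "(\<lambda>(b, b', a, x). (a, x, b, b')) ` N' \<subseteq> N" by (auto simp: N_def N'_def)
    show "inj_on (\<lambda>(b, b', a, x). (a, x, b, b')) N'" by (auto simp: inj_on_def)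
  qed (rule finN)
  hence N': "real (card N') \<le> real (card N)" by simp
  have sq: "real (card B) * real (card B) \<le> 1003 / 1000 * m ^ 2" "real (card A) * real (card A) \<le> 1003 / 1000 * m ^ 2"
  proof -
    have "real (card B) * real (card B) \<le> 1001 / 1000 * m * (1001 / 1000 * m)"
      "real (card A) * real (card A) \<le> 1001 / 1000 * m * (1001 / 1000 * m)"
      using card_bounds(1,2) by (simp_all only: m_def) (intro mult_mono; simp)+
    moreover have "1001 / 1000 * m * (1001 / 1000 * m) \<le> 1003 / 1000 * m ^ 2"
      using zero_le_power2[of m] by (simp add: power2_eq_square)
    ultimately show "real (card B) * real (card B) \<le> 1003 / 1000 * m ^ 2"
      "real (card A) * real (card A) \<le> 1003 / 1000 * m ^ 2" by linarith+
  qed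
  have finH: "finite ?H" "finite ?H'"
    by (rule finite_subset[of _ "A \<times> A"], auto simp: heavy_def)
       (rule finite_subset[of _ "B \<times> B"], auto simp: sw.heavy_def)
  have "N \<subseteq> {(a, x, b, b'). ((a, x), (b, b')) \<in> ?H \<times> (B \<times> B)} \<union> {(a, x, b, b'). ((b, b'), (a, x)) \<in> ?H' \<times> (A \<times> A)}"
    using edge_heavy[OF no good F(1) Fn] by (auto simp: N_def)
  moreover have "{(a, x, b, b'). ((a, x), (b, b')) \<in> ?H \<times> (B \<times> B)} = {t. (\<lambda>(a, x, b, b'). ((a, x), (b, b'))) t \<in> ?H \<times> (B \<times> B)}"
    "{(a, x, b, b'). ((b, b'), (a, x)) \<in> ?H' \<times> (A \<times> A)} = {t. (\<lambda>(a, x, b, b'). ((b, b'), (a, x))) t \<in> ?H' \<times> (A \<times> A)}"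
    by auto
  ultimately have sub: "N \<subseteq> {t. (\<lambda>(a, x, b, b'). ((a, x), (b, b'))) t \<in> ?H \<times> (B \<times> B)} \<union>
     {t. (\<lambda>(a, x, b, b'). ((b, b'), (a, x))) t \<in> ?H' \<times> (A \<times> A)}" (is "_ \<subseteq> ?K \<union> ?K'") by (simp only:)
  have inj: "inj (\<lambda>(a, x, b, b'). ((a, x), (b, b')))" "inj (\<lambda>(a, x, b, b'). ((b, b'), (a, x)))"
    by (auto simp: inj_on_def)
  have finK: "finite ?K" "finite ?K'"
    using finite_vimageI[OF _ inj(1), of "?H \<times> (B \<times> B)"] finite_vimageI[OF _ inj(2), of "?H' \<times> (A \<times> A)"] finH
    by (simp_all add: vimage_def)
  have "card N \<le> card (?K \<union> ?K')" using sub finK by (intro card_mono) auto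
  also have "\<dots> \<le> card ?K + card ?K'" by (rule card_Un_le)
  also have "\<dots> \<le> card (?H \<times> (B \<times> B)) + card (?H' \<times> (A \<times> A))"
    using finH inj by (intro add_mono card_preimage_le) auto
  finally have "real (card N) \<le> P * (real (card B) * real (card B)) + P' * (real (card A) * real (card A))"
    unfolding P_def P'_def card_cartesian_product of_nat_mult[symmetric] of_nat_add[symmetric] of_nat_le_iff .
  also have "\<dots> \<le> P * (1003 / 1000 * m ^ 2) + P' * (1003 / 1000 * m ^ 2)"
    using sq by (intro add_mono mult_left_mono) (auto simp: P_def P'_def)
  finally have Nle: "real (card N) \<le> 1003 / 1000 * m ^ 2 * (P + P')" by (simp add: algebra_simps)
  define e where "e = 1 / 10 ^ 30 * m ^ 3"
  have e: "0 \<le> e" using m by (simp add: e_def)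
  define s s' where "s = m + 1 - real (card A) - real (card Z)" and "s' = m + 1 - real (card B) - real (card Z)"
  note X = card_triples[OF F(1) Fn] and Y = sw.card_triples[OF F(1) Fn]
  have "s \<le> (real (card N) + e) / (98 / 100 * m ^ 3) - 9 / 4 * m ^ 2 * P / (101 / 100 * m ^ 3)"
    using X half_count[OF F] m e unfolding m_def s_def P_def N_def e_def
    by (intro quotient_bound) auto
  moreover have "s' \<le> (real (card N) + e) / (98 / 100 * m ^ 3) - 9 / 4 * m ^ 2 * P' / (101 / 100 * m ^ 3)"
    using Y sw.half_count[OF F] m e N' unfolding m_def s'_def P'_def N'_def e_def
    by (intro quotient_bound) auto
  moreover have "real (card A) + real (card B) + real (card Z) = 2 * m"
    using arg_cong[OF card_sum, of real] by (simp add: m_def)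
  hence "1 \<le> s + s'" using Z unfolding s_def s'_def by linarith
  ultimately have "1 \<le> 2 * ((real (card N) + e) / (98 / 100 * m ^ 3)) -
      (9 / 4 * m ^ 2 * P / (101 / 100 * m ^ 3) + 9 / 4 * m ^ 2 * P' / (101 / 100 * m ^ 3))" by linarith
  moreover have "9 / 4 * m ^ 2 * P / (101 / 100 * m ^ 3) + 9 / 4 * m ^ 2 * P' / (101 / 100 * m ^ 3) =
      225 / 101 * ((P + P') / m)"
    using m(1) by (simp add: field_simps power2_eq_square power3_eq_cube)
  moreover have "(real (card N) + e) / (98 / 100 * m ^ 3) \<le> (1003 / 1000 * m ^ 2 * (P + P') + e) / (98 / 100 * m ^ 3)"
    using Nle m by (intro divide_right_mono) auto
  moreover have "(1003 / 1000 * m ^ 2 * (P + P') + e) / (98 / 100 * m ^ 3) = 1003 / 980 * ((P + P') / m) + 100 / 98 / 10 ^ 30"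
    using m(1) unfolding e_def by (simp add: field_simps power2_eq_square power3_eq_cube)
  moreover have "0 \<le> (P + P') / m" using m by (simp add: P_def P'_def)
  \<comment> \<open>The same \<open>N\<close> occurs on both sides, so its coefficient doubles:
    2006/980 of (P + P') / m is still below 225/101 of it, and 1 would be bounded by a tiny error
    term.\<close>
  ultimately show False by (simp only: pow_simps; linarith)
qed

text \<open>If the pair a, x is rich with both b and b', the edge is the middle window of a detour
  of A kind. Otherwise some triple a, x, c is poor and has many AABB extensions y in
  \<open>B\<close>; typicality makes c, y rich on the B side, which yields a detour of B
  kind.\<close>

lemma detour_exists:
  assumes u: "usable F" and Z: "Z = {}" and F: "finite F" "real (card F) \<le> 1 / 1000 * real n"
    and good: "\<And>a b. a \<in> A \<Longrightarrow> b \<in> B \<Longrightarrow> g2 a b"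
  shows "(\<exists>P. detour F P) \<or> (\<exists>P. near_extremal.detour V E n B A F P)"
proof -
  interpret sw: near_extremal V E n B A Z by (rule swapped)
  obtain a x b b' where h: "a \<in> A - F" "x \<in> A - F" "b \<in> B - F" "b' \<in> B - F" "{a, b, x, b'} \<in> E"
    using u unfolding usable_def by blast
  have d: "distinct [a, b, x, b']" by (rule edge_distinct[OF h(5)])
  have poor: "\<exists>P. sw.detour F P" if c: "c \<in> B - F" "\<not> richA a x c" for c
  proof -
    have ac: "a \<noteq> x" using d by simp
    have many: "89 / 100 * real n \<le> real (card {u \<in> B. {a, x, c, u} \<in> E})"
      using h c ac by (intro many_B_of_poor) auto
    have "\<exists>y\<in>{u \<in> B. {a, x, c, u} \<in> E} - F. \<forall>T\<in>set [g3 a c, g3 x c]. T y"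
      using few_g3[OF good[of a c]] few_g3[OF good[of x c]] h c many F n_pos(1) by (intro pick_in) auto
    then obtain y where y: "y \<in> B - F" "{a, x, c, y} \<in> E" "g3 a c y" "g3 x c y" by auto
    have dy: "distinct [a, x, c, y]" by (rule edge_distinct[OF y(2)])
    have "g3 c y a" "g3 c y x" using y(3,4) g3_commute(1)[of a c y] g3_commute(2)[of c a y]
        g3_commute(1)[of x c y] g3_commute(2)[of c x y] by simp_all
    hence "richB c y a" "richB c y x" using h c y(1) dy by (auto intro!: richB_of_g3)
    hence "richB c a y" "richB y x c" using rich_commute(3,4) by metis+
    moreover have "{c, a, y, x} \<in> E" using y(2) by (simp add: insert_commute)
    moreover have "g2 c a" "g2 y x" using good h c y(1) g2_commute by auto
    ultimately show ?thesis using h c y(1)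
      by (intro sw.detour_of_edge[of c y a x, OF _ _ _ _ _ _ _ _ _ F]) (auto simp: swap richB_def)
  qed
  show ?thesis
  proof (cases "richA a x b \<and> richA a x b'")
    case True
    hence "richA a b x" "richA x b' a" using rich_commute(2)[of a x b] rich_commute(1)[of a x b'] rich_commute(2)[of x a b']
      by simp_all
    hence "\<exists>P. detour F P" unfolding richA_def using h good
      by (intro detour_of_edge[of a x b b', OF _ _ _ _ _ _ _ _ _ F]) auto
    thus ?thesis by blast
  next
    case False
    thus ?thesis using poor[of b] poor[of b'] h by blast
  qed
qed

end

section \<open>Crossings and detours through exceptional vertices\<close>

text \<open>A thick family allows a path of triples, consecutive ones sharing a pair, to be continued from every covered
pair while avoiding any few vertices.\<close>

definition covers :: "'b set set \<Rightarrow> 'b set \<Rightarrow> bool" where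
  "covers G P \<longleftrightarrow> (\<exists>T\<in>G. P \<subseteq> T)"

lemma coversI: "T \<in> G \<Longrightarrow> P \<subseteq> T \<Longrightarrow> covers G P"
  unfolding covers_def by blast

definition thick :: "'b set set \<Rightarrow> bool" where
  "thick G \<longleftrightarrow> finite G \<and> (\<forall>T\<in>G. card T = 3 \<and> (\<forall>P\<subseteq>T. card P = 2 \<longrightarrow> 10 < card {T' \<in> G. P \<subseteq> T'}))"

lemma card3_insert:
  assumes "card T = 3" "{y, z} \<subseteq> T" "y \<noteq> z"
  shows "\<exists>w. T = {y, z, w} \<and> w \<noteq> y \<and> w \<noteq> z"
proof -
  have fin: "finite T" using assms(1) by (intro card_ge_0_finite) simp
  have "card (T - {y, z}) = 1" using assms fin by (simp add: card_Diff_subset)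
  then obtain w where "T - {y, z} = {w}" by (auto simp: card_1_singleton_iff)
  thus ?thesis using assms(2) by (intro exI[of _ w]) auto
qed

lemma thick_extend:
  assumes G: "thick G" and P: "covers G {y, z}" "y \<noteq> z" and U: "finite U" "card U \<le> 10"
  shows "\<exists>w. w \<notin> U \<and> {y, z, w} \<in> G \<and> w \<noteq> y \<and> w \<noteq> z"
proof (rule ccontr)
  assume no: "\<not> ?thesis"
  let ?H = "{T' \<in> G. {y, z} \<subseteq> T'}"
  have "?H \<subseteq> (\<lambda>w. {y, z, w}) ` U"
  proof
    fix T assume T: "T \<in> ?H"
    have "card T = 3" using T G unfolding thick_def by blast
    then obtain w where w: "T = {y, z, w}" "w \<noteq> y" "w \<noteq> z" using card3_insert[of T y z] T P(2) by blast
    hence "w \<in> U" using no T by blast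
    thus "T \<in> (\<lambda>w. {y, z, w}) ` U" using w(1) by blast
  qed
  hence "card ?H \<le> card ((\<lambda>w. {y, z, w}) ` U)" using U(1) by (intro card_mono) auto
  also have "\<dots> \<le> 10" using card_image_le[OF U(1)] U(2) by (rule order_trans)
  finally have "card ?H \<le> 10" .
  moreover have "card {y, z} = 2" using P(2) by simp
  hence "10 < card ?H" using G P(1) unfolding thick_def covers_def by blast
  ultimately show False by linarith
qed

context near_extremal begin

section \<open>Typical links of exceptional vertices\<close>

definition hset :: "'a set \<Rightarrow> bool" where
  "hset T \<longleftrightarrow> T \<subseteq> A \<union> B \<and> card T = 3 \<and> few (1 / 10 ^ 7) (\<lambda>u. \<not> W (insert u T)) \<and>
     (\<forall>p\<in>T. \<forall>q\<in>T. p \<noteq> q \<longrightarrow> g2 p q)"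

lemma hset_iff: "hset {x, y, z} \<longleftrightarrow> h3 x y z"
proof -
  have "insert u {x, y, z} = {x, y, z, u}" for u by auto
  hence "few (1 / 10 ^ 7) (\<lambda>u. \<not> W (insert u {x, y, z})) \<longleftrightarrow> g3 x y z" unfolding g3_def by simp
  moreover have "card {x, y, z} = 3 \<longleftrightarrow> x \<noteq> y \<and> y \<noteq> z \<and> x \<noteq> z" by (auto simp: card_insert_if)
  moreover have "(\<forall>p\<in>{x, y, z}. \<forall>q\<in>{x, y, z}. p \<noteq> q \<longrightarrow> g2 p q) \<longleftrightarrow> g2 x y \<and> g2 y z \<and> g2 x z"
    if "x \<noteq> y \<and> y \<noteq> z \<and> x \<noteq> z"
    using that g2_commute[of x y] g2_commute[of y z] g2_commute[of x z] by auto
  ultimately show ?thesis unfolding hset_def h3_def by blast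
qed

lemma swap_hset: "near_extremal.hset E n B A = hset"
proof
  fix T
  interpret sw: near_extremal V E n B A Z by (rule swapped)
  show "near_extremal.hset E n B A T = hset T" unfolding hset_def sw.hset_def by (simp add: swap Un_commute)
qed

text \<open>Links are families of 3-sets, for which \<open>hset\<close> restates typicality: pruning
  by \<open>dense_core\<close> and walking along shared pairs are insensitive to the order of a
  triple.\<close>

definition linkA :: "'a \<Rightarrow> 'a set \<Rightarrow> 'a set set" where
  "linkA v F = {T. hset T \<and> T \<inter> F = {} \<and> card (T \<inter> A) = 2 \<and> insert v T \<in> E}"

definition linkB :: "'a \<Rightarrow> 'a set \<Rightarrow> 'a set set" where
  "linkB v F = {T. hset T \<and> T \<inter> F = {} \<and> card (T \<inter> B) = 2 \<and> insert v T \<in> E}"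

lemma swap_link: "near_extremal.linkA E n B A = linkB" "near_extremal.linkB E n B A = linkA"
proof -
  interpret sw: near_extremal V E n B A Z by (rule swapped)
  show "near_extremal.linkA E n B A = linkB" "near_extremal.linkB E n B A = linkA"
    by (intro ext, simp add: linkA_def linkB_def sw.linkA_def sw.linkB_def swap_hset)+
qed

lemma finite_link: "finite (linkA v F)" "finite (linkB v F)"
  by (rule finite_subset[of _ "Pow (A \<union> B)"]; auto simp: linkA_def linkB_def hset_def)+

lemma few_not_h3:
  assumes F: "finite F" "real (card F) \<le> 1 / 10 ^ 100 * real n"
  shows "real (card {(x, y, z). x \<in> A \<union> B \<and> y \<in> A \<union> B \<and> z \<in> A \<union> B \<and> x \<noteq> y \<and> y \<noteq> z \<and> x \<noteq> z \<and>
    \<not> (h3 x y z \<and> x \<notin> F \<and> y \<notin> F \<and> z \<notin> F)}) \<le> 1 / 10 ^ 90 * real n ^ 3"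
proof -
  let ?U = "A \<union> B"
  let ?S = "{(x, y, z). x \<in> ?U \<and> y \<in> ?U \<and> z \<in> ?U \<and> x \<noteq> y \<and> y \<noteq> z \<and> x \<noteq> z \<and>
    \<not> (h3 x y z \<and> x \<notin> F \<and> y \<notin> F \<and> z \<notin> F)}"
  let ?g3 = "{(x, y, z). x \<in> ?U \<and> y \<in> ?U \<and> z \<in> ?U \<and> \<not> g3 x y z}"
  let ?g2 = "{(x, y). x \<in> ?U \<and> y \<in> ?U \<and> \<not> g2 x y}"
  let ?R = "?g2 \<times> ?U" and ?FF = "F \<times> (?U \<times> ?U)"
  let ?R1 = "{t. (\<lambda>(x, y, z). ((x, y), z)) t \<in> ?R}" and ?R2 = "{t. (\<lambda>(x, y, z). ((y, z), x)) t \<in> ?R}"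
    and ?R3 = "{t. (\<lambda>(x, y, z). ((x, z), y)) t \<in> ?R}"
  let ?F1 = "{t. (\<lambda>(x, y, z). (x, (y, z))) t \<in> ?FF}" and ?F2 = "{t. (\<lambda>(x, y, z). (y, (x, z))) t \<in> ?FF}"
    and ?F3 = "{t. (\<lambda>(x, y, z). (z, (x, y))) t \<in> ?FF}"
  have fin0: "finite ?g3" "finite ?g2"
    by (rule finite_subset[of _ "?U \<times> ?U \<times> ?U"], auto) (rule finite_subset[of _ "?U \<times> ?U"], auto)
  have finR: "finite ?R" "finite ?FF" using fin0(2) F(1) by auto
  have fin3: "finite {t. f t \<in> ?R}" "finite {t. f' t \<in> ?FF}" if "inj f" "inj f'" for f f'
    using finite_vimageI[OF finR(1) that(1)] finite_vimageI[OF finR(2) that(2)] by (simp_all add: vimage_def)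
  have "?S \<subseteq> ?g3 \<union> (?R1 \<union> (?R2 \<union> (?R3 \<union> (?F1 \<union> (?F2 \<union> ?F3)))))"
  proof
    fix s assume "s \<in> ?S"
    then obtain x y z where s: "s = (x, y, z)" and m: "x \<in> ?U" "y \<in> ?U" "z \<in> ?U" "x \<noteq> y" "y \<noteq> z" "x \<noteq> z"
      "\<not> (h3 x y z \<and> x \<notin> F \<and> y \<notin> F \<and> z \<notin> F)" by auto
    hence "\<not> g3 x y z \<or> \<not> g2 x y \<or> \<not> g2 y z \<or> \<not> g2 x z \<or> x \<in> F \<or> y \<in> F \<or> z \<in> F" unfolding h3_def by simp
    thus "s \<in> ?g3 \<union> (?R1 \<union> (?R2 \<union> (?R3 \<union> (?F1 \<union> (?F2 \<union> ?F3)))))"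
      using m(1-3) unfolding s by (elim disjE) simp_all
  qed
  moreover have "finite (?g3 \<union> (?R1 \<union> (?R2 \<union> (?R3 \<union> (?F1 \<union> (?F2 \<union> ?F3))))))"
    by (intro finite_UnI fin0 fin3) (auto simp: inj_on_def)
  ultimately have "card ?S \<le> card (?g3 \<union> (?R1 \<union> (?R2 \<union> (?R3 \<union> (?F1 \<union> (?F2 \<union> ?F3))))))" by (intro card_mono)
  also have "\<dots> \<le> card ?g3 + (card ?R1 + (card ?R2 + (card ?R3 + (card ?F1 + (card ?F2 + card ?F3)))))"
    by (intro order_trans[OF card_Un_le] add_left_mono order_refl)
  also have "\<dots> \<le> card ?g3 + (card ?R + (card ?R + (card ?R + (card ?FF + (card ?FF + card ?FF)))))"
    by (intro add_mono card_preimage_le finR order_refl) (auto simp: inj_on_def)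
  finally have "real (card ?S) \<le> real (card ?g3) + 3 * real (card ?R) + 3 * real (card ?FF)" by linarith
  moreover have "real (card ?R) \<le> 1 / 10 ^ 92 * real n ^ 2 * (3 * real n)"
    unfolding card_cartesian_product of_nat_mult
    using not_g2_pairs card_AB n_pos(1) by (intro mult_mono) auto
  moreover have "real (card ?FF) \<le> 1 / 10 ^ 100 * real n * (3 * real n * (3 * real n))"
    unfolding card_cartesian_product of_nat_mult
    using F(2) card_AB n_pos(1) by (intro mult_mono) auto
  moreover have "1 / 10 ^ 92 * real n ^ 2 * (3 * real n) = 3 / 10 ^ 92 * real n ^ 3"
    "1 / 10 ^ 100 * real n * (3 * real n * (3 * real n)) = 9 / 10 ^ 100 * real n ^ 3"
    by (simp_all add: power2_eq_square power3_eq_cube)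
  moreover have "0 \<le> real n ^ 3" by simp
  ultimately show ?thesis using not_g3_triples by (simp only: pow_simps; linarith)
qed

text \<open>A 3-set accounts for at most 27 ordered triples, so the density 10^-38 leaves 10^-40
  after the atypical triples, of density 10^-90, are discarded.\<close>

lemma card_linkA:
  assumes v: "v \<in> Z" and F: "finite F" "real (card F) \<le> 1 / 10 ^ 100 * real n"
  shows "1 / 10 ^ 40 * real n ^ 3 \<le> real (card (linkA v F))"
proof -
  let ?S = "{(b, a, a'). b \<in> B \<and> a \<in> A \<and> a' \<in> A \<and> {v, b, a, a'} \<in> E}"
  let ?bad = "{(x, y, z). x \<in> A \<union> B \<and> y \<in> A \<union> B \<and> z \<in> A \<union> B \<and> x \<noteq> y \<and> y \<noteq> z \<and> x \<noteq> z \<and>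
    \<not> (h3 x y z \<and> x \<notin> F \<and> y \<notin> F \<and> z \<notin> F)}"
  let ?good = "?S - ?bad"
  have finS: "finite ?S" by (rule finite_subset[of _ "B \<times> A \<times> A"]) auto
  have finbad: "finite ?bad" by (rule finite_subset[of _ "(A \<union> B) \<times> (A \<union> B) \<times> (A \<union> B)"]) auto
  have "card ?S \<le> card (?good \<union> ?bad)" using finS finbad by (intro card_mono) auto
  also have "\<dots> \<le> card ?good + card ?bad" by (rule card_Un_le)
  finally have 1: "real (card ?S) \<le> real (card ?good) + real (card ?bad)" by linarith
  have "?good \<subseteq> (\<Union>T\<in>linkA v F. T \<times> (T \<times> T))"
  proof
    fix s assume sg: "s \<in> ?good"
    then obtain b a a' where s: "s = (b, a, a')" and m: "b \<in> B" "a \<in> A" "a' \<in> A" "{v, b, a, a'} \<in> E" by auto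
    have d: "distinct [v, b, a, a']" by (rule edge_distinct[OF m(4)])
    have h: "h3 b a a'" "b \<notin> F" "a \<notin> F" "a' \<notin> F" using sg d m unfolding s by auto
    have "card ({b, a, a'} \<inter> A) = 2" using m d not_mem(2)[OF m(1)] by (simp add: Int_insert_left)
    hence "{b, a, a'} \<in> linkA v F" unfolding linkA_def using h m(4) hset_iff by simp
    thus "s \<in> (\<Union>T\<in>linkA v F. T \<times> (T \<times> T))" unfolding s by blast
  qed
  moreover have finT: "finite T" if "T \<in> linkA v F" for T
    using that unfolding linkA_def hset_def by (auto intro: card_ge_0_finite)
  ultimately have "card ?good \<le> card (\<Union>T\<in>linkA v F. T \<times> (T \<times> T))"
    using finite_link by (intro card_mono) auto
  also have "\<dots> \<le> (\<Sum>T\<in>linkA v F. card (T \<times> (T \<times> T)))" by (rule card_UN_le[OF finite_link(1)])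
  also have "\<dots> = (\<Sum>T\<in>linkA v F. 27)"
    by (intro sum.cong refl) (simp add: linkA_def hset_def card_cartesian_product)
  finally have "real (card ?good) \<le> 27 * real (card (linkA v F))" by simp
  moreover have "0 \<le> real n ^ 3" by simp
  ultimately show ?thesis using 1 Z_dense(1)[OF v] few_not_h3[OF F] by (simp only: pow_simps; linarith)
qed

lemma card_linkB:
  assumes v: "v \<in> Z" and F: "finite F" "real (card F) \<le> 1 / 10 ^ 100 * real n"
  shows "1 / 10 ^ 40 * real n ^ 3 \<le> real (card (linkB v F))"
proof -
  interpret sw: near_extremal V E n B A Z by (rule swapped)
  show ?thesis using sw.card_linkA[OF assms] by (simp add: swap_link)
qed

lemma card_pairs:
  "finite {P. P \<subseteq> A \<union> B \<and> card P = 2}" "real (card {P. P \<subseteq> A \<union> B \<and> card P = 2}) \<le> 5 * real n ^ 2"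
proof -
  show fin: "finite {P. P \<subseteq> A \<union> B \<and> card P = 2}" by (rule finite_subset[of _ "Pow (A \<union> B)"]) auto
  have "{P. P \<subseteq> A \<union> B \<and> card P = 2} \<subseteq> (\<lambda>(x, y). {x, y}) ` ((A \<union> B) \<times> (A \<union> B))"
  proof
    fix P assume P: "P \<in> {P. P \<subseteq> A \<union> B \<and> card P = 2}"
    then obtain x y where "P = {x, y}" by (auto simp: card_2_iff)
    thus "P \<in> (\<lambda>(x, y). {x, y}) ` ((A \<union> B) \<times> (A \<union> B))"
      using P by (intro image_eqI[of _ _ "(x, y)"]) auto
  qed
  hence "card {P. P \<subseteq> A \<union> B \<and> card P = 2} \<le> card ((A \<union> B) \<times> (A \<union> B))"
    by (intro surj_card_le) auto
  hence "real (card {P. P \<subseteq> A \<union> B \<and> card P = 2}) \<le> real (card (A \<union> B)) * real (card (A \<union> B))"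
    unfolding card_cartesian_product of_nat_mult[symmetric] of_nat_le_iff .
  also have "\<dots> \<le> 2002 / 1000 * real n * (2002 / 1000 * real n)" using card_AB by (intro mult_mono) auto
  also have "\<dots> \<le> 5 * real n ^ 2" using zero_le_power2[of "real n"] by (simp add: power2_eq_square)
  finally show "real (card {P. P \<subseteq> A \<union> B \<and> card P = 2}) \<le> 5 * real n ^ 2" .
qed

text \<open>Pruning with d = 10 loses at most 10 members for each of at most 5 n^2 pairs, negligible
  against a link of order n^3.\<close>

lemma thick_subfamily:
  assumes "finite G" "\<And>T. T \<in> G \<Longrightarrow> T \<subseteq> A \<union> B \<and> card T = 3"
  shows "\<exists>G'\<subseteq>G. thick G' \<and> real (card (G - G')) \<le> 50 * real n ^ 2"
proof -
  let ?Q = "{P. P \<subseteq> A \<union> B \<and> card P = 2}"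
  have "\<exists>G'\<subseteq>G. card G \<le> card G' + 10 * card ?Q \<and>
    (\<forall>T\<in>G'. \<forall>P\<subseteq>T. card P = 2 \<longrightarrow> 10 < card {T' \<in> G'. P \<subseteq> T'})"
    using assms card_pairs(1) by (intro dense_core) auto
  then obtain G' where G': "G' \<subseteq> G" "card G \<le> card G' + 10 * card ?Q"
    "\<forall>T\<in>G'. \<forall>P\<subseteq>T. card P = 2 \<longrightarrow> 10 < card {T' \<in> G'. P \<subseteq> T'}" by blast
  have fin: "finite G'" using G'(1) assms(1) finite_subset by blast
  have "card (G - G') \<le> 10 * card ?Q" using G'(1,2) fin by (simp add: card_Diff_subset)
  hence "real (card (G - G')) \<le> 10 * (5 * real n ^ 2)" using card_pairs(2) by linarith
  moreover have "thick G'" unfolding thick_def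
  proof (intro conjI ballI)
    show "card T = 3" if "T \<in> G'" for T using that G'(1) assms(2) by (meson subsetD)
  qed (use fin G'(3) in auto)
  ultimately show ?thesis using G'(1) by (intro exI[of _ G']) simp
qed

lemma card_transversals_le:
  assumes "finite G" "\<And>T. T \<in> G \<Longrightarrow> card T = 3"
  shows "card {(a, b, c). {a, b, c} \<in> G} \<le> 27 * card G"
proof -
  have fin: "finite T" if "T \<in> G" for T using assms(2)[OF that] by (intro card_ge_0_finite) simp
  have "{(a, b, c). {a, b, c} \<in> G} \<subseteq> (\<Union>T\<in>G. T \<times> (T \<times> T))" by auto
  hence "card {(a, b, c). {a, b, c} \<in> G} \<le> card (\<Union>T\<in>G. T \<times> (T \<times> T))"
    using assms(1) fin by (intro card_mono) auto
  also have "\<dots> \<le> (\<Sum>T\<in>G. card (T \<times> (T \<times> T)))" by (rule card_UN_le[OF assms(1)])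
  also have "\<dots> = (\<Sum>T\<in>G. 27)" using assms(2) by (intro sum.cong refl) (simp add: card_cartesian_product)
  finally show ?thesis by simp
qed

text \<open>Let {a, b} be covered by \<open>G1\<close>. By the codegree nearly n vertices u make {v,
  a, b, u} an edge; unless it is lost, {a, b, u} lies in \<open>G1\<close>, as \<open>G2\<close>
  does not cover {a, b}. Then u is in \<open>A\<close> and {u, b} is covered too. So one covered
  pair fills almost the whole row of b.\<close>

lemma covered_rows:
  assumes v: "v \<in> Z" and G: "finite G1" "\<And>T. T \<in> G1 \<Longrightarrow> T \<subseteq> A \<union> B \<and> card T = 3 \<and> card (T \<inter> A) = 2"
    and big: "9 / 10 ^ 41 * real n ^ 3 \<le> real (card G1)"
    and lost: "real (card {(a, b, c). a \<in> A \<and> b \<in> B \<and> c \<in> A \<union> B \<and> {v, a, b, c} \<in> E \<and> {a, b, c} \<notin> G1 \<union> G2})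
      \<le> 1 / 10 ^ 88 * real n ^ 3"
    and no: "\<And>a b. a \<in> A \<Longrightarrow> b \<in> B \<Longrightarrow> covers G1 {a, b} \<Longrightarrow> \<not> covers G2 {a, b}"
  shows "\<exists>B1\<subseteq>B. 7 / 10 ^ 41 * real n \<le> real (card B1) \<and>
    (\<forall>b\<in>B1. real (card {a \<in> A. \<not> covers G1 {a, b}}) \<le> 3 / 10 ^ 44 * real n)"
proof -
  let ?lost = "\<lambda>a b. {c \<in> A \<union> B. {v, a, b, c} \<in> E \<and> {a, b, c} \<notin> G1 \<union> G2}"
  let ?L = "{(a, b, c). a \<in> A \<and> b \<in> B \<and> c \<in> A \<union> B \<and> {v, a, b, c} \<in> E \<and> {a, b, c} \<notin> G1 \<union> G2}"
  let ?L' = "{t. (\<lambda>((a, b), c). (a, b, c)) t \<in> ?L}"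
  define S where "S = {(a, b). a \<in> A \<and> b \<in> B \<and> covers G1 {a, b}}"
  \<comment> \<open>The pairs at which unusually many edges were lost to pruning or atypicality;
    averaging over \<open>lost\<close> shows that they are few.\<close>
  define abn where "abn = {(a, b). a \<in> A \<and> b \<in> B \<and> 1 / 10 ^ 44 * real n \<le> real (card (?lost a b))}"
  have finL: "finite ?L" by (rule finite_subset[of _ "A \<times> B \<times> (A \<union> B)"]) auto
  have injL: "inj (\<lambda>((a, b), c). (a, b, c))" by (auto simp: inj_on_def)
  have finS: "finite S" "finite abn"
    by (rule finite_subset[of _ "A \<times> B"], auto simp: S_def)
       (rule finite_subset[of _ "A \<times> B"], auto simp: abn_def)
  have "1 / 10 ^ 44 * real n * real (card abn) \<le> real (card ?L')"
  proof (rule card_le_of_fibres)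
    show "finite ?L'" using finite_vimageI[OF finL injL] by (simp add: vimage_def)
    show "abn \<subseteq> A \<times> B" by (auto simp: abn_def)
    fix x assume "x \<in> abn"
    then obtain a b where x: "x = (a, b)" "a \<in> A" "b \<in> B" "1 / 10 ^ 44 * real n \<le> real (card (?lost a b))"
      by (auto simp: abn_def)
    moreover from x(2,3) have "{y. ((a, b), y) \<in> ?L'} = ?lost a b" by auto
    ultimately show "1 / 10 ^ 44 * real n \<le> real (card {y. (x, y) \<in> ?L'})" by (simp only:)
  qed auto
  also have "\<dots> \<le> real (card ?L)" using card_preimage_le[OF finL injL] by simp
  also note lost
  finally have "real n * (1 / 10 ^ 44 * real (card abn)) \<le> real n * (1 / 10 ^ 88 * real n ^ 2)"
    by (simp add: power2_eq_square power3_eq_cube mult_ac)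
  hence "1 / 10 ^ 44 * real (card abn) \<le> 1 / 10 ^ 88 * real n ^ 2" using n_pos(1) by (rule mult_left_le_imp_le)
  hence abn: "real (card abn) \<le> 1 / 10 ^ 44 * real n ^ 2" by simp
  have row: "real (card {a' \<in> A. \<not> covers G1 {a', b}}) \<le> 3 / 10 ^ 44 * real n" if ab: "(a, b) \<in> S" "(a, b) \<notin> abn" for a b
  proof -
    have m: "a \<in> A" "b \<in> B" "covers G1 {a, b}" using ab(1) by (auto simp: S_def)
    have l: "real (card (?lost a b)) \<le> 1 / 10 ^ 44 * real n" using ab(2) m by (auto simp: abn_def)
    have vab: "v \<in> V" "a \<in> V" "b \<in> V" "v \<noteq> a" "a \<noteq> b" "v \<noteq> b" using v m in_V not_mem by auto
    define NA NB C L where "NA = {u \<in> A. {v, a, b, u} \<in> E}" and "NB = {u \<in> B. {v, a, b, u} \<in> E}"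
      and "C = {u \<in> A. covers G1 {u, b}}" and "L = ?lost a b"
    have fins: "finite NA" "finite NB" "finite C" "finite L" by (simp_all add: NA_def NB_def C_def L_def)
    have no2: "\<not> covers G2 {a, b}" by (rule no[OF m])
    have "NA \<union> NB \<subseteq> C \<union> L"
    proof
      fix u assume u: "u \<in> NA \<union> NB"
      show "u \<in> C \<union> L"
      proof (cases "{a, b, u} \<in> G1 \<union> G2")
        case True
        have "{a, b, u} \<notin> G2" using no2 coversI[of "{a, b, u}" G2 "{a, b}"] by auto
        hence G1u: "{a, b, u} \<in> G1" using True by blast
        have "u \<in> A"
        proof (rule ccontr)
          assume "u \<notin> A"
          hence "{a, b, u} \<inter> A = {a}" using m not_mem(2)[OF m(2)] by auto
          thus False using G(2)[OF G1u] by simp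
        qed
        moreover have "covers G1 {u, b}" by (rule coversI[OF G1u]) simp
        ultimately show ?thesis by (simp add: C_def)
      next
        case False
        thus ?thesis using u by (auto simp: NA_def NB_def L_def)
      qed
    qed
    moreover have "NA \<inter> NB = {}" using not_mem(1) by (auto simp: NA_def NB_def)
    hence "card (NA \<union> NB) = card NA + card NB" using fins by (simp add: card_Un_disjoint)
    moreover have "card (C \<union> L) \<le> card C + card (L)" by (rule card_Un_le)
    ultimately have "card NA + card NB \<le> card C + card (L)"
      using card_mono[of "C \<union> L" "NA \<union> NB"] fins by simp
    moreover have "n \<le> card NA + card NB + card {u \<in> Z. {v, a, b, u} \<in> E} + 1" unfolding NA_def NB_def by (rule codeg_split[OF vab])
    moreover have "card {u \<in> Z. {v, a, b, u} \<in> E} \<le> card Z" by (intro card_mono) auto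
    ultimately have "real n \<le> real (card C) + real (card (L)) + real (card Z) + 1" by linarith
    moreover have "{a' \<in> A. \<not> covers G1 {a', b}} = A - C" by (auto simp: C_def)
    hence "real (card {a' \<in> A. \<not> covers G1 {a', b}}) = real (card A) - real (card C)"
      using fins(3) by (simp add: card_Diff_subset of_nat_diff card_mono C_def)
    moreover have "real (card A) \<le> real n + 1 / 10 ^ 110 * real n" using cardA_le by (simp only: distrib_right mult_1)
    moreover have "0 \<le> real n" by simp
    ultimately show ?thesis using l[folded L_def] cardZ_le one_le by (simp only: pow_simps; linarith)
  qed
  define B1 where "B1 = {b \<in> B. \<exists>a. (a, b) \<in> S \<and> (a, b) \<notin> abn}"
  have "G1 \<subseteq> (\<lambda>((a, b), c). {a, b, c}) ` (S \<times> A)"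
  proof
    fix T assume T: "T \<in> G1"
    have c: "card T = 3" "card (T \<inter> A) = 2" "T \<subseteq> A \<union> B" using G(2)[OF T] by auto
    then obtain a c where ac: "T \<inter> A = {a, c}" "a \<noteq> c" by (auto simp: card_2_iff)
    then obtain b where b: "T = {a, c, b}" "b \<noteq> a" "b \<noteq> c" using card3_insert[OF c(1), of a c] by blast
    have "b \<in> B" using b ac c(3) by auto
    moreover have "covers G1 {a, b}" by (rule coversI[OF T]) (simp add: b(1))
    ultimately have "((a, b), c) \<in> S \<times> A" using ac(1) by (auto simp: S_def)
    moreover have "T = (\<lambda>((a, b), c). {a, b, c}) ((a, b), c)" using b(1) by auto
    ultimately show "T \<in> (\<lambda>((a, b), c). {a, b, c}) ` (S \<times> A)" by (rule rev_image_eqI)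
  qed
  hence "card G1 \<le> card (S \<times> A)" using finS by (intro surj_card_le) auto
  hence "real (card G1) \<le> real (card S) * real (card A)"
    unfolding card_cartesian_product of_nat_mult[symmetric] of_nat_le_iff .
  also have "\<dots> \<le> real (card S) * (1001 / 1000 * real n)" using card_bounds(1) by (intro mult_left_mono) auto
  finally have "9 / 10 ^ 41 * real n ^ 3 \<le> real (card S) * (1001 / 1000 * real n)" using big by (rule order_trans[rotated])
  hence "real n * (9 / 10 ^ 41 * real n ^ 2) \<le> real n * (1001 / 1000 * real (card S))"
    by (simp add: power2_eq_square power3_eq_cube mult_ac)
  hence "9 / 10 ^ 41 * real n ^ 2 \<le> 1001 / 1000 * real (card S)" using n_pos(1) by (rule mult_left_le_imp_le)
  moreover have "S \<subseteq> A \<times> B1 \<union> abn" by (auto simp: S_def B1_def)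
  hence "card S \<le> card (A \<times> B1 \<union> abn)" using finS by (intro card_mono) (auto simp: B1_def)
  hence "card S \<le> card (A \<times> B1) + card abn" using card_Un_le order_trans by blast
  hence "real (card S) \<le> real (card A) * real (card B1) + real (card abn)"
    unfolding card_cartesian_product of_nat_mult[symmetric] of_nat_add[symmetric] of_nat_le_iff .
  moreover have "real (card A) * real (card B1) \<le> 1001 / 1000 * real n * real (card B1)"
    using card_bounds(1) by (intro mult_right_mono) auto
  moreover have "0 \<le> real n ^ 2" by simp
  ultimately have "8 / 10 ^ 41 * real n ^ 2 \<le> 1001 / 1000 * real n * real (card B1)"
    using abn by (simp only: pow_simps; linarith)
  hence "real n * (8 / 10 ^ 41 * real n) \<le> real n * (1001 / 1000 * real (card B1))"
    by (simp add: power2_eq_square mult_ac)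
  hence "8 / 10 ^ 41 * real n \<le> 1001 / 1000 * real (card B1)" using n_pos(1) by (rule mult_left_le_imp_le)
  hence "7 / 10 ^ 41 * real n \<le> real (card B1)" using n_pos(1) by (simp only: pow_simps; linarith)
  thus ?thesis using row by (intro exI[of _ B1]) (auto simp: B1_def)
qed

text \<open>If no pair were covered twice, \<open>covered_rows\<close> would give linearly many rows
  filled by \<open>G1\<close> and, mirrored, linearly many columns filled by \<open>G2\<close>; most
  pairs of the rectangle they span would then be covered by both. A shared pair is what lets a path
  pass from the AAB triples of the link to the ABB triples.\<close>

lemma shared_pair:
  assumes v: "v \<in> Z" and F: "finite F" "real (card F) \<le> 1 / 10 ^ 100 * real n"
  shows "\<exists>G1 G2 a b. G1 \<subseteq> linkA v F \<and> G2 \<subseteq> linkB v F \<and> thick G1 \<and> thick G2 \<and> a \<in> A \<and> b \<in> B \<and>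
    covers G1 {a, b} \<and> covers G2 {a, b}"
proof (rule ccontr)
  assume none: "\<not> ?thesis"
  interpret sw: near_extremal V E n B A Z by (rule swapped)
  have three: "T \<subseteq> A \<union> B \<and> card T = 3" if "T \<in> linkA v F \<or> T \<in> linkB v F" for T
    using that by (auto simp: linkA_def linkB_def hset_def)
  have "\<exists>G1\<subseteq>linkA v F. thick G1 \<and> real (card (linkA v F - G1)) \<le> 50 * real n ^ 2"
    using three by (intro thick_subfamily[OF finite_link(1)]) simp
  then obtain G1 where G1: "G1 \<subseteq> linkA v F" "thick G1" "real (card (linkA v F - G1)) \<le> 50 * real n ^ 2"
    by (elim exE conjE) (rule that)
  have "\<exists>G2\<subseteq>linkB v F. thick G2 \<and> real (card (linkB v F - G2)) \<le> 50 * real n ^ 2"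
    using three by (intro thick_subfamily[OF finite_link(2)]) simp
  then obtain G2 where G2: "G2 \<subseteq> linkB v F" "thick G2" "real (card (linkB v F - G2)) \<le> 50 * real n ^ 2"
    by (elim exE conjE) (rule that)
  have fin: "finite G1" "finite G2" using G1(2) G2(2) by (auto simp: thick_def)
  have no: "\<not> covers G2 {a, b}" if "a \<in> A" "b \<in> B" "covers G1 {a, b}" for a b
    using none G1(1,2) G2(1,2) that by blast
  have "10 ^ 80 \<le> real n" by (rule order_trans[OF _ n_real]) simp
  hence n80: "10 ^ 80 * real n ^ 2 \<le> real n ^ 3"
    unfolding power2_eq_square power3_eq_cube mult.assoc[symmetric] by (intro mult_right_mono) auto
  have "real (card (linkA v F)) \<le> real (card (linkA v F - G1)) + real (card G1)"
    "real (card (linkB v F)) \<le> real (card (linkB v F - G2)) + real (card G2)"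
    using finite_link fin card_Un_le[of "linkA v F - G1" G1] card_Un_le[of "linkB v F - G2" G2]
      card_mono[of "linkA v F - G1 \<union> G1" "linkA v F"] card_mono[of "linkB v F - G2 \<union> G2" "linkB v F"] by auto
  hence big: "9 / 10 ^ 41 * real n ^ 3 \<le> real (card G1)" "9 / 10 ^ 41 * real n ^ 3 \<le> real (card G2)"
    using G1(3) G2(3) card_linkA[OF v F] card_linkB[OF v F] n80 by (simp_all only: pow_simps; linarith)+
  define bad where "bad = {(x, y, z). x \<in> A \<union> B \<and> y \<in> A \<union> B \<and> z \<in> A \<union> B \<and> x \<noteq> y \<and> y \<noteq> z \<and> x \<noteq> z \<and>
    \<not> (h3 x y z \<and> x \<notin> F \<and> y \<notin> F \<and> z \<notin> F)}"
  define K where "K = (linkA v F - G1) \<union> (linkB v F - G2)"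
  define L where "L = {(a, b, c). a \<in> A \<and> b \<in> B \<and> c \<in> A \<union> B \<and> {v, a, b, c} \<in> E \<and> {a, b, c} \<notin> G1 \<union> G2}"
  have finbad: "finite bad" unfolding bad_def by (rule finite_subset[of _ "(A \<union> B) \<times> (A \<union> B) \<times> (A \<union> B)"]) auto
  have finK: "finite K" unfolding K_def using finite_link by blast
  have "finite {(a, b, c). {a, b, c} \<in> K}"
  proof (rule finite_subset)
    show "{(a, b, c). {a, b, c} \<in> K} \<subseteq> (A \<union> B) \<times> (A \<union> B) \<times> (A \<union> B)" using three by (fastforce simp: K_def)
  qed simp
  note finT = this
  have "L \<subseteq> bad \<union> {(a, b, c). {a, b, c} \<in> K}"
  proof
    fix s assume "s \<in> L"
    then obtain a b c where s: "s = (a, b, c)" and m: "a \<in> A" "b \<in> B" "c \<in> A \<union> B" "{v, a, b, c} \<in> E"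
      "{a, b, c} \<notin> G1 \<union> G2" by (auto simp: L_def)
    have d: "distinct [v, a, b, c]" by (rule edge_distinct[OF m(4)])
    show "s \<in> bad \<union> {(a, b, c). {a, b, c} \<in> K}"
    proof (cases "h3 a b c \<and> a \<notin> F \<and> b \<notin> F \<and> c \<notin> F")
      case True
      have h: "hset {a, b, c}" using True hset_iff by blast
      have "{a, b, c} \<in> linkA v F \<union> linkB v F"
      proof (cases "c \<in> A")
        case cA: True
        have "card ({a, b, c} \<inter> A) = 2" using m(1) cA d not_mem(2)[OF m(2)] by (simp add: Int_insert_left)
        thus ?thesis using h True m(4) by (simp add: linkA_def)
      next
        case False
        hence "c \<in> B" using m(3) by blast
        hence "card ({a, b, c} \<inter> B) = 2" using m(2) d not_mem(1)[OF m(1)] by (simp add: Int_insert_left)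
        thus ?thesis using h True m(4) by (simp add: linkB_def)
      qed
      thus ?thesis using m(5) unfolding s K_def by blast
    next
      case False
      thus ?thesis using m d unfolding s by (simp add: bad_def)
    qed
  qed
  hence "card L \<le> card (bad \<union> {(a, b, c). {a, b, c} \<in> K})" using finbad finT by (intro card_mono) auto
  also have "\<dots> \<le> card bad + card {(a, b, c). {a, b, c} \<in> K}" by (rule card_Un_le)
  also have "\<dots> \<le> card bad + 27 * card K"
    using three by (intro add_left_mono card_transversals_le[OF finK]) (auto simp: K_def)
  also have "\<dots> \<le> card bad + 27 * (card (linkA v F - G1) + card (linkB v F - G2))"
    unfolding K_def by (intro add_left_mono mult_left_mono card_Un_le) simp
  finally have "real (card L) \<le> real (card bad + 27 * (card (linkA v F - G1) + card (linkB v F - G2)))"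
    by (simp only: of_nat_le_iff)
  hence Lle: "real (card L) \<le> real (card bad) + 27 * real (card (linkA v F - G1)) + 27 * real (card (linkB v F - G2))"
    by simp
  have lost: "real (card L) \<le> 1 / 10 ^ 88 * real n ^ 3"
  proof -
    have "10 ^ 95 \<le> real n" by (rule order_trans[OF _ n_real]) simp
    hence n95: "10 ^ 95 * real n ^ 2 \<le> real n ^ 3"
      unfolding power2_eq_square power3_eq_cube mult.assoc[symmetric] by (intro mult_right_mono) auto
    show ?thesis using Lle G1(3) G2(3) few_not_h3[OF F, folded bad_def] n95 zero_le_power2[of "real n"]
      by (simp only: pow_simps; linarith)
  qed
  have "\<exists>B1\<subseteq>B. 7 / 10 ^ 41 * real n \<le> real (card B1) \<and>
    (\<forall>b\<in>B1. real (card {a \<in> A. \<not> covers G1 {a, b}}) \<le> 3 / 10 ^ 44 * real n)"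
    using v fin(1) _ big(1) lost[unfolded L_def] no
  proof (rule covered_rows)
    show "T \<subseteq> A \<union> B \<and> card T = 3 \<and> card (T \<inter> A) = 2" if "T \<in> G1" for T
    proof -
      have "T \<in> linkA v F" using that G1(1) by blast
      thus ?thesis by (simp add: linkA_def hset_def)
    qed
  qed
  then obtain B1 where B1: "B1 \<subseteq> B" "7 / 10 ^ 41 * real n \<le> real (card B1)"
    "\<And>b. b \<in> B1 \<Longrightarrow> real (card {a \<in> A. \<not> covers G1 {a, b}}) \<le> 3 / 10 ^ 44 * real n" by blast
  have "\<exists>A2\<subseteq>A. 7 / 10 ^ 41 * real n \<le> real (card A2) \<and>
    (\<forall>a\<in>A2. real (card {b \<in> B. \<not> covers G2 {b, a}}) \<le> 3 / 10 ^ 44 * real n)"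
    using v fin(2) _ big(2)
  proof (rule sw.covered_rows)
    show "T \<subseteq> B \<union> A \<and> card T = 3 \<and> card (T \<inter> B) = 2" if "T \<in> G2" for T
    proof -
      have "T \<in> linkB v F" using that G2(1) by blast
      thus ?thesis by (auto simp: linkB_def hset_def)
    qed
    let ?L' = "{(b, a, c). b \<in> B \<and> a \<in> A \<and> c \<in> B \<union> A \<and> {v, b, a, c} \<in> E \<and> {b, a, c} \<notin> G2 \<union> G1}"
    have finL: "finite L" unfolding L_def by (rule finite_subset[of _ "A \<times> B \<times> (A \<union> B)"]) auto
    have c: "{v, b, a, c} = {v, a, b, c}" "{b, a, c} = {a, b, c}" for a b c :: 'a by auto
    have "card ?L' \<le> card L"
    proof (rule card_inj_on_le[of "\<lambda>(b, a, c). (a, b, c)"])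
      show "(\<lambda>(b, a, c). (a, b, c)) ` ?L' \<subseteq> L"
      proof (rule image_subsetI)
        fix s assume s: "s \<in> ?L'"
        obtain b a c where bac: "s = (b, a, c)" by (metis surj_pair)
        show "(\<lambda>(b, a, c). (a, b, c)) s \<in> L"
          using s c(1)[of b a c] c(2)[of b a c] unfolding bac L_def by auto
      qed
    qed (auto simp: inj_on_def intro: finL)
    thus "real (card ?L') \<le> 1 / 10 ^ 88 * real n ^ 3" using lost by linarith
    show "\<not> covers G1 {b, a}" if "b \<in> B" "a \<in> A" "covers G2 {b, a}" for b a
      using that no[of a b] by (auto simp: insert_commute)
  qed
  then obtain A2 where A2: "A2 \<subseteq> A" "7 / 10 ^ 41 * real n \<le> real (card A2)"
    "\<And>a. a \<in> A2 \<Longrightarrow> real (card {b \<in> B. \<not> covers G2 {b, a}}) \<le> 3 / 10 ^ 44 * real n" by blast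
  have finAB: "finite A2" "finite B1" using finite_subset[OF A2(1)] finite_subset[OF B1(1)] by simp_all
  let ?X = "Sigma B1 (\<lambda>b. {a \<in> A. \<not> covers G1 {a, b}})" and ?Y = "Sigma A2 (\<lambda>a. {b \<in> B. \<not> covers G2 {b, a}})"
  have X: "real (card ?X) \<le> 3 / 10 ^ 44 * real n * real (card B1)" using B1(3) finAB by (intro card_Sigma_le) auto
  have Y: "real (card ?Y) \<le> 3 / 10 ^ 44 * real n * real (card A2)" using A2(3) finAB by (intro card_Sigma_le) auto
  have "B1 \<times> A2 \<subseteq> ?X \<union> prod.swap ` ?Y"
  proof
    fix s assume "s \<in> B1 \<times> A2"
    then obtain b a where s: "s = (b, a)" "b \<in> B1" "a \<in> A2" by auto
    hence m: "a \<in> A" "b \<in> B" using A2(1) B1(1) by auto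
    show "s \<in> ?X \<union> prod.swap ` ?Y"
    proof (cases "covers G1 {a, b}")
      case True
      hence "\<not> covers G2 {b, a}" using no[OF m] by (simp add: insert_commute)
      hence "(a, b) \<in> ?Y" using s m by simp
      thus ?thesis unfolding s(1) by force
    qed (use s m in simp)
  qed
  moreover have finXY: "finite ?X" "finite ?Y" using finAB by auto
  ultimately have "card (B1 \<times> A2) \<le> card (?X \<union> prod.swap ` ?Y)" by (intro card_mono) auto
  also have "\<dots> \<le> card ?X + card (prod.swap ` ?Y)" by (rule card_Un_le)
  also have "\<dots> \<le> card ?X + card ?Y" using finXY by (intro add_left_mono card_image_le)
  finally have "real (card B1) * real (card A2) \<le> real (card ?X) + real (card ?Y)"
    unfolding card_cartesian_product of_nat_mult[symmetric] of_nat_add[symmetric] of_nat_le_iff .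
  hence le: "real (card B1) * real (card A2) \<le> 3 / 10 ^ 44 * real n * real (card B1) + 3 / 10 ^ 44 * real n * real (card A2)"
    using X Y by linarith
  define \<beta> \<alpha> \<nu> where "\<beta> = real (card B1)" and "\<alpha> = real (card A2)" and "\<nu> = 3 / 10 ^ 44 * real n"
  have small: "0 < \<nu>" "2 * \<nu> < \<alpha>" "2 * \<nu> < \<beta>" using A2(2) B1(2) n_pos(1) unfolding \<alpha>_def \<beta>_def \<nu>_def
    by (simp_all only: pow_simps)
  have "2 * \<nu> * \<beta> < \<alpha> * \<beta>" "2 * \<nu> * \<alpha> < \<beta> * \<alpha>" using small by (intro mult_strict_right_mono; linarith)+
  moreover have "\<beta> * \<alpha> \<le> \<nu> * \<beta> + \<nu> * \<alpha>" using le by (simp only: \<alpha>_def \<beta>_def \<nu>_def)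
  ultimately show False by (simp add: mult.commute)
qed

section \<open>Routing paths through an exceptional vertex\<close>

lemma link_triple:
  assumes "{x, y, z} \<in> linkA v F \<or> {x, y, z} \<in> linkB v F"
  shows "h3 x y z" "{v, x, y, z} \<in> E" "x \<notin> F" "y \<notin> F" "z \<notin> F"
  using assms hset_iff[of x y z] by (auto simp: linkA_def linkB_def)

lemma linkA_third:
  assumes T: "{x, y, z} \<in> linkA v F"
  shows "x \<in> A \<Longrightarrow> y \<in> A \<Longrightarrow> z \<in> B" "x \<in> A \<Longrightarrow> y \<in> B \<Longrightarrow> z \<in> A" "x \<in> B \<Longrightarrow> y \<in> A \<Longrightarrow> z \<in> A"
proof -
  have h: "h3 x y z" using T link_triple(1)[of x y z v F] by blast
  hence d: "x \<noteq> y" "y \<noteq> z" "x \<noteq> z" "z \<in> A \<union> B" by (auto simp: h3_def)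
  have c: "card ({x, y, z} \<inter> A) = 2" using T by (simp add: linkA_def)
  show "z \<in> B" if "x \<in> A" "y \<in> A"
  proof (rule ccontr)
    assume "z \<notin> B"
    hence "z \<in> A" using d(4) by blast
    thus False using c d that by (simp add: Int_insert_left)
  qed
  show "z \<in> A" if "x \<in> A" "y \<in> B"
    using c d that not_mem(2)[of y] by (cases "z \<in> A") (simp_all add: Int_insert_left)
  show "z \<in> A" if "x \<in> B" "y \<in> A"
    using c d that not_mem(2)[of x] by (cases "z \<in> A") (simp_all add: Int_insert_left)
qed

lemma linkB_third:
  assumes T: "{x, y, z} \<in> linkB v F"
  shows "x \<in> B \<Longrightarrow> y \<in> B \<Longrightarrow> z \<in> A" "x \<in> B \<Longrightarrow> y \<in> A \<Longrightarrow> z \<in> B" "x \<in> A \<Longrightarrow> y \<in> B \<Longrightarrow> z \<in> B"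
proof -
  interpret sw: near_extremal V E n B A Z by (rule swapped)
  show "x \<in> B \<Longrightarrow> y \<in> B \<Longrightarrow> z \<in> A" "x \<in> B \<Longrightarrow> y \<in> A \<Longrightarrow> z \<in> B" "x \<in> A \<Longrightarrow> y \<in> B \<Longrightarrow> z \<in> B"
    using sw.linkA_third[of x y z v F] T by (simp_all add: swap_link)
qed

lemma link_step:
  assumes G: "thick G" "covers G {y, z}" "y \<noteq> z" and U: "length U \<le> 10"
  shows "\<exists>w. w \<notin> set U \<and> {y, z, w} \<in> G"
  using thick_extend[OF G, of "set U"] card_length[of U] U by fastforce

text \<open>Every window contains v, so what is needed is a path of triples u1 u2 u3, u2 u3 u4, u3
  u4 u5, u4 u5 u6 in the link of v.\<close>

lemma piece_around:
  assumes h: "h3 u1 u2 u3" "h3 u4 u5 u6" and v: "v \<in> Z" and d: "distinct [u1, u2, u3, u4, u5, u6]"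
    and e: "{v, u1, u2, u3} \<in> E" "{v, u2, u3, u4} \<in> E" "{v, u3, u4, u5} \<in> E" "{v, u4, u5, u6} \<in> E"
  shows "piece [u1, u2, u3, v, u4, u5, u6]"
proof -
  have "{u1, u2, u3, v} = {v, u1, u2, u3}" "{u2, u3, v, u4} = {v, u2, u3, u4}" "{u3, v, u4, u5} = {v, u3, u4, u5}"
    by auto
  hence "tight_path E [u1, u2, u3, v, u4, u5, u6]" using e by simp
  moreover have m: "u1 \<in> A \<union> B" "u2 \<in> A \<union> B" "u3 \<in> A \<union> B" "u4 \<in> A \<union> B" "u5 \<in> A \<union> B" "u6 \<in> A \<union> B"
    using h by (auto simp: h3_def)
  hence "{u1, u2, u3, u4, u5, u6} \<subseteq> A \<union> B" by blast
  hence "{u1, u2, u3, u4, u5, u6} \<subseteq> V" "v \<in> V" "v \<notin> {u1, u2, u3, u4, u5, u6}"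
    using v V_eq disj(2,3) by blast+
  ultimately show ?thesis using d unfolding piece_def by (simp; blast)
qed

text \<open>The pattern switches at the shared pair {a, b}, from triples of \<open>G1\<close> to
  triples of \<open>G2\<close>. The order of a and b, and the side on which the extra steps are
  made, give four cores; the resulting weights 25, 29, 23, 19 are 1, 5, 7, 3 modulo 8, all odd
  residues.\<close>

lemma crossing_around:
  assumes v: "v \<in> Z" "v \<notin> F" and F: "finite F" "real (card F) \<le> 1 / 10 ^ 100 * real n"
    and w: "w \<in> {25, 29, 23, 19}"
  shows "\<exists>P. crossing F w P \<and> v \<in> set P"
proof -
  obtain G1 G2 a b where G: "G1 \<subseteq> linkA v F" "G2 \<subseteq> linkB v F" "thick G1" "thick G2" and m: "a \<in> A" "b \<in> B"
    and cov: "covers G1 {a, b}" "covers G2 {a, b}" using shared_pair[OF v(1) F] by blast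
  have ab: "a \<noteq> b" "a \<notin> B" "b \<notin> A" using m not_mem by blast+
  have L1: "h3 x y z" "{v, x, y, z} \<in> E" "x \<notin> F" "y \<notin> F" "z \<notin> F" "x \<noteq> y" "y \<noteq> z" "x \<noteq> z"
    if "{x, y, z} \<in> G1 \<or> {x, y, z} \<in> G2" for x y z
    using link_triple[of x y z v F] that G(1,2) unfolding h3_def by blast+
  obtain y where y: "{a, b, y} \<in> G1" using link_step[OF G(3) cov(1) ab(1), of "[]"] by auto
  have yA: "y \<in> A" using linkA_third(2)[of a b y v F] y G(1) m by blast
  obtain z where z: "{a, b, z} \<in> G2" using link_step[OF G(4) cov(2) ab(1), of "[]"] by auto
  have zB: "z \<in> B" using linkB_third(3)[of a b z v F] z G(2) m by blast
  note dy = L1(6-8)[OF disjI1[OF y]] and dz = L1(6-8)[OF disjI2[OF z]]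
  have yz: "y \<noteq> z" using yA zB not_mem by blast
  have F': "real (card F) \<le> 1 / 5 * real n" using F(2) n_pos(1) by (simp only: pow_simps; linarith)
  \<comment> \<open>The first three of u1, ..., u6 have two vertices in \<open>A\<close>, the last
    three have two in \<open>B\<close>, and v weighs 0. So every core weighs 7 + 11 = 18, and the
    cores differ in the weights needed to complete them.\<close>
  have final: "\<exists>P. crossing F (wl + 18 + wr) P \<and> v \<in> set P"
    if d: "distinct [u1, u2, u3, u4, u5, u6]"
    and T: "{u1, u2, u3} \<in> G1 \<union> G2" "{u2, u3, u4} \<in> G1 \<union> G2" "{u3, u4, u5} \<in> G1 \<union> G2" "{u4, u5, u6} \<in> G1 \<union> G2"
    and left: "u1 \<in> A \<and> u2 \<in> A \<and> u3 \<in> B \<and> wl = 7 \<or> u1 \<in> B \<and> u2 \<in> A \<and> u3 \<in> A \<and> wl = 1 \<or>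
      u1 \<in> A \<and> u2 \<in> B \<and> u3 \<in> A \<and> wl = 0"
    and right: "u4 \<in> A \<and> u5 \<in> B \<and> u6 \<in> B \<and> wr = 11 \<or> u4 \<in> B \<and> u5 \<in> B \<and> u6 \<in> A \<and> wr = 5 \<or>
      u4 \<in> B \<and> u5 \<in> A \<and> u6 \<in> B \<and> wr = 0"
    for u1 u2 u3 u4 u5 u6 wl wr
  proof -
    let ?K = "[u1, u2, u3, v, u4, u5, u6]"
    have T': "{u1, u2, u3} \<in> G1 \<or> {u1, u2, u3} \<in> G2" "{u2, u3, u4} \<in> G1 \<or> {u2, u3, u4} \<in> G2"
      "{u3, u4, u5} \<in> G1 \<or> {u3, u4, u5} \<in> G2" "{u4, u5, u6} \<in> G1 \<or> {u4, u5, u6} \<in> G2" using T by blast+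
    have h: "h3 u1 u2 u3" "h3 u4 u5 u6" using L1(1)[OF T'(1)] L1(1)[OF T'(4)] .
    have K: "piece ?K"
      by (rule piece_around[OF h v(1) d L1(2)[OF T'(1)] L1(2)[OF T'(2)] L1(2)[OF T'(3)] L1(2)[OF T'(4)]])
    have KF: "set ?K \<inter> F = {}" using L1(3-5)[OF T'(1)] L1(3-5)[OF T'(4)] v(2) by simp
    have "\<exists>P. crossing F (wl + wt ?K + wr) P \<and> set ?K \<subseteq> set P"
    proof (rule crossing_extending_core[OF K refl _ h _ F(1) F' KF])
      show "?K = [u1, u2, u3, v] @ [u4, u5, u6]" by simp
      show "length ?K \<le> 14" by simp
    qed (use left right in blast)+
    then obtain P where P: "crossing F (wl + wt ?K + wr) P" "set ?K \<subseteq> set P" by blast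
    have w: "wt [u1, u2, u3] = 7" "wt [u4, u5, u6] = 11" using left right not_mem(2) by auto
    have "wt ?K = wt [u1, u2, u3] + wt [u4, u5, u6]" using not_mem(3,4)[OF v(1)] by simp
    hence "wt ?K = 18" unfolding w by simp
    hence "crossing F (wl + 18 + wr) P" using P(1) by (simp only:)
    moreover have "v \<in> set P" using P(2) by simp
    ultimately show ?thesis by blast
  qed
  have T0: "{y, a, b} \<in> G1" "{y, b, a} \<in> G1" "{a, b, z} \<in> G2" "{b, a, z} \<in> G2"
    using y z by (simp_all add: insert_commute)
  consider "w = 25" | "w = 29" | "w = 23" | "w = 19" using w by auto
  thus ?thesis
  proof cases
    case 1
    have "covers G2 {b, z}" by (rule coversI[OF z]) simp
    then obtain s where s: "s \<notin> set [y, a, b, z]" "{b, z, s} \<in> G2" using link_step[OF G(4) _ dz(2), of "[y, a, b, z]"] by auto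
    have sA: "s \<in> A" using linkB_third(1)[of b z s v F] s(2) G(2) m(2) zB by blast
    have zs: "z \<noteq> s" using s(1) by auto
    have "covers G2 {z, s}" by (rule coversI[OF s(2)]) simp
    then obtain t where t: "t \<notin> set [y, a, b, z, s]" "{z, s, t} \<in> G2" using link_step[OF G(4) _ zs, of "[y, a, b, z, s]"] by auto
    have tB: "t \<in> B" using linkB_third(2)[of z s t v F] t(2) G(2) zB sA by blast
    have "\<exists>P. crossing F (7 + 18 + 0) P \<and> v \<in> set P"
      by (rule final[of y a b z s t]) (use T0 s t sA tB m yA zB ab dy dz yz in auto)
    thus ?thesis using 1 by simp
  next
    case 2
    have ya: "y \<noteq> a" using dy by simp
    have "covers G1 {y, a}" by (rule coversI[OF y]) simp
    then obtain s where s: "s \<notin> set [y, a, b, z]" "{y, a, s} \<in> G1" using link_step[OF G(3) _ ya, of "[y, a, b, z]"] by auto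
    have sB: "s \<in> B" using linkA_third(1)[of y a s v F] s(2) G(1) m(1) yA by blast
    have sy: "s \<noteq> y" using s(1) by auto
    have "covers G1 {s, y}" by (rule coversI[OF s(2)]) simp
    then obtain t where t: "t \<notin> set [y, a, b, z, s]" "{s, y, t} \<in> G1" using link_step[OF G(3) _ sy, of "[y, a, b, z, s]"] by auto
    have tA: "t \<in> A" using linkA_third(3)[of s y t v F] t(2) G(1) sB yA by blast
    have "{t, s, y} \<in> G1" "{s, y, a} \<in> G1" using s(2) t(2) by (simp_all add: insert_commute)
    hence "\<exists>P. crossing F (0 + 18 + 11) P \<and> v \<in> set P"
      by (intro final[of t s y a b z]) (use T0 s t sB tA m yA zB ab dy dz yz in auto)
    thus ?thesis using 2 by simp
  next
    case 3
    have "covers G2 {a, z}" by (rule coversI[OF z]) simp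
    then obtain s where s: "s \<notin> set [y, a, b, z]" "{a, z, s} \<in> G2" using link_step[OF G(4) _ dz(3), of "[y, a, b, z]"] by auto
    have sB: "s \<in> B" using linkB_third(3)[of a z s v F] s(2) G(2) m(1) zB by blast
    have zs: "z \<noteq> s" using s(1) by auto
    have "covers G2 {z, s}" by (rule coversI[OF s(2)]) simp
    then obtain t where t: "t \<notin> set [y, a, b, z, s]" "{z, s, t} \<in> G2" using link_step[OF G(4) _ zs, of "[y, a, b, z, s]"] by auto
    have tA: "t \<in> A" using linkB_third(1)[of z s t v F] t(2) G(2) zB sB by blast
    have "\<exists>P. crossing F (0 + 18 + 5) P \<and> v \<in> set P"
      by (rule final[of y b a z s t]) (use T0 s t sB tA m yA zB ab dy dz yz in auto)
    thus ?thesis using 3 by simp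
  next
    case 4
    have yb: "y \<noteq> b" using dy by simp
    have "covers G1 {y, b}" by (rule coversI[OF y]) simp
    then obtain s where s: "s \<notin> set [y, a, b, z]" "{y, b, s} \<in> G1" using link_step[OF G(3) _ yb, of "[y, a, b, z]"] by auto
    have sA: "s \<in> A" using linkA_third(2)[of y b s v F] s(2) G(1) m(2) yA by blast
    have sy: "s \<noteq> y" using s(1) by auto
    have "covers G1 {s, y}" by (rule coversI[OF s(2)]) simp
    then obtain t where t: "t \<notin> set [y, a, b, z, s]" "{s, y, t} \<in> G1" using link_step[OF G(3) _ sy, of "[y, a, b, z, s]"] by auto
    have tB: "t \<in> B" using linkA_third(1)[of s y t v F] t(2) G(1) sA yA by blast
    have "{t, s, y} \<in> G1" "{s, y, b} \<in> G1" using s(2) t(2) by (simp_all add: insert_commute)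
    hence "\<exists>P. crossing F (1 + 18 + 0) P \<and> v \<in> set P"
      by (intro final[of t s y b a z]) (use T0 s t sA tB m yA zB ab dy dz yz in auto)
    thus ?thesis using 4 by simp
  qed
qed

text \<open>Staying with AAB triples on both sides of v gives A B A v A B A, which starts and ends
  in the A pattern. With such detours exceptional vertices are collected one at a time.\<close>

lemma detour_around:
  assumes v: "v \<in> Z" "v \<notin> F" and F: "finite F" "real (card F) \<le> 1 / 10 ^ 100 * real n"
  shows "\<exists>P. detour F P \<and> v \<in> set P"
proof -
  obtain G1 a b where G: "G1 \<subseteq> linkA v F" "thick G1" and m: "a \<in> A" "b \<in> B"
    and cov: "covers G1 {a, b}" using shared_pair[OF v(1) F] by blast
  have ab: "a \<noteq> b" using m not_mem by blast
  have L: "h3 x y z" "{v, x, y, z} \<in> E" "x \<notin> F" "y \<notin> F" "z \<notin> F" "x \<noteq> y" "y \<noteq> z" "x \<noteq> z" if "{x, y, z} \<in> G1" for x y z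
    using link_triple[of x y z v F] that G(1) unfolding h3_def by blast+
  obtain c where c: "{a, b, c} \<in> G1" using link_step[OF G(2) cov ab, of "[]"] by auto
  have cA: "c \<in> A" using linkA_third(2)[of a b c v F] c G(1) m by blast
  note dc = L(6-8)[OF c]
  have "covers G1 {b, c}" by (rule coversI[OF c]) simp
  then obtain p where p: "p \<notin> set [a, b, c]" "{b, c, p} \<in> G1" using link_step[OF G(2) _ dc(2), of "[a, b, c]"] by auto
  have pA: "p \<in> A" using linkA_third(3)[of b c p v F] p(2) G(1) m(2) cA by blast
  have cp: "c \<noteq> p" using p(1) by auto
  have "covers G1 {c, p}" by (rule coversI[OF p(2)]) simp
  then obtain q where q: "q \<notin> set [a, b, c, p]" "{c, p, q} \<in> G1" using link_step[OF G(2) _ cp, of "[a, b, c, p]"] by auto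
  have qB: "q \<in> B" using linkA_third(1)[of c p q v F] q(2) G(1) pA cA by blast
  have pq: "p \<noteq> q" using q(1) by auto
  have "covers G1 {p, q}" by (rule coversI[OF q(2)]) simp
  then obtain r where r: "r \<notin> set [a, b, c, p, q]" "{p, q, r} \<in> G1" using link_step[OF G(2) _ pq, of "[a, b, c, p, q]"] by auto
  have rA: "r \<in> A" using linkA_third(2)[of p q r v F] r(2) G(1) pA qB by blast
  let ?K = "[a, b, c, v, p, q, r]"
  have K: "piece ?K"
    using dc p(1) q(1) r(1) by (intro piece_around L(1)[OF c] L(1)[OF r(2)] v(1) L(2)[OF c] L(2)[OF p(2)] L(2)[OF q(2)] L(2)[OF r(2)]) auto
  moreover have "starts A B ?K" unfolding starts_def using m cA L(1)[OF c]
    by (intro exI[of _ a] exI[of _ b] exI[of _ c] exI[of _ "[v, p, q, r]"]) simp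
  moreover have "ends A B ?K" unfolding ends_def using pA qB rA L(1)[OF r(2)]
    by (intro exI[of _ p] exI[of _ q] exI[of _ r] exI[of _ "[a, b, c, v]"]) simp
  moreover have "set ?K \<inter> F = {}" using L(3-5)[OF c] L(3-5)[OF r(2)] v(2) by simp
  moreover have "wt ?K = 14" using m cA pA qB rA not_mem(2) not_mem(3,4)[OF v(1)] by simp
  ultimately have "detour F ?K" unfolding detour_def by simp
  thus ?thesis by (intro exI[of _ ?K]) simp
qed

end

section \<open>Adjusting the weight modulo 8\<close>

text \<open>\<open>k\<close> is the residue of t - r - 6, written as t + 7 r + 2 to avoid
  subtraction of natural numbers.\<close>

lemma residue_mod_8:
  fixes r t :: nat
  defines "k \<equiv> (t + 7 * r + 2) mod 8"
  shows "w mod 8 = k \<Longrightarrow> (w + r + 6) mod 8 = t mod 8" "even k \<longleftrightarrow> even (r + t)" "k < 8"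
proof -
  show "even k \<longleftrightarrow> even (r + t)" by (auto simp: k_def dvd_mod_iff)
  show "k < 8" by (simp add: k_def)
  show "(w + r + 6) mod 8 = t mod 8" if "w mod 8 = k"
  proof -
    have "(w + r + 6) mod 8 = (k + (r + 6)) mod 8" using that by (metis add.assoc mod_add_left_eq)
    also have "\<dots> = ((t + 7 * r + 2) + (r + 6)) mod 8" unfolding k_def by (rule mod_add_left_eq)
    also have "(t + 7 * r + 2) + (r + 6) = t + 8 * (r + 1)" by simp
    also have "\<dots> mod 8 = t mod 8" by (rule mod_mult_self2)
    finally show ?thesis .
  qed
qed
lemma odd_residue:
  fixes r t :: nat
  assumes "odd (r + t)"
  shows "\<exists>w\<in>{25, 29, 23, 19}. (w + r + 6) mod 8 = t mod 8"
proof -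
  define k where "k = (t + 7 * r + 2) mod 8"
  have "odd k" "k < 8" using residue_mod_8(2,3)[of t r] assms by (simp_all add: k_def)
  hence k: "k = 1 \<or> k = 3 \<or> k = 5 \<or> k = 7" by presburger
  have *: "w mod 8 = k \<Longrightarrow> (w + r + 6) mod 8 = t mod 8" for w unfolding k_def by (rule residue_mod_8(1))
  show ?thesis using k *[of 25] *[of 29] *[of 23] *[of 19] by auto
qed

text \<open>For the second claim, 23 is -1 modulo 8, so m = 0, 2, 4, 6 detours produce the residues
  0, 6, 4, 2.\<close>

lemma even_residue:
  fixes r t :: nat
  assumes "even (r + t)"
  shows "\<exists>w\<in>{36, 30, 42, 24}. (w + r + 6) mod 8 = t mod 8" "\<exists>m\<le>6. (23 * m + r + 6) mod 8 = t mod 8"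
proof -
  define k where "k = (t + 7 * r + 2) mod 8"
  have "even k" "k < 8" using residue_mod_8(2,3)[of t r] assms by (simp_all add: k_def)
  hence k: "k = 0 \<or> k = 2 \<or> k = 4 \<or> k = 6" by presburger
  have *: "w mod 8 = k \<Longrightarrow> (w + r + 6) mod 8 = t mod 8" for w unfolding k_def by (rule residue_mod_8(1))
  show "\<exists>w\<in>{36, 30, 42, 24}. (w + r + 6) mod 8 = t mod 8" using k *[of 36] *[of 30] *[of 42] *[of 24] by auto
  have "\<exists>m\<in>{0, 2, 4, 6}. (23 * m) mod 8 = k" using k by auto
  then obtain m where "m \<in> {0, 2, 4, 6}" "(23 * m) mod 8 = k" by blast
  moreover from this(1) have "m \<le> 6" by auto
  ultimately show "\<exists>m\<le>6. (23 * m + r + 6) mod 8 = t mod 8" using * by blast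
qed

context near_extremal begin

text \<open>Both pieces are given as crossings from A to B, and the second is traversed backwards.
  The 6 is the residue that \<open>hamiltonian_of_pieces\<close> demands of the uncovered
  vertices.\<close>

lemma hamiltonian_of_crossings:
  assumes S1: "piece S1" "starts A B S1" "ends B A S1" and S2: "piece S2" "starts A B S2" "ends B A S2"
    and d: "set S1 \<inter> set S2 = {}" and Z: "Z \<subseteq> set S1 \<union> set S2"
    and len: "real (length S1 + length S2) \<le> 1 / 50 * real n"
    and cong: "(wt S1 + wt S2 + 6) mod 8 = (card A + 5 * card B) mod 8"
  shows "has_hamiltonian_cycle V E"
proof (rule hamiltonian_of_pieces)
  let ?U = "set S1 \<union> set (rev S2)"
  have "card ?U \<le> length S1 + length S2"
    using card_Un_le[of "set S1" "set (rev S2)"] card_length[of S1] card_length[of S2] by simp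
  thus "real (card ?U) \<le> 1 / 50 * real n" using len by linarith
  have split: "card X = card (X - ?U) + card (set S1 \<inter> X) + card (set S2 \<inter> X)" if "finite X" for X
  proof -
    have "X = (X - ?U) \<union> (set S1 \<inter> X \<union> set S2 \<inter> X)" by auto
    moreover have "(X - ?U) \<inter> (set S1 \<inter> X \<union> set S2 \<inter> X) = {}" by auto
    ultimately have "card X = card (X - ?U) + card (set S1 \<inter> X \<union> set S2 \<inter> X)"
      using that by (metis List.finite_set card_Un_disjoint finite_Diff finite_Int finite_UnI)
    moreover have "card (set S1 \<inter> X \<union> set S2 \<inter> X) = card (set S1 \<inter> X) + card (set S2 \<inter> X)"
      using d by (intro card_Un_disjoint) auto
    ultimately show ?thesis by simp
  qed
  have "distinct S1" "distinct S2" using S1(1) S2(1) by (simp_all add: piece_def)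
  hence "card A + 5 * card B = (card (A - ?U) + 5 * card (B - ?U)) + (wt S1 + wt S2)"
    using split[of A] split[of B] by (simp add: wt_card)
  moreover have "(w + 6) mod 8 = r mod 8 \<Longrightarrow> r = q + w \<Longrightarrow> q mod 8 = 6" for w r q :: nat by presburger
  ultimately show "(card (A - ?U) + 5 * card (B - ?U)) mod 8 = 6" using cong by blast
  show "piece S1" "starts A B S1" "ends B A S1" using S1 by -
  show "piece (rev S2)" "starts B A (rev S2)" "ends A B (rev S2)"
    using S2 by (simp_all only: piece_rev starts_rev ends_rev)
  show "set S1 \<inter> set (rev S2) = {}" "Z \<subseteq> ?U" using d Z by simp_all
qed

lemma small_set:
  assumes "card F \<le> 1000"
  shows "real (card F) \<le> 1 / 10 ^ 100 * real n" "real (card F) \<le> 1 / 10 ^ 20 * real n"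
    "real (card F) \<le> 1 / 1000 * real n" "real (card F) \<le> 1 / 4 * real n"
proof -
  have "real (card F) \<le> 1000 * (1 / 10 ^ 200 * real n)" using assms one_le by linarith
  thus *: "real (card F) \<le> 1 / 10 ^ 100 * real n"
    using n_pos(1) by (simp only: pow_simps; linarith)
  thus "real (card F) \<le> 1 / 10 ^ 20 * real n"
    using n_pos(1) by (simp only: pow_simps; linarith)
  show "real (card F) \<le> 1 / 1000 * real n" "real (card F) \<le> 1 / 4 * real n"
    using * n_pos(1) by (simp_all only: pow_simps)
qed

text \<open>Either all pairs outside \<open>F\<close> are typical, and \<open>usable_exists\<close>
  finds an AABB edge, or a bad pair outside \<open>F\<close> gives the crossing directly. Both
  routes can produce weight 36.\<close>

lemma crossing_exists:
  assumes F: "finite F" "card F \<le> 1000" "Z \<subseteq> F" and Z: "card Z \<le> 1"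
  shows "\<exists>P. crossing F 36 P"
proof (cases "\<forall>a\<in>A - F. \<forall>b\<in>B - F. g2 a b")
  case True
  have "usable F" by (rule usable_exists[OF F Z]) (use True in blast)
  thus ?thesis by (rule crossing_of_usable[OF _ F(1) small_set(3)[OF F(2)]])
next
  case False
  then obtain a b where ab: "a \<in> A" "b \<in> B" "a \<notin> F" "b \<notin> F" "\<not> g2 a b" by blast
  show ?thesis by (rule crossing_of_bad_pair[OF ab(1,2,5) F(1) small_set(2)[OF F(2)] ab(3,4)]) simp
qed

lemma prepend_detour:
  assumes Q: "piece Q" "starts A B Q" "ends B A Q" and D: "detour F D" and F: "finite F" "set Q \<subseteq> F"
    "real (card F) + 20 \<le> 1 / 4 * real n"
  shows "\<exists>Q'. piece Q' \<and> starts A B Q' \<and> ends B A Q' \<and> set D \<union> set Q \<subseteq> set Q' \<and> set Q' \<inter> (F - set Q) = {} \<and>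
    length Q' \<le> length Q + 25 \<and> wt Q' = wt Q + 23"
proof -
  have D': "piece D" "starts A B D" "ends A B D" "set D \<inter> F = {}" "length D \<le> 20" "wt D = 14"
    using D by (simp_all add: detour_def)
  have "card (F \<union> set D) \<le> card F + 20" using card_Un_le[of F "set D"] card_length[of D] D'(5) by linarith
  hence c: "real (card (F \<union> set D)) \<le> 1 / 4 * real n" using F(3) by linarith
  have dj: "set D \<inter> set Q = {}" using D'(4) F(2) by blast
  obtain M where M: "piece (D @ M @ Q)" "set M \<inter> (F \<union> set D) = {}" "length M = 5" "wt M = 9"
    using join[OF D'(1,3) Q(1,2) dj _ c] F(1,2) by auto
  show ?thesis
  proof (intro exI[of _ "D @ M @ Q"] conjI)
    show "starts A B (D @ M @ Q)" by (rule starts_append[OF D'(2)])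
    show "ends B A (D @ M @ Q)" using ends_append[OF Q(3), of "D @ M"] by simp
    show "piece (D @ M @ Q)" by (rule M(1))
    show "set (D @ M @ Q) \<inter> (F - set Q) = {}" using M(2) D'(4) by auto
    show "length (D @ M @ Q) \<le> length Q + 25" "wt (D @ M @ Q) = wt Q + 23" using M(3,4) D'(5,6) by simp_all
  qed auto
qed

lemma prepend_detours:
  assumes P: "piece P" "starts A B P" "ends B A P" "set P \<inter> H = {}" "length P \<le> 20" and H: "finite H" "card H \<le> 20"
    and ex: "\<And>F. finite F \<Longrightarrow> card F \<le> 400 \<Longrightarrow> \<exists>D. detour F D" and m: "m \<le> 6"
  shows "\<exists>Q. piece Q \<and> starts A B Q \<and> ends B A Q \<and> set Q \<inter> H = {} \<and> length Q \<le> 20 + 25 * m \<and> wt Q = wt P + 23 * m"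
  using m
proof (induction m)
  case 0
  thus ?case using P by (intro exI[of _ P]) simp
next
  case (Suc m)
  then obtain Q where Q: "piece Q" "starts A B Q" "ends B A Q" "set Q \<inter> H = {}" "length Q \<le> 20 + 25 * m"
    "wt Q = wt P + 23 * m" by auto
  let ?F = "H \<union> set Q"
  have c: "card ?F \<le> 200"
    using card_Un_le[of H "set Q"] card_length[of Q] H(2) Q(5) Suc.prems by linarith
  then obtain D where D: "detour ?F D" using ex[of ?F] H(1) by auto
  have "real (card ?F) + 20 \<le> 1 / 4 * real n" using c one_le n_pos(1) by (simp only: pow_simps; linarith)
  then obtain Q' where "piece Q'" "starts A B Q'" "ends B A Q'" "set Q' \<inter> (?F - set Q) = {}"
    "length Q' \<le> length Q + 25" "wt Q' = wt Q + 23"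
    using prepend_detour[OF Q(1-3) D _ _] H(1) by auto
  moreover from this(4) have "set Q' \<inter> H = {}" using Q(4) by blast
  ultimately show ?case using Q(5,6) by (intro exI[of _ Q']) simp
qed

text \<open>\<open>H\<close> contains \<open>L\<close>: in each step one vertex of \<open>L\<close>
  is released from the avoided set and a detour around it is prepended, at the cost of weight 23 and
  at most 25 vertices.\<close>

lemma absorb:
  assumes P: "piece P" "starts A B P" "ends B A P" "set P \<inter> H = {}" "length P \<le> 20"
    and H: "finite H" "real (card H) \<le> 1 / 10 ^ 101 * real n" and L: "L \<subseteq> Z" "L \<subseteq> H"
  shows "\<exists>Q. piece Q \<and> starts A B Q \<and> ends B A Q \<and> set P \<union> L \<subseteq> set Q \<and> set Q \<inter> (H - L) = {} \<and>
    length Q \<le> 20 + 25 * card L \<and> wt Q = wt P + 23 * card L"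
proof -
  have "finite L" using L(1) fin(3) by (rule finite_subset)
  thus ?thesis using L
  proof (induction L rule: finite_induct)
    case empty
    thus ?case using P by (intro exI[of _ P]) simp
  next
    case (insert v L)
    then obtain Q where Q: "piece Q" "starts A B Q" "ends B A Q" "set P \<union> L \<subseteq> set Q" "set Q \<inter> (H - L) = {}"
      "length Q \<le> 20 + 25 * card L" "wt Q = wt P + 23 * card L" by auto
    have v: "v \<in> Z" "v \<in> H" "v \<notin> set Q" using insert.prems insert.hyps(2) Q(5) by auto
    let ?F = "(H - {v}) \<union> set Q"
    have "card ?F \<le> card H + length Q"
      using card_Un_le[of "H - {v}" "set Q"] card_length[of Q] card_mono[of H "H - {v}"] H(1) by fastforce
    moreover have "card L \<le> card Z" using insert.prems by (intro card_mono) auto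
    ultimately have "real (card ?F) + 20 \<le> real (card H) + 40 + 25 * real (card Z)" using Q(6) by linarith
    hence c: "real (card ?F) + 20 \<le> 1 / 10 ^ 100 * real n"
      using H(2) cardZ_le one_le by (simp only: pow_simps; linarith)
    obtain D where D: "detour ?F D" "v \<in> set D" using detour_around[of v ?F] v H(1) c by auto
    have "real (card ?F) + 20 \<le> 1 / 4 * real n" using c n_pos(1) by (simp only: pow_simps; linarith)
    then obtain Q' where Q': "piece Q'" "starts A B Q'" "ends B A Q'" "set D \<union> set Q \<subseteq> set Q'"
      "set Q' \<inter> (?F - set Q) = {}" "length Q' \<le> length Q + 25" "wt Q' = wt Q + 23"
      using prepend_detour[OF Q(1-3) D(1) _ _] H(1) by auto
    have "set Q' \<inter> (H - insert v L) = {}" using Q'(5) Q(5) by blast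
    moreover have "set P \<union> insert v L \<subseteq> set Q'" using Q'(4) Q(4) D(2) by blast
    ultimately show ?case using Q' Q(6,7) insert.hyps by (intro exI[of _ Q']) simp
  qed
qed

section \<open>Parity of the total weight and the final cases\<close>

lemma even_card_AB: "even (card A + 5 * card B + card Z)"
  using card_sum by presburger

text \<open>One exceptional vertex v is held in reserve. Crossings around it realise all odd
  residues, so the rest of the cycle only has to leave an odd residue.\<close>

lemma hamiltonian_flexible:
  assumes "Z \<noteq> {}"
  shows "has_hamiltonian_cycle V E"
proof -
  obtain v where v: "v \<in> Z" using assms by blast
  \<comment> \<open>A detour has odd weight 23 with its connection, so the number of exceptional
    vertices still to be absorbed enters the parity. If v is the only one,
    \<open>crossing_exists\<close> applies, as it allows |Z| = 1; otherwise a second exceptional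
    vertex v' supplies the crossing.\<close>
  have "\<exists>S w. crossing {v} w S \<and> odd (w + card (Z - {v} - set S) + card Z)"
  proof (cases "Z = {v}")
    case True
    then obtain S where "crossing {v} 36 S" using crossing_exists[of Z] by auto
    thus ?thesis using True by (intro exI[of _ S] exI[of _ 36]) simp
  next
    case False
    then obtain v' where v': "v' \<in> Z" "v' \<noteq> v" using v by blast
    have "card (Z - {v'}) \<le> card Z" by (rule card_mono) auto
    hence "real (card (Z - {v'})) \<le> 1 / 10 ^ 100 * real n"
      using cardZ_le n_pos(1) by (simp only: pow_simps; linarith)
    then obtain S where S: "crossing (Z - {v'}) 25 S" "v' \<in> set S"
      using crossing_around[of v' "Z - {v'}" 25] v' by auto
    have "Z - {v} - set S = Z - {v, v'}" "v \<notin> set S" using S v v' unfolding crossing_def by blast+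
    moreover have "card Z = card (Z - {v, v'}) + 2"
      using v v' card_Diff_subset[of "{v, v'}" Z] card_mono[of Z "{v, v'}"] by simp
    ultimately show ?thesis using S unfolding crossing_def by (intro exI[of _ S] exI[of _ 25]) simp
  qed
  then obtain S2 w2 where S2: "crossing {v} w2 S2" and par: "odd (w2 + card (Z - {v} - set S2) + card Z)" by blast
  let ?L = "Z - {v} - set S2" and ?H = "(Z - {v}) \<union> set S2"
  have "odd (w + l + z) \<Longrightarrow> even (c + z) \<Longrightarrow> odd ((23 * l + w) + c)" for w l z c :: nat by auto
  hence "odd ((23 * card ?L + w2) + (card A + 5 * card B))" using par even_card_AB by blast
  then obtain w where w: "w \<in> {25, 29, 23, 19}" "(w + (23 * card ?L + w2) + 6) mod 8 = (card A + 5 * card B) mod 8"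
    using odd_residue by blast
  have "card ?H \<le> card (Z - {v}) + length S2"
    using card_Un_le[of "Z - {v}" "set S2"] card_length[of S2] by linarith
  moreover have "card (Z - {v}) \<le> card Z" "card ?L \<le> card Z" by (rule card_mono; auto)+
  moreover have "length S2 \<le> 20" using S2 by (simp add: crossing_def)
  ultimately have "real (card ?H) \<le> real (card Z) + 20" "real (card ?L) \<le> real (card Z)" by linarith+
  hence H: "real (card ?H) \<le> 1 / 10 ^ 101 * real n" and L: "40 + 25 * real (card ?L) \<le> 1 / 50 * real n"
    using cardZ_le one_le by (simp only: pow_simps; linarith)+
  have "real (card ?H) \<le> 1 / 10 ^ 100 * real n" using H n_pos(1) by (simp only: pow_simps; linarith)
  moreover have "v \<notin> ?H" using S2 by (auto simp: crossing_def)
  ultimately obtain P where P: "crossing ?H w P" "v \<in> set P" using crossing_around[OF v, of ?H w] w(1) by auto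
  obtain S1 where S1: "piece S1" "starts A B S1" "ends B A S1" "set P \<union> ?L \<subseteq> set S1" "set S1 \<inter> (?H - ?L) = {}"
    "length S1 \<le> 20 + 25 * card ?L" "wt S1 = wt P + 23 * card ?L"
    using absorb[of P ?H ?L] P(1) H unfolding crossing_def by auto
  have wts: "wt S2 = w2" "wt P = w" using S2 P(1) by (simp_all add: crossing_def)
  show ?thesis
  proof (rule hamiltonian_of_crossings[OF S1(1-3)])
    show "piece S2" "starts A B S2" "ends B A S2" using S2 by (simp_all add: crossing_def)
    show "set S1 \<inter> set S2 = {}" using S1(5) by blast
    show "Z \<subseteq> set S1 \<union> set S2" using S1(4) P(2) by blast
    show "real (length S1 + length S2) \<le> 1 / 50 * real n"
      using S1(6) S2 L unfolding crossing_def by linarith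
    show "(wt S1 + wt S2 + 6) mod 8 = (card A + 5 * card B) mod 8"
      using w(2) unfolding S1(7) wts by (simp only: ac_simps)
  qed
qed

text \<open>The second crossing avoids a and b, so the bad pair is free to supply any even residue
  in the first. Even residues suffice because |A| + 5 |B| is even when \<open>Z\<close> is
  empty.\<close>

lemma hamiltonian_of_bad_pair:
  assumes Z: "Z = {}" and m: "a \<in> A" "b \<in> B" "\<not> g2 a b"
  shows "has_hamiltonian_cycle V E"
proof -
  obtain S2 where S2: "crossing {a, b} 36 S2" using crossing_exists[of "{a, b}"] Z card_insert_le_m1[of 2 "{b}" a] by auto
  have "even (36 + (card A + 5 * card B))" using even_card_AB Z by simp
  then obtain w where w: "w \<in> {36, 30, 42, 24}" "(w + 36 + 6) mod 8 = (card A + 5 * card B) mod 8"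
    using even_residue(1) by blast
  have l2: "length S2 \<le> 20" using S2 by (simp add: crossing_def)
  hence "card (set S2) \<le> 1000" using card_length[of S2] by linarith
  then obtain S1 where S1: "crossing (set S2) w S1"
    using crossing_of_bad_pair[OF m, of "set S2" w] small_set(2)[of "set S2"] S2 w(1) unfolding crossing_def by auto
  show ?thesis
  proof (rule hamiltonian_of_crossings)
    show "piece S1" "starts A B S1" "ends B A S1" "piece S2" "starts A B S2" "ends B A S2"
      "set S1 \<inter> set S2 = {}" using S1 S2 by (simp_all add: crossing_def)
    show "Z \<subseteq> set S1 \<union> set S2" using Z by simp
    have "length S1 + length S2 \<le> 40" using S1 l2 by (simp add: crossing_def)
    thus "real (length S1 + length S2) \<le> 1 / 50 * real n" using one_le by (simp only: pow_simps; linarith)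
    show "(wt S1 + wt S2 + 6) mod 8 = (card A + 5 * card B) mod 8"
      using S1 S2 w(2) by (simp add: crossing_def)
  qed
qed

text \<open>Two crossings of weight 36 leave an even residue, which at most six detours
  correct.\<close>

lemma hamiltonian_of_detours:
  assumes Z: "Z = {}" and ex: "\<And>F. finite F \<Longrightarrow> card F \<le> 400 \<Longrightarrow> \<exists>D. detour F D"
  shows "has_hamiltonian_cycle V E"
proof -
  obtain S2 where S2: "crossing {} 36 S2" using crossing_exists[of "{}"] Z by auto
  have l2: "length S2 \<le> 20" using S2 by (simp add: crossing_def)
  hence c2: "card (set S2) \<le> 20" using card_length[of S2] by linarith
  obtain P where P: "crossing (set S2) 36 P" using crossing_exists[of "set S2"] Z c2 by auto
  have "even (72 + (card A + 5 * card B))" using even_card_AB Z by simp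
  then obtain m where m: "m \<le> 6" "(23 * m + 72 + 6) mod 8 = (card A + 5 * card B) mod 8"
    using even_residue(2) by blast
  obtain S1 where S1: "piece S1" "starts A B S1" "ends B A S1" "set S1 \<inter> set S2 = {}" "length S1 \<le> 20 + 25 * m"
    "wt S1 = wt P + 23 * m"
    using prepend_detours[of P "set S2" m] P ex c2 m(1) unfolding crossing_def by auto
  have wts: "wt S2 = 36" "wt P = 36" using S2 P by (simp_all add: crossing_def)
  show ?thesis
  proof (rule hamiltonian_of_crossings[OF S1(1-3)])
    show "piece S2" "starts A B S2" "ends B A S2" using S2 by (simp_all add: crossing_def)
    show "set S1 \<inter> set S2 = {}" by (rule S1(4))
    show "Z \<subseteq> set S1 \<union> set S2" using Z by simp
    have "length S1 + length S2 \<le> 200" using S1(5) l2 m(1) by linarith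
    thus "real (length S1 + length S2) \<le> 1 / 50 * real n" using one_le n_pos(1) by (simp only: pow_simps; linarith)
    show "(wt S1 + wt S2 + 6) mod 8 = (card A + 5 * card B) mod 8"
      using m(2) unfolding S1(6) wts by (simp only: ac_simps) simp
  qed
qed

lemma hamiltonian: "has_hamiltonian_cycle V E"
proof (cases "Z = {}")
  case False
  thus ?thesis by (rule hamiltonian_flexible)
next
  case Z: True
  interpret sw: near_extremal V E n B A Z by (rule swapped)
  show ?thesis
  proof (cases "\<forall>a\<in>A. \<forall>b\<in>B. g2 a b")
    case False
    thus ?thesis using hamiltonian_of_bad_pair[OF Z] by blast
  next
    case good: True
    have g: "a \<in> A \<Longrightarrow> b \<in> B \<Longrightarrow> g2 a b" for a b using good by blast
    have either: "(\<exists>D. detour F D) \<or> (\<exists>D. sw.detour F D)" if F: "finite F" "card F \<le> 800" for F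
    proof -
      have c: "card F \<le> 1000" "Z \<subseteq> F" "card Z \<le> 1" using F(2) Z by simp_all
      have "usable F" using usable_exists[OF F(1) c] g by blast
      from detour_exists[OF this Z F(1) small_set(3)[OF c(1)] g] show ?thesis .
    qed
    \<comment> \<open>The kind of detour available may vary with the set to be avoided. If the A
      kind fails for one \<open>F0\<close>, it fails for every set containing \<open>F0\<close>, so
      enlarging each \<open>F\<close> by \<open>F0\<close> forces the B kind throughout; hence 800 =
      400 + 400.\<close>
    show ?thesis
    proof (cases "\<forall>F. finite F \<and> card F \<le> 400 \<longrightarrow> (\<exists>D. detour F D)")
      case True
      thus ?thesis using hamiltonian_of_detours[OF Z] by blast
    next
      case False
      then obtain F0 where F0: "finite F0" "card F0 \<le> 400" "\<nexists>D. detour F0 D" by blast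
      show ?thesis
      proof (rule sw.hamiltonian_of_detours[OF Z])
        fix F :: "'a set" assume F: "finite F" "card F \<le> 400"
        have "card (F \<union> F0) \<le> 800" using card_Un_le[of F F0] F(2) F0(2) by linarith
        moreover have "\<not> detour (F \<union> F0) D" for D
          using F0(3) unfolding detour_def by (auto simp: Int_Un_distrib)
        ultimately obtain D where "sw.detour (F \<union> F0) D" using either[of "F \<union> F0"] F(1) F0(1) by auto
        hence "sw.detour F D" unfolding sw.detour_def by auto
        thus "\<exists>D. sw.detour F D" by blast
      qed
    qed
  qed
qed

end

section \<open>From a balanced partition to a near-extremal one\<close>

lemma card_triples_change:
  assumes V: "finite V" "X \<subseteq> V" "Y \<subseteq> V" "T \<subseteq> V" "X' \<subseteq> V" "Y' \<subseteq> V" "T' \<subseteq> V"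
  shows "card {(x, y, z). x \<in> X \<and> y \<in> Y \<and> z \<in> T \<and> P x y z} \<le>
    card {(x, y, z). x \<in> X' \<and> y \<in> Y' \<and> z \<in> T' \<and> P x y z} +
    (card (X - X') + card (Y - Y') + card (T - T')) * card V ^ 2"
proof -
  let ?L = "{(x, y, z). x \<in> X \<and> y \<in> Y \<and> z \<in> T \<and> P x y z}"
  let ?R = "{(x, y, z). x \<in> X' \<and> y \<in> Y' \<and> z \<in> T' \<and> P x y z}"
  let ?X = "(X - X') \<times> V \<times> V" and ?Y = "V \<times> (Y - Y') \<times> V" and ?T = "V \<times> V \<times> (T - T')"
  have f: "finite (X - X')" "finite (Y - Y')" "finite (T - T')" using V finite_subset by blast+
  have R: "finite ?R" by (rule finite_subset[of _ "V \<times> V \<times> V"]) (use V in auto)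
  have "?L \<subseteq> ?R \<union> (?X \<union> (?Y \<union> ?T))" using V(2-4) by auto
  hence "card ?L \<le> card (?R \<union> (?X \<union> (?Y \<union> ?T)))" using R V(1) f by (intro card_mono) auto
  also have "\<dots> \<le> card ?R + (card ?X + (card ?Y + card ?T))"
    using card_Un_le[of ?R "?X \<union> (?Y \<union> ?T)"] card_Un_le[of ?X "?Y \<union> ?T"] card_Un_le[of ?Y ?T] by linarith
  also have "card ?X + (card ?Y + card ?T) = (card (X - X') + card (Y - Y') + card (T - T')) * card V ^ 2"
    by (simp add: card_cartesian_product power2_eq_square algebra_simps)
  finally show ?thesis .
qed

lemma card_quadruples_change:
  assumes V: "finite V" "X \<subseteq> V" "Y \<subseteq> V" "X' \<subseteq> V" "Y' \<subseteq> V"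
  shows "card {(x, x', y, y'). x \<in> X \<and> x' \<in> X \<and> y \<in> Y \<and> y' \<in> Y \<and> P x x' y y'} \<le>
    card {(x, x', y, y'). x \<in> X' \<and> x' \<in> X' \<and> y \<in> Y' \<and> y' \<in> Y' \<and> P x x' y y'} +
    2 * (card (X - X') + card (Y - Y')) * card V ^ 3"
proof -
  let ?L = "{(x, x', y, y'). x \<in> X \<and> x' \<in> X \<and> y \<in> Y \<and> y' \<in> Y \<and> P x x' y y'}"
  let ?R = "{(x, x', y, y'). x \<in> X' \<and> x' \<in> X' \<and> y \<in> Y' \<and> y' \<in> Y' \<and> P x x' y y'}"
  let ?X = "(X - X') \<times> V \<times> V \<times> V" and ?X' = "V \<times> (X - X') \<times> V \<times> V"
    and ?Y = "V \<times> V \<times> (Y - Y') \<times> V" and ?Y' = "V \<times> V \<times> V \<times> (Y - Y')"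
  have f: "finite (X - X')" "finite (Y - Y')" using V finite_subset by blast+
  have R: "finite ?R" by (rule finite_subset[of _ "V \<times> V \<times> V \<times> V"]) (use V in auto)
  have "?L \<subseteq> ?R \<union> (?X \<union> (?X' \<union> (?Y \<union> ?Y')))"
  proof
    fix q assume "q \<in> ?L"
    then obtain x x' y y' where q: "q = (x, x', y, y')" and m: "x \<in> X" "x' \<in> X" "y \<in> Y" "y' \<in> Y" "P x x' y y'"
      by auto
    moreover have "x \<in> V" "x' \<in> V" "y \<in> V" "y' \<in> V" using V(2,3) m by blast+
    ultimately show "q \<in> ?R \<union> (?X \<union> (?X' \<union> (?Y \<union> ?Y')))" by simp
  qed
  hence "card ?L \<le> card (?R \<union> (?X \<union> (?X' \<union> (?Y \<union> ?Y'))))" using R V(1) f by (intro card_mono) auto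
  also have "\<dots> \<le> card ?R + (card ?X + (card ?X' + (card ?Y + card ?Y')))"
    using card_Un_le[of ?R "?X \<union> (?X' \<union> (?Y \<union> ?Y'))"] card_Un_le[of ?X "?X' \<union> (?Y \<union> ?Y')"]
      card_Un_le[of ?X' "?Y \<union> ?Y'"] card_Un_le[of ?Y ?Y'] by linarith
  also have "card ?X + (card ?X' + (card ?Y + card ?Y')) = 2 * (card (X - X') + card (Y - Y')) * card V ^ 3"
    by (simp add: card_cartesian_product power3_eq_cube algebra_simps)
  finally show ?thesis .
qed

section \<open>Reassigning the vertices of a sparse balanced partition\<close>

locale sparse_partition =
  fixes V :: "'a set" and E :: "'a set set" and n :: nat and X Y :: "'a set"
  assumes finV: "finite V" and edge: "e \<in> E \<Longrightarrow> e \<subseteq> V \<and> card e = 4"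
    and codeg: "T \<subseteq> V \<Longrightarrow> card T = 3 \<Longrightarrow> n \<le> card {u \<in> V. insert u T \<in> E} + 1"
    and V_eq: "V = X \<union> Y" and disj: "X \<inter> Y = {}" and card: "card X = n" "card Y = n"
    and sparse: "real (card (edges_AABB E X)) \<le> 1 / 10 ^ 200 * real n ^ 4"
    and n_large: "10 ^ 200 \<le> n"
begin

lemma fin [simp]: "finite X" "finite Y" "finite V" "finite E"
proof -
  have "E \<subseteq> Pow V" using edge by blast
  thus "finite E" using finV by (simp add: finite_subset)
qed (use finV V_eq in auto)

lemma cardV: "card V = 2 * n"
  using V_eq disj card by (simp add: card_Un_disjoint)

lemma n_real: "(10::real) ^ 200 \<le> real n"
  using n_large by (metis of_nat_le_iff of_nat_numeral of_nat_power)

lemma n_pos [simp]: "0 < real n" "0 < n"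
proof -
  show "0 < real n" by (rule less_le_trans[OF _ n_real]) simp
  thus "0 < n" by simp
qed

lemma swapped: "sparse_partition V E n Y X"
proof
  have "edges_AABB E Y \<subseteq> edges_AABB E X"
  proof
    fix e assume "e \<in> edges_AABB E Y"
    hence e: "e \<in> E" "card (e \<inter> Y) = 2" by (simp_all add: edges_AABB_def)
    have "finite e" using edge[OF e(1)] by (intro card_ge_0_finite) simp
    moreover have "e = (e \<inter> X) \<union> (e \<inter> Y)" "(e \<inter> X) \<inter> (e \<inter> Y) = {}" using edge[OF e(1)] V_eq disj by auto
    ultimately have "card e = card (e \<inter> X) + card (e \<inter> Y)" by (metis card_Un_disjoint finite_Int)
    thus "e \<in> edges_AABB E X" using e edge[OF e(1)] by (simp add: edges_AABB_def)
  qed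
  hence "card (edges_AABB E Y) \<le> card (edges_AABB E X)"
    by (intro card_mono) (simp_all add: edges_AABB_def)
  thus "real (card (edges_AABB E Y)) \<le> 1 / 10 ^ 200 * real n ^ 4" using sparse by linarith
qed (use finV edge codeg V_eq disj card n_large in auto)

text \<open>All counts of triples and quadruples are of ordered ones.\<close>

definition d :: "'a set \<Rightarrow> 'a set \<Rightarrow> 'a \<Rightarrow> nat" where
  "d P Q v = card {(x, y, y'). x \<in> P \<and> y \<in> Q \<and> y' \<in> Q \<and> {v, x, y, y'} \<in> E}"

text \<open>For each x in \<open>X\<close> and y in \<open>Y\<close> other than v, the triple {v, x,
  y} has at least n - 1 extensions, and each is counted on one of the two sides. So no vertex is
  sparse on both, which makes the two cores disjoint.\<close>

lemma links_large:
  assumes v: "v \<in> V"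
  shows "1 / 2 * real n ^ 3 \<le> real (d X Y v + d Y X v)"
proof -
  let ?R = "(X - {v}) \<times> (Y - {v})"
  let ?S = "Sigma ?R (\<lambda>(x, y). {u \<in> Y. {v, x, y, u} \<in> E})"
  let ?T = "Sigma ?R (\<lambda>(x, y). {u \<in> X. {v, y, x, u} \<in> E})"
  have step: "n - 1 \<le> card {u \<in> Y. {v, x, y, u} \<in> E} + card {u \<in> X. {v, y, x, u} \<in> E}"
    if "x \<in> X - {v}" "y \<in> Y - {v}" for x y
  proof -
    have "x \<noteq> y" "{v, x, y} \<subseteq> V" using that v disj V_eq by auto
    hence "n \<le> card {u \<in> V. insert u {v, x, y} \<in> E} + 1" using that by (intro codeg) auto
    also have "{u \<in> V. insert u {v, x, y} \<in> E} = {u \<in> Y. {v, x, y, u} \<in> E} \<union> {u \<in> X. {v, y, x, u} \<in> E}"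
      unfolding V_eq by (auto simp: insert_commute)
    also have "card \<dots> + 1 \<le> card {u \<in> Y. {v, x, y, u} \<in> E} + card {u \<in> X. {v, y, x, u} \<in> E} + 1"
      using card_Un_le by (intro add_right_mono)
    finally show ?thesis by linarith
  qed
  have m: "n - 1 \<le> card (X - {v})" "n - 1 \<le> card (Y - {v})"
    using card by (simp_all add: card_Diff_singleton_if)
  have "(n - 1) * ((n - 1) * (n - 1)) \<le> (n - 1) * card ?R"
    unfolding card_cartesian_product using m by (intro mult_left_mono mult_mono) auto
  also have "\<dots> = (\<Sum>p\<in>?R. n - 1)" by simp
  also have "\<dots> \<le> (\<Sum>p\<in>?R. (case p of (x, y) \<Rightarrow> card {u \<in> Y. {v, x, y, u} \<in> E}) +
      (case p of (x, y) \<Rightarrow> card {u \<in> X. {v, y, x, u} \<in> E}))"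
    using step by (intro sum_mono) auto
  also have "\<dots> = card ?S + card ?T" by (simp add: sum.distrib split_def)
  also have "card ?S \<le> d X Y v" unfolding d_def
  proof (rule card_inj_on_le[of "\<lambda>((x, y), u). (x, y, u)"])
    show "finite {(x, y, y'). x \<in> X \<and> y \<in> Y \<and> y' \<in> Y \<and> {v, x, y, y'} \<in> E}"
      by (rule finite_subset[of _ "X \<times> Y \<times> Y"]) auto
  qed (auto simp: inj_on_def)
  also have "card ?T \<le> d Y X v" unfolding d_def
  proof (rule card_inj_on_le[of "\<lambda>((x, y), u). (y, x, u)"])
    show "finite {(x, y, y'). x \<in> Y \<and> y \<in> X \<and> y' \<in> X \<and> {v, x, y, y'} \<in> E}"
      by (rule finite_subset[of _ "Y \<times> X \<times> X"]) auto
  qed (auto simp: inj_on_def)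
  finally have "real ((n - 1) * ((n - 1) * (n - 1))) \<le> real (d X Y v + d Y X v)" by (simp only: of_nat_le_iff)
  moreover have "1 \<le> n" using n_large by (rule order_trans[rotated]) simp
  hence "real (n - 1) = real n - 1" by simp
  ultimately have "(real n - 1) ^ 3 \<le> real (d X Y v + d Y X v)" by (simp add: power3_eq_cube)
  moreover have "(9 / 10 * real n) ^ 3 \<le> (real n - 1) ^ 3"
  proof (rule power_mono)
    have "10 \<le> real n" by (rule order_trans[OF _ n_real]) simp
    thus "9 / 10 * real n \<le> real n - 1" by simp
  qed simp
  moreover have "1 / 2 * real n ^ 3 \<le> (9 / 10 * real n) ^ 3" by (simp add: power_mult_distrib power_divide)
  ultimately show ?thesis by linarith
qed

text \<open>An edge carries at most 4^4 = 256 ordered quadruples.\<close>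

lemma quadruples_le:
  "real (card {(x, x', y, y'). x \<in> X \<and> x' \<in> X \<and> y \<in> Y \<and> y' \<in> Y \<and> {x, x', y, y'} \<in> E}) \<le> 256 / 10 ^ 200 * real n ^ 4"
  (is "real (card ?Q) \<le> _")
proof -
  let ?F = "edges_AABB E X"
  have "?Q \<subseteq> (\<Union>e\<in>?F. e \<times> e \<times> e \<times> e)"
  proof
    fix q assume "q \<in> ?Q"
    then obtain x x' y y' where q: "q = (x, x', y, y')" and m: "x \<in> X" "x' \<in> X" "y \<in> Y" "y' \<in> Y"
      and e: "{x, x', y, y'} \<in> E" by auto
    have "y \<notin> X" "y' \<notin> X" using m disj by auto
    hence i: "{x, x', y, y'} \<inter> X = {x, x'}" using m by auto
    have "card {x, x', y, y'} = 4" using edge[OF e] by blast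
    hence "x \<noteq> x'" using card_length[of "[x, y, y']"] by auto
    hence "{x, x', y, y'} \<in> ?F" using e i by (simp add: edges_AABB_def)
    thus "q \<in> (\<Union>e\<in>?F. e \<times> e \<times> e \<times> e)" unfolding q by (rule UN_I) simp
  qed
  moreover have F: "e \<in> E" if "e \<in> ?F" for e using that by (simp add: edges_AABB_def)
  hence fe: "finite e" "card e = 4" if "e \<in> ?F" for e
    using edge[OF F[OF that]] finite_subset[OF _ finV] by blast+
  have finF: "finite ?F" by (simp add: edges_AABB_def)
  ultimately have "card ?Q \<le> card (\<Union>e\<in>?F. e \<times> e \<times> e \<times> e)" using fe by (intro card_mono) auto
  also have "\<dots> \<le> (\<Sum>e\<in>?F. card (e \<times> e \<times> e \<times> e))" by (rule card_UN_le[OF finF])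
  also have "\<dots> = (\<Sum>e\<in>?F. 256)" using fe by (intro sum.cong) (simp_all add: card_cartesian_product)
  also have "\<dots> = 256 * card ?F" by simp
  finally have "real (card ?Q) \<le> 256 * real (card ?F)" by linarith
  thus ?thesis using sparse by linarith
qed

text \<open>Averaging over the first vertex of a quadruple: the density 10^-200 leaves room for very
  few vertices of link density 2 / 10^38.\<close>

lemma few_exceptional:
  "real (card {v \<in> X. 2 / 10 ^ 38 * real n ^ 3 \<le> real (d X Y v)}) \<le> 1 / 10 ^ 150 * real n"
  (is "real (card ?S) \<le> _")
proof -
  let ?Q = "{(x, x', y, y'). x \<in> X \<and> x' \<in> X \<and> y \<in> Y \<and> y' \<in> Y \<and> {x, x', y, y'} \<in> E}"
  have "2 / 10 ^ 38 * real n ^ 3 * real (card ?S) \<le> real (card ?Q)"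
  proof (rule card_le_of_fibres[where X = X])
    show "finite ?Q" by (rule finite_subset[of _ "X \<times> X \<times> Y \<times> Y"]) auto
    show "2 / 10 ^ 38 * real n ^ 3 \<le> real (card {y. (v, y) \<in> ?Q})" if "v \<in> ?S" for v
    proof -
      have "{y. (v, y) \<in> ?Q} = {(x, y, y'). x \<in> X \<and> y \<in> Y \<and> y' \<in> Y \<and> {v, x, y, y'} \<in> E}" using that by auto
      thus ?thesis using that by (simp add: d_def)
    qed
  qed auto
  also note quadruples_le
  finally have "real n ^ 3 * (2 / 10 ^ 38 * real (card ?S)) \<le> real n ^ 3 * (256 / 10 ^ 200 * real n)"
    by (simp only: power3_eq_cube power4_eq_xxxx ac_simps)
  hence "2 / 10 ^ 38 * real (card ?S) \<le> 256 / 10 ^ 200 * real n" by (rule mult_left_le_imp_le) simp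
  thus ?thesis using n_pos by (simp only: pow_simps; linarith)
qed

text \<open>The threshold lies between the densities 10^-38 and 10^-37 of the near-extremal setting,
  so both bounds survive the small change from \<open>X\<close>, \<open>Y\<close> to the cores.
  Candidates come from all of \<open>V\<close>, so a vertex may change sides.\<close>

definition core :: "'a set \<Rightarrow> 'a set \<Rightarrow> 'a set" where
  "core P Q = {v \<in> V. real (d P Q v) < 2 / 10 ^ 38 * real n ^ 3}"

lemma core_close:
  shows "real (card (X - core X Y)) \<le> 1 / 10 ^ 150 * real n" "core X Y \<inter> core Y X = {}"
    "real (card (core Y X - Y)) \<le> 1 / 10 ^ 150 * real n"
proof -
  have subV: "X \<subseteq> V" "V \<subseteq> X \<union> Y" using V_eq by auto
  have "X - core X Y \<subseteq> {v \<in> X. 2 / 10 ^ 38 * real n ^ 3 \<le> real (d X Y v)}"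
    unfolding core_def using subV by auto
  hence "card (X - core X Y) \<le> card {v \<in> X. 2 / 10 ^ 38 * real n ^ 3 \<le> real (d X Y v)}"
    by (intro card_mono) auto
  thus 1: "real (card (X - core X Y)) \<le> 1 / 10 ^ 150 * real n" using few_exceptional by linarith
  show 2: "core X Y \<inter> core Y X = {}"
  proof (rule ccontr)
    assume "core X Y \<inter> core Y X \<noteq> {}"
    then obtain v where v: "v \<in> V" "real (d X Y v) < 2 / 10 ^ 38 * real n ^ 3"
      "real (d Y X v) < 2 / 10 ^ 38 * real n ^ 3" by (auto simp: core_def)
    have "0 < real n ^ 3" by simp
    thus False using links_large[OF v(1)] v(2,3) unfolding of_nat_add by (simp only: pow_simps; linarith)
  qed
  have "core Y X \<subseteq> V" by (simp add: core_def)
  \<comment> \<open>A newcomer in \<open>core Y X\<close> comes from \<open>X\<close>, and as the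
    cores are disjoint it is one of the few vertices of \<open>X\<close> outside
    \<open>core X Y\<close>.\<close>
  hence "core Y X - Y \<subseteq> X - core X Y" using 2 subV(2) by blast
  hence "card (core Y X - Y) \<le> card (X - core X Y)" by (intro card_mono) auto
  thus "real (card (core Y X - Y)) \<le> 1 / 10 ^ 150 * real n" using 1 by linarith
qed

text \<open>12 = 3 * 2^2: one of the three coordinates leaves its set while the other two range over
  2 n vertices.\<close>

lemma d_change:
  assumes "P \<subseteq> V" "Q \<subseteq> V" "P' \<subseteq> V" "Q' \<subseteq> V"
    and e: "real (card (P - P')) \<le> e * real n" "real (card (Q - Q')) \<le> e * real n"
  shows "real (d P Q v) \<le> real (d P' Q' v) + 12 * e * real n ^ 3"
proof -
  have "d P Q v \<le> d P' Q' v + (card (P - P') + card (Q - Q') + card (Q - Q')) * card V ^ 2"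
    unfolding d_def by (rule card_triples_change) (use assms(1-4) finV in blast)+
  hence "real (d P Q v) \<le> real (d P' Q' v + (card (P - P') + card (Q - Q') + card (Q - Q')) * card V ^ 2)"
    by (rule of_nat_mono)
  also have "\<dots> = real (d P' Q' v) + (real (card (P - P')) + real (card (Q - Q')) + real (card (Q - Q'))) * (2 * real n) ^ 2"
    unfolding cardV by simp
  also have "(real (card (P - P')) + real (card (Q - Q')) + real (card (Q - Q'))) * (2 * real n) ^ 2 \<le>
      (3 * (e * real n)) * (2 * real n) ^ 2"
    using e by (intro mult_right_mono) simp_all
  also have "\<dots> = 12 * e * real n ^ 3" by (simp add: power2_eq_square power3_eq_cube)
  finally show ?thesis by simp
qed

lemma quadruples_change:
  assumes "P \<subseteq> V" "Q \<subseteq> V" and e: "real (card (P - X)) \<le> e * real n" "real (card (Q - Y)) \<le> e * real n"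
  shows "real (card {(a, a', b, b'). a \<in> P \<and> a' \<in> P \<and> b \<in> Q \<and> b' \<in> Q \<and> {a, a', b, b'} \<in> E}) \<le>
    (256 / 10 ^ 200 + 32 * e) * real n ^ 4"
proof -
  let ?Q = "\<lambda>P Q. card {(a, a', b, b'). a \<in> P \<and> a' \<in> P \<and> b \<in> Q \<and> b' \<in> Q \<and> {a, a', b, b'} \<in> E}"
  have "X \<subseteq> V" "Y \<subseteq> V" using V_eq by auto
  hence "?Q P Q \<le> ?Q X Y + 2 * (card (P - X) + card (Q - Y)) * card V ^ 3"
    by (rule card_quadruples_change[OF finV assms(1,2)])
  hence "real (?Q P Q) \<le> real (?Q X Y + 2 * (card (P - X) + card (Q - Y)) * card V ^ 3)"
    by (rule of_nat_mono)
  also have "\<dots> = real (?Q X Y) + 2 * (real (card (P - X)) + real (card (Q - Y))) * (2 * real n) ^ 3"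
    unfolding cardV by simp
  also have "2 * (real (card (P - X)) + real (card (Q - Y))) * (2 * real n) ^ 3 \<le> (4 * (e * real n)) * (2 * real n) ^ 3"
    using e by (intro mult_right_mono) simp_all
  also have "\<dots> = 32 * e * real n ^ 4" by (simp add: power3_eq_cube power4_eq_xxxx)
  finally show ?thesis using quadruples_le unfolding distrib_right by linarith
qed

text \<open>The cores differ from \<open>X\<close> and \<open>Y\<close> by at most 10^-150 n
  vertices in either direction, so all counts change by far less than the gaps between the
  constants. A vertex in neither core has both links dense, as required of the exceptional
  set.\<close>

lemma near_extremal_core: "near_extremal V E n (core X Y) (core Y X) (V - core X Y - core Y X)"
proof -
  interpret sw: sparse_partition V E n Y X by (rule swapped)
  let ?A = "core X Y" and ?B = "core Y X" and ?Z = "V - core X Y - core Y X"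
  note close = core_close(1,3) sw.core_close(1,3)
  have sub: "?A \<subseteq> V" "?B \<subseteq> V" "X \<subseteq> V" "Y \<subseteq> V" by (auto simp: core_def) (use V_eq in auto)
  have finc: "finite ?A" "finite ?B" using sub(1,2) finite_subset[OF _ finV] by blast+
  have pos: "0 < real n ^ 3" "0 < real n ^ 4" by simp_all
  have large: "(1 - 1 / 10 ^ 110) * real n \<le> real (card S)"
    if "finite S" "card R = n" "real (card (R - S)) \<le> 1 / 10 ^ 150 * real n" "finite R" for S R :: "'a set"
  proof -
    have "card R \<le> card (S \<union> (R - S))" using that by (intro card_mono) auto
    hence "real n \<le> real (card S) + 1 / 10 ^ 150 * real n" using card_Un_le[of S "R - S"] that(2,3) by linarith
    moreover have "1 / 10 ^ 150 * real n \<le> 1 / 10 ^ 110 * real n" by (rule mult_right_mono) simp_all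
    ultimately show ?thesis by (simp only: left_diff_distrib mult_1)
  qed
  have upper: "x \<le> 1 / 10 ^ 37 * real n ^ 3"
    if "x \<le> y + 12 * (1 / 10 ^ 150) * real n ^ 3" "y < 2 / 10 ^ 38 * real n ^ 3" for x y
    using that pos by (simp only: pow_simps; linarith)
  have above: "1 / 10 ^ 38 * real n ^ 3 \<le> x"
    if "y \<le> x + 12 * (1 / 10 ^ 150) * real n ^ 3" "2 / 10 ^ 38 * real n ^ 3 \<le> y" for x y
    using that pos by (simp only: pow_simps; linarith)
  have lower: "2 / 10 ^ 38 * real n ^ 3 \<le> real (d P Q v)" if "v \<in> V - core P Q" for P Q v
    using that unfolding core_def mem_Collect_eq Diff_iff by argo
  show ?thesis
  proof
    show "finite V" "card V = 2 * n" "10 ^ 200 \<le> n" by (fact finV cardV n_large)+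
    show "e \<subseteq> V \<and> card e = 4" if "e \<in> E" for e using edge[OF that] .
    show "n \<le> card {u \<in> V. insert u T \<in> E} + 1" if "T \<subseteq> V" "card T = 3" for T using codeg[OF that] .
    show "V = ?A \<union> ?B \<union> ?Z" "?A \<inter> ?B = {}" "?A \<inter> ?Z = {}" "?B \<inter> ?Z = {}"
      using sub(1,2) core_close(2) by auto
    show "(1 - 1 / 10 ^ 110) * real n \<le> real (card ?A)" "(1 - 1 / 10 ^ 110) * real n \<le> real (card ?B)"
      using large[OF finc(1) card(1) close(1)] large[OF finc(2) card(2) close(3)] by simp_all
    have "?Z \<subseteq> (X - ?A) \<union> (Y - ?B)" using V_eq by auto
    hence "card ?Z \<le> card ((X - ?A) \<union> (Y - ?B))" by (intro card_mono) auto
    hence "real (card ?Z) \<le> 2 / 10 ^ 150 * real n" using card_Un_le[of "X - ?A" "Y - ?B"] close(1,3) by linarith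
    also have "\<dots> \<le> 1 / 10 ^ 110 * real n" by (rule mult_right_mono) simp_all
    finally show "real (card ?Z) \<le> 1 / 10 ^ 110 * real n" .
    show "real (card {(a, b, b'). a \<in> ?A \<and> b \<in> ?B \<and> b' \<in> ?B \<and> {v, a, b, b'} \<in> E}) \<le> 1 / 10 ^ 37 * real n ^ 3"
      if "v \<in> ?A" for v
    proof -
      have "real (d ?A ?B v) \<le> real (d X Y v) + 12 * (1 / 10 ^ 150) * real n ^ 3"
        by (rule d_change[OF sub(1,2,3,4) close(4,2)])
      moreover have "real (d X Y v) < 2 / 10 ^ 38 * real n ^ 3" using that by (simp add: core_def)
      ultimately have "real (d ?A ?B v) \<le> 1 / 10 ^ 37 * real n ^ 3" by (rule upper)
      thus ?thesis by (simp only: d_def)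
    qed
    show "real (card {(b, a, a'). b \<in> ?B \<and> a \<in> ?A \<and> a' \<in> ?A \<and> {v, b, a, a'} \<in> E}) \<le> 1 / 10 ^ 37 * real n ^ 3"
      if "v \<in> ?B" for v
    proof -
      have "real (d ?B ?A v) \<le> real (d Y X v) + 12 * (1 / 10 ^ 150) * real n ^ 3"
        by (rule d_change[OF sub(2,1,4,3) close(2,4)])
      moreover have "real (d Y X v) < 2 / 10 ^ 38 * real n ^ 3" using that by (simp add: core_def)
      ultimately have "real (d ?B ?A v) \<le> 1 / 10 ^ 37 * real n ^ 3" by (rule upper)
      thus ?thesis by (simp only: d_def)
    qed
    show "1 / 10 ^ 38 * real n ^ 3 \<le> real (card {(b, a, a'). b \<in> ?B \<and> a \<in> ?A \<and> a' \<in> ?A \<and> {v, b, a, a'} \<in> E})"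
      if "v \<in> ?Z" for v
    proof -
      have "real (d Y X v) \<le> real (d ?B ?A v) + 12 * (1 / 10 ^ 150) * real n ^ 3"
        by (rule d_change[OF sub(4,3,2,1) close(3,1)])
      moreover have "2 / 10 ^ 38 * real n ^ 3 \<le> real (d Y X v)" by (rule lower) (use that in blast)
      ultimately have "1 / 10 ^ 38 * real n ^ 3 \<le> real (d ?B ?A v)" by (rule above)
      thus ?thesis by (simp only: d_def)
    qed
    show "1 / 10 ^ 38 * real n ^ 3 \<le> real (card {(a, b, b'). a \<in> ?A \<and> b \<in> ?B \<and> b' \<in> ?B \<and> {v, a, b, b'} \<in> E})"
      if "v \<in> ?Z" for v
    proof -
      have "real (d X Y v) \<le> real (d ?A ?B v) + 12 * (1 / 10 ^ 150) * real n ^ 3"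
        by (rule d_change[OF sub(3,4,1,2) close(1,3)])
      moreover have "2 / 10 ^ 38 * real n ^ 3 \<le> real (d X Y v)" by (rule lower) (use that in blast)
      ultimately have "1 / 10 ^ 38 * real n ^ 3 \<le> real (d ?A ?B v)" by (rule above)
      thus ?thesis by (simp only: d_def)
    qed
    have "real (card {(a, a', b, b'). a \<in> ?A \<and> a' \<in> ?A \<and> b \<in> ?B \<and> b' \<in> ?B \<and> {a, a', b, b'} \<in> E}) \<le>
        (256 / 10 ^ 200 + 32 * (1 / 10 ^ 150)) * real n ^ 4"
      by (rule quadruples_change[OF sub(1,2) close(4,2)])
    also have "\<dots> \<le> 1 / 10 ^ 108 * real n ^ 4" by (rule mult_right_mono) simp_all
    finally show "real (card {(a, a', b, b'). a \<in> ?A \<and> a' \<in> ?A \<and> b \<in> ?B \<and> b' \<in> ?B \<and> {a, a', b, b'} \<in> E})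
      \<le> 1 / 10 ^ 108 * real n ^ 4" .
  qed
qed

end

lemma sparse_balanced_partition:
  assumes G: "four_graph V E" "card V = 2 * n" and n: "10 ^ 200 \<le> n"
    and b: "real (balanced_min n V E) < 1 / 10 ^ 200 * real n ^ 4" and c: "real (min_codegree3 V E) \<ge> real n - 1"
  shows "\<exists>X Y. sparse_partition V E n X Y"
proof -
  have fin: "finite V" and e: "\<And>e. e \<in> E \<Longrightarrow> e \<subseteq> V \<and> card e = 4" using G(1) by (auto simp: four_graph_def)
  let ?N = "{card (edges_AABB E A) | A B. A \<union> B = V \<and> A \<inter> B = {} \<and> card A = n \<and> card B = n}"
  have "?N \<subseteq> (\<lambda>A. card (edges_AABB E A)) ` Pow V" by auto
  hence fN: "finite ?N" using fin by (simp add: finite_subset)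
  obtain A where A: "A \<subseteq> V" "card A = n" using obtain_subset_with_card_n[of n V] G(2) by auto
  hence "card (V - A) = n" using G(2) fin by (simp add: card_Diff_subset finite_subset)
  hence "card (edges_AABB E A) \<in> ?N" using A by blast
  \<comment> \<open>The minimum is attained because the set of values is finite and, as
    \<open>V\<close> has 2 n vertices, not empty.\<close>
  hence "Min ?N \<in> ?N" using fN by (intro Min_in) auto
  then obtain X Y where XY: "X \<union> Y = V" "X \<inter> Y = {}" "card X = n" "card Y = n"
    "balanced_min n V E = card (edges_AABB E X)" unfolding balanced_min_def by auto
  have "sparse_partition V E n X Y"
  proof
    show "n \<le> card {u \<in> V. insert u T \<in> E} + 1" if T: "T \<subseteq> V" "card T = 3" for T
    proof -
      have "finite {T. T \<subseteq> V \<and> card T = 3}" using fin by simp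
      hence "min_codegree3 V E \<le> card {x \<in> V. T \<union> {x} \<in> E}"
        unfolding min_codegree3_def using T by (intro Min_le) auto
      thus ?thesis using c by simp
    qed
  qed (use fin e XY n b in auto)
  thus ?thesis by blast
qed

theorem theorem4p1:
  "\<exists>\<epsilon>\<^sub>0::real. \<epsilon>\<^sub>0 > 0 \<and>
     (\<exists>N::nat. \<forall>n\<ge>N. \<forall>(V::'a set) (E::'a set set).
        four_graph V E \<longrightarrow> card V = 2 * n \<longrightarrow>
        real (balanced_min n V E) < \<epsilon>\<^sub>0 * real n ^ 4 \<longrightarrow>
        real (min_codegree3 V E) \<ge> real n - 1 \<longrightarrow>
        has_hamiltonian_cycle V E)"
proof (intro exI conjI allI impI)
  \<comment> \<open>The witnesses 1 / 10^200 for the density and 10^200 for the size are the two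
    constants of \<open>sparse_partition\<close>.\<close>
  show "0 < (1 / 10 ^ 200 :: real)" by simp
  fix n :: nat and V :: "'a set" and E :: "'a set set"
  assume "10 ^ 200 \<le> n" "four_graph V E" "card V = 2 * n"
    "real (balanced_min n V E) < 1 / 10 ^ 200 * real n ^ 4" "real (min_codegree3 V E) \<ge> real n - 1"
  then obtain X Y where "sparse_partition V E n X Y" using sparse_balanced_partition by blast
  then interpret sparse_partition V E n X Y .
  show "has_hamiltonian_cycle V E" by (rule near_extremal.hamiltonian[OF near_extremal_core])
qed

end
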